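(* Let $k$ be a positive integer, and let $T,\nu_1,\nu_2$ be positive real numbers with $\nu_1\le\nu_2$. Let $c:(0,T)\to\mathbb R$ be a measurable function with $\nu_1\le c(t)\le\nu_2$ for almost every $t\in(0,T)$, and let $\gamma\in C^k([0,T])$ satisfy $1/\nu_2\le\gamma(t)\le1/\nu_1$ for every $t\in[0,T]$. There exist four positive constants $A_k,B_k,C_k,\varepsilon_k$, depending only on $k,T,\nu_1,\nu_2$, such that the following holds. For every $\lambda>0$ such that $$|\gamma^{(j)}(t)|\le\varepsilon_k\lambda^j\qquad\forall t\in[0,T],\quad j=1,\dots,k-1,$$ and for every solution $u_\lambda$ of $u_\lambda''(t)+\lambda^2c(t)^2u_\lambda(t)=0$ on $[0,T]$, the energy $\mathcal E_{k,\gamma}$ (defined in the context) satisfies $$A_kE_\lambda(t)\le\mathcal E_{k,\gamma}(t)\le B_kE_\lambda(t)\qquad\forall t\in[0,T],$$ where $E_\lambda(t):=u_\lambda'(t)^2+\lambda^2u_\lambda(t)^2$, and $$\mathcal E_{k,\gamma}(0)\exp\left\{-C_k\left[\frac1{\lambda^{k-1}}+\mathcal F_{k,\lambda}(\gamma;c)\right]\right\}\le\mathcal E_{k,\gamma}(t)\le\mathcal E_{k,\gamma}(0)\exp\left\{C_k\left[\frac1{\lambda^{k-1}}+\mathcal F_{k,\lambda}(\gamma;c)\right]\right\}$$ for every $t\in[0,T]$, where $$\mathcal F_{k,\lambda}(\gamma;c):=\frac1{\lambda^{k-1}}\int_0^T|\gamma^{(k)}(t)|\,dt+\lambda\int_0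^T\left|\gamma(t)-\frac1{c(t)}\right|dt.$$
   Context: Solutions: since $c$ is only measurable and bounded, a solution is a function $u_\lambda\in C^1([0,T])$ with $u_\lambda'$ absolutely continuous satisfying the equation for almost every $t$. Homogeneous differential polynomials: a differential monomial of differential weight $r\ge1$ is a monomial $X_0^m\prod_{\ell=1}^nX_{j_\ell}$ in formal variables $X_0,\dots,X_r$, with $m\ge0$, $n\ge1$ integers, and positive integers $j_1,\dots,j_n$ with $j_1+\dots+j_n=r$. A homogeneous differential polynomial of differential weight $r$ is a finite real linear combination of such monomials. Its evaluation along a function $\gamma$ of class $C^r$ is $P[\gamma](t):=P(\gamma(t),\gamma'(t),\dots,\gamma^{(r)}(t))$. Coefficients: set $a_1:=\gamma$. For $i\ge2$, $a_i:=P_i[\gamma]$, where $P_i$ is the homogeneous differential polynomial of differential weight $2i-2$ (universal, i.e. independent of $\gamma$) such that, for every positive sufficiently smooth $\gamma$, $$\left(\frac{a_{i}}{\gamma}\right)'=-\frac14\gamma\,a_{i-1}'''\qquad\forall i\ge2.$$ (Such polynomials exist; the recursion alone determines $a_i$ only up to adding a constant multiple of $\gamma$, and the homogeneity requirement selects the representative. For example $a_2=-\frac{\gamma}{4}\left(\gamma\gamma''-\frac12(\gamma')^2\right)$.) Only the $a_i$ with $i\le\max\{1,\lfloor k/2\rfloor\}$ enter in $\mathcal E_{k,\gamma}$. Energies: for a solution $u_\lambda$, $$\mathcal E_{1,\gamma}:=a_1\left((u_\lambda')^2+\lambda^2\gamma^{-2}u_\lambda^2\right),\qquad \mathcal E_{2,\gamma}:=\mathcal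 E_{1,\gamma}-a_1'u_\lambda u_\lambda',\qquad \mathcal E_{3,\gamma}:=\mathcal E_{2,\gamma}+\tfrac12a_1''u_\lambda^2,$$ and, for every $i\ge2$, $$\mathcal E_{2i,\gamma}:=\mathcal E_{2i-1,\gamma}+\frac1{\lambda^{2i-2}}\left[a_i\left((u_\lambda')^2+\lambda^2\gamma^{-2}u_\lambda^2\right)-a_i'u_\lambda u_\lambda'\right],$$ $$\mathcal E_{2i+1,\gamma}:=\mathcal E_{2i,\gamma}+\frac12\frac1{\lambda^{2i-2}}a_i''u_\lambda^2.$$ *)

theory Defs
  imports "HOL-Analysis.Analysis" "HOL-Library.Poly_Mapping" "HOL-Library.Multiset"
begin

section \<open>Functions on a compact interval\<close>

(* Derivatives are taken within S, hence are one-sided at the endpoints of an interval. *)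
primrec nth_deriv_on :: "real set \<Rightarrow> nat \<Rightarrow> (real \<Rightarrow> real) \<Rightarrow> real \<Rightarrow> real" where
  "nth_deriv_on S 0 f = f"
| "nth_deriv_on S (Suc j) f = (\<lambda>t. vector_derivative (nth_deriv_on S j f) (at t within S))"

definition Ck_on :: "nat \<Rightarrow> real set \<Rightarrow> (real \<Rightarrow> real) \<Rightarrow> bool" where
  "Ck_on k S f \<longleftrightarrow>
     (\<forall>j<k. nth_deriv_on S j f differentiable_on S) \<and> continuous_on S (nth_deriv_on S k f)"

(* The classical notion for real functions; the library's absolutely_continuous is about
   measures.  D is a finite set of intervals given by their endpoints, with pairwise disjoint
   interiors. *)
definition abs_cont_on :: "real set \<Rightarrow> (real \<Rightarrow> real) \<Rightarrow> bool" where
  "abs_cont_on S f \<longleftrightarrow>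
     (\<forall>e>0. \<exists>d>0. \<forall>D :: (real \<times> real) set.
        finite D \<longrightarrow> (\<forall>(a, b)\<in>D. a \<le> b \<and> {a..b} \<subseteq> S) \<longrightarrow>
        disjoint_family_on (\<lambda>(a, b). {a<..<b}) D \<longrightarrow> (\<Sum>(a, b)\<in>D. b - a) < d \<longrightarrow>
        (\<Sum>(a, b)\<in>D. \<bar>f b - f a\<bar>) < e)"

definition is_solution :: "real \<Rightarrow> (real \<Rightarrow> real) \<Rightarrow> real \<Rightarrow> (real \<Rightarrow> real) \<Rightarrow> bool" where
  "is_solution T c lam u \<longleftrightarrow>
     Ck_on 1 {0..T} u \<and> abs_cont_on {0..T} (nth_deriv_on {0..T} 1 u) \<and>
     (AE t\<in>{0<..<T} in lebesgue.
        \<exists>w. (nth_deriv_on {0..T} 1 u has_real_derivative w) (at t) \<and>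
            w + lam\<^sup>2 * (c t)\<^sup>2 * u t = 0)"

section \<open>Homogeneous differential polynomials\<close>

(* (m, J) encodes the monomial X_0^m * (\<Prod>j\<in>#J. X_j). *)
type_synonym diff_monomial = "nat \<times> nat multiset"
type_synonym diff_poly = "diff_monomial \<Rightarrow>\<^sub>0 real"

definition has_diff_weight :: "nat \<Rightarrow> diff_monomial \<Rightarrow> bool" where
  "has_diff_weight r M \<longleftrightarrow>
     snd M \<noteq> {#} \<and> (\<forall>j\<in>#snd M. 1 \<le> j) \<and> sum_mset (snd M) = r"

definition homogeneous :: "nat \<Rightarrow> diff_poly \<Rightarrow> bool" where
  "homogeneous r P \<longleftrightarrow> (\<forall>M\<in>Poly_Mapping.keys P. has_diff_weight r M)"

definition eval_poly :: "diff_poly \<Rightarrow> (nat \<Rightarrow> real) \<Rightarrow> real" where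
  "eval_poly P x =
     (\<Sum>M\<in>Poly_Mapping.keys P. Poly_Mapping.lookup P M * x 0 ^ fst M * (\<Prod>j\<in>#snd M. x j))"

definition eval_along :: "real set \<Rightarrow> diff_poly \<Rightarrow> (real \<Rightarrow> real) \<Rightarrow> real \<Rightarrow> real" where
  "eval_along S P \<gamma> t = eval_poly P (\<lambda>j. nth_deriv_on S j \<gamma> t)"

section \<open>Coefficients\<close>

(* \<gamma> itself is not the value of a homogeneous polynomial of positive weight, so a_1 is
   treated separately; P is used only from index 2 on. *)
definition coeff_of :: "(nat \<Rightarrow> diff_poly) \<Rightarrow> real set \<Rightarrow> (real \<Rightarrow> real) \<Rightarrow> nat \<Rightarrow> real \<Rightarrow> real" where
  "coeff_of P S \<gamma> i = (if i \<le> 1 then \<gamma> else eval_along S (P i) \<gamma>)"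

(* Both sides of the recursion involve derivatives of \<gamma> of order at most 2 * i - 1. *)
definition coeff_family :: "(nat \<Rightarrow> diff_poly) \<Rightarrow> bool" where
  "coeff_family P \<longleftrightarrow>
     (\<forall>i\<ge>2. homogeneous (2 * i - 2) (P i) \<and>
        (\<forall>T \<gamma>. 0 < T \<longrightarrow> Ck_on (2 * i - 1) {0..T} \<gamma> \<longrightarrow> (\<forall>t\<in>{0..T}. 0 < \<gamma> t) \<longrightarrow>
           (\<forall>t\<in>{0..T}.
              ((\<lambda>s. coeff_of P {0..T} \<gamma> i s / \<gamma> s) has_real_derivative
                 - (1/4) * \<gamma> t * nth_deriv_on {0..T} 3 (coeff_of P {0..T} \<gamma> (i - 1)) t)
              (at t within {0..T}))))"

(* On constant \<gamma> a homogeneous polynomial of positive weight vanishes, so the recursion leaves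
   no freedom in the members of index \<ge> 2. *)
definition coeff_polys :: "nat \<Rightarrow> diff_poly" where
  "coeff_polys = (SOME P. coeff_family P)"

abbreviation a_coeff :: "real set \<Rightarrow> (real \<Rightarrow> real) \<Rightarrow> nat \<Rightarrow> real \<Rightarrow> real" where
  "a_coeff \<equiv> coeff_of coeff_polys"

section \<open>Energies\<close>

definition energy0 :: "real \<Rightarrow> real \<Rightarrow> (real \<Rightarrow> real) \<Rightarrow> real \<Rightarrow> real" where
  "energy0 T lam u t = (nth_deriv_on {0..T} 1 u t)\<^sup>2 + lam\<^sup>2 * (u t)\<^sup>2"

(* energy T \<gamma> lam u k is the energy of index k; the value for k = 0 is a dummy. *)
primrec energy :: "real \<Rightarrow> (real \<Rightarrow> real) \<Rightarrow> real \<Rightarrow> (real \<Rightarrow> real) \<Rightarrow> nat \<Rightarrow> real \<Rightarrow> real" where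
  "energy T \<gamma> lam u 0 = (\<lambda>t. 0)"
| "energy T \<gamma> lam u (Suc n) = (\<lambda>t.
     let S = {0..T};
         i = Suc n div 2;
         a = a_coeff S \<gamma>;
         u' = nth_deriv_on S 1 u t;
         Q = u'\<^sup>2 + lam\<^sup>2 * (1 / (\<gamma> t)\<^sup>2) * (u t)\<^sup>2
     in if Suc n = 1 then a 1 t * Q
        else if Suc n = 2 then energy T \<gamma> lam u n t - nth_deriv_on S 1 (a 1) t * u t * u'
        else if Suc n = 3 then energy T \<gamma> lam u n t + 1/2 * nth_deriv_on S 2 (a 1) t * (u t)\<^sup>2
        else if even (Suc n) then
          energy T \<gamma> lam u n t
            + 1 / lam ^ (2 * i - 2) * (a i t * Q - nth_deriv_on S 1 (a i) t * u t * u')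
        else
          energy T \<gamma> lam u n t
            + 1/2 * (1 / lam ^ (2 * i - 2)) * nth_deriv_on S 2 (a i) t * (u t)\<^sup>2)"

definition error_term :: "real \<Rightarrow> nat \<Rightarrow> real \<Rightarrow> (real \<Rightarrow> real) \<Rightarrow> (real \<Rightarrow> real) \<Rightarrow> real" where
  "error_term T k lam \<gamma> c =
     1 / lam ^ (k - 1) * (LINT t:{0..T}|lebesgue. \<bar>nth_deriv_on {0..T} k \<gamma> t\<bar>)
     + lam * (LINT t:{0<..<T}|lebesgue. \<bar>\<gamma> t - 1 / c t\<bar>)"

end

theory Submission
  imports Defs
begin

text \<open>The energies are truncations of a formal conserved quantity of \<open>u'' + \<lambda>\<^sup>2 \<gamma>\<^sup>-\<^sup>2 u = 0\<close>: the recursion for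
  the \<open>a\<^sub>i\<close> makes the derivatives of consecutive blocks telescope, so that up to terms containing
  \<open>c\<^sup>2 - \<gamma>\<^sup>-\<^sup>2\<close> only one term \<open>\<lambda>\<^sup>-\<^sup>(\<^sup>k\<^sup>-\<^sup>1\<^sup>) W[\<gamma>]\<close> with \<open>W\<close> homogeneous of weight \<open>k\<close> survives. The
  \<open>a\<^sub>i\<close> are polynomial because their generating series satisfies a quadratic first integral of the
  recursion. A Gagliardo--Nirenberg type inequality bounds the integral of \<open>\<bar>W[\<gamma>]\<bar>\<close> by
  \<open>C (1 + \<integral>\<bar>\<gamma>\<^sup>(\<^sup>k\<^sup>)\<bar>)\<close>, with \<open>C\<close> independent of \<open>\<lambda>\<close>, and Gronwall's lemma concludes.\<close>

section \<open>Differential polynomials as functions on jets\<close>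

text \<open>The recursion asks for a primitive of \<gamma> a''', which is not visibly the derivative
  of a polynomial. With the formal series A = \<Sum> a_(n+1) \<mu>^n and B = A / \<gamma> it reads
  B' = -(\<mu>/4) \<gamma> A'''. Multiplied by 2 B it becomes exact, because A A''' = (A A'' - A'^2
  / 2)'. As B starts with 1, the integrated identity yields each coefficient polynomially from the
  earlier ones.

  Two obstacles shape the analysis. Pointwise, smallness bounds the products of intermediate
  derivatives in W only by a multiple of \<lambda>^k, which would leave a term of order \<lambda> in
  the exponent; they must be controlled in L^1 through \<gamma>^(k) and the sup bound of \<gamma>.
  And u' is merely absolutely continuous, with the equation valid almost everywhere, so Gronwall has
  to work for functions differentiable off a null set whose increments are controlled by those of
  u'.

  Smallness keeps all of the energy except its leading term within a fraction of
  \<open>energy0\<close>.\<close>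

definition jet :: "real set \<Rightarrow> (real \<Rightarrow> real) \<Rightarrow> real \<Rightarrow> nat \<Rightarrow> real" where
  "jet S \<gamma> t = (\<lambda>j. nth_deriv_on S j \<gamma> t)"

text \<open>The total derivative sending x_j to x_(j+1), encoded as one directional derivative at s
  = 0, which avoids partial derivatives in infinitely many variables.\<close>

definition total_deriv :: "((nat \<Rightarrow> real) \<Rightarrow> real) \<Rightarrow> (nat \<Rightarrow> real) \<Rightarrow> real" where
  "total_deriv F x = deriv (\<lambda>s. F (\<lambda>j. x j + s * x (Suc j))) 0"

inductive diff_hom :: "nat \<Rightarrow> ((nat \<Rightarrow> real) \<Rightarrow> real) \<Rightarrow> bool" where
  const: "diff_hom 0 (\<lambda>x. c)"
| coord: "diff_hom j (\<lambda>x. x j)"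
| add: "diff_hom r F \<Longrightarrow> diff_hom r G \<Longrightarrow> diff_hom r (\<lambda>x. F x + G x)"
| mult: "diff_hom r F \<Longrightarrow> diff_hom s G \<Longrightarrow> diff_hom (r + s) (\<lambda>x. F x * G x)"

lemma diff_hom_scale: "diff_hom r F \<Longrightarrow> diff_hom r (\<lambda>x. c * F x)"
  using diff_hom.mult[OF diff_hom.const[of c], of r F] by simp

lemma diff_hom_zero: "diff_hom r (\<lambda>x. 0)"
  using diff_hom_scale[OF diff_hom.coord[of r], of 0] by simp

lemma diff_hom_diff: "diff_hom r F \<Longrightarrow> diff_hom r G \<Longrightarrow> diff_hom r (\<lambda>x. F x - G x)"
  using diff_hom.add[OF _ diff_hom_scale[of r G "-1"], of F] by simp

lemma diff_hom_sum:
  assumes "\<And>i. i \<in> I \<Longrightarrow> diff_hom r (F i)"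
  shows "diff_hom r (\<lambda>x. \<Sum>i\<in>I. F i x)"
  using assms
proof (induction I rule: infinite_finite_induct)
  case (insert i I)
  then show ?case using diff_hom.add[of r "F i" "\<lambda>x. \<Sum>i\<in>I. F i x"] by simp
qed (simp_all add: diff_hom_zero)

lemma nth_deriv_on_has_derivative:
  assumes "Ck_on K S \<gamma>" "j < K" "t \<in> S"
  shows "((\<lambda>t. jet S \<gamma> t j) has_real_derivative jet S \<gamma> t (Suc j)) (at t within S)"
  using assms unfolding Ck_on_def jet_def differentiable_on_def
  by (simp add: vector_derivative_works has_real_derivative_iff_has_vector_derivative)

lemma total_deriv_eqI:
  "((\<lambda>s. F (\<lambda>j. x j + s * x (Suc j))) has_real_derivative d) (at 0) \<Longrightarrow> total_deriv F x = d"
  unfolding total_deriv_def by (rule DERIV_imp_deriv)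

text \<open>The clause on curves and the one on \<open>total_deriv\<close> have to be established by the
  same induction, since \<open>diff_hom\<close> functions have no unique representation.\<close>

lemma diff_hom_total_deriv_aux:
  assumes "diff_hom r F"
  shows "diff_hom (Suc r) (total_deriv F) \<and>
    (\<forall>x. ((\<lambda>s. F (\<lambda>j. x j + s * x (Suc j))) has_real_derivative total_deriv F x) (at 0)) \<and>
    (\<forall>K S \<gamma> t. Ck_on K S \<gamma> \<longrightarrow> r < K \<longrightarrow> t \<in> S \<longrightarrow>
      ((\<lambda>t. F (jet S \<gamma> t)) has_real_derivative total_deriv F (jet S \<gamma> t)) (at t within S))"
  using assms
proof induction
  case (const c)
  have e: "total_deriv (\<lambda>x. c) = (\<lambda>x. 0)"
    by (rule ext, rule total_deriv_eqI) auto
  show ?case unfolding e by (auto intro: diff_hom_zero)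
next
  case (coord j)
  have d: "((\<lambda>s. x j + s * x (Suc j)) has_real_derivative x (Suc j)) (at 0)" for x :: "nat \<Rightarrow> real"
    by (auto intro!: derivative_eq_intros)
  have e: "total_deriv (\<lambda>x. x j) = (\<lambda>x. x (Suc j))"
    by (rule ext, rule total_deriv_eqI, rule d)
  show ?case unfolding e using d nth_deriv_on_has_derivative by (auto intro: diff_hom.coord)
next
  case (add r F G)
  have d: "((\<lambda>s. F (\<lambda>j. x j + s * x (Suc j)) + G (\<lambda>j. x j + s * x (Suc j)))
      has_real_derivative total_deriv F x + total_deriv G x) (at 0)" for x
    using add.IH by (auto intro!: derivative_eq_intros)
  have e: "total_deriv (\<lambda>x. F x + G x) = (\<lambda>x. total_deriv F x + total_deriv G x)"
    by (rule ext, rule total_deriv_eqI, rule d)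
  show ?case unfolding e using d add.IH by (auto intro!: diff_hom.add derivative_intros)
next
  case (mult r F s G)
  have d: "((\<lambda>s. F (\<lambda>j. x j + s * x (Suc j)) * G (\<lambda>j. x j + s * x (Suc j)))
      has_real_derivative total_deriv F x * G x + F x * total_deriv G x) (at 0)" for x
    using DERIV_mult[OF mult.IH(1)[THEN conjunct2, THEN conjunct1, rule_format, of x]
        mult.IH(2)[THEN conjunct2, THEN conjunct1, rule_format, of x]]
    by (simp add: mult.commute)
  have e: "total_deriv (\<lambda>x. F x * G x) = (\<lambda>x. total_deriv F x * G x + F x * total_deriv G x)"
    by (rule ext, rule total_deriv_eqI, rule d)
  have "diff_hom (Suc (r + s)) (\<lambda>x. total_deriv F x * G x + F x * total_deriv G x)"
    using diff_hom.mult[of "Suc r" "total_deriv F" s G] diff_hom.mult[of r F "Suc s" "total_deriv G"]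
      mult by (auto intro!: diff_hom.add)
  moreover have "((\<lambda>t. F (jet S \<gamma> t) * G (jet S \<gamma> t)) has_real_derivative
        total_deriv F (jet S \<gamma> t) * G (jet S \<gamma> t) + F (jet S \<gamma> t) * total_deriv G (jet S \<gamma> t))
      (at t within S)" if "Ck_on K S \<gamma>" "r + s < K" "t \<in> S" for K S \<gamma> t
  proof -
    have "((\<lambda>t. F (jet S \<gamma> t)) has_real_derivative total_deriv F (jet S \<gamma> t)) (at t within S)"
      "((\<lambda>t. G (jet S \<gamma> t)) has_real_derivative total_deriv G (jet S \<gamma> t)) (at t within S)"
      using mult.IH that by auto
    from DERIV_mult[OF this] show ?thesis by (simp add: mult.commute)
  qed
  ultimately show ?case unfolding e using d by blast
qed

lemma diff_hom_total_deriv: "diff_hom r F \<Longrightarrow> diff_hom (Suc r) (total_deriv F)"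
  using diff_hom_total_deriv_aux by blast

lemma total_deriv_has_derivative:
  "diff_hom r F \<Longrightarrow>
    ((\<lambda>s. F (\<lambda>j. x j + s * x (Suc j))) has_real_derivative total_deriv F x) (at 0)"
  using diff_hom_total_deriv_aux by blast

lemma has_derivative_along_jet:
  "diff_hom r F \<Longrightarrow> Ck_on K S \<gamma> \<Longrightarrow> r < K \<Longrightarrow> t \<in> S \<Longrightarrow>
    ((\<lambda>t. F (jet S \<gamma> t)) has_real_derivative total_deriv F (jet S \<gamma> t)) (at t within S)"
  using diff_hom_total_deriv_aux by blast

lemma diff_hom_total_deriv_funpow: "diff_hom r F \<Longrightarrow> diff_hom (r + m) ((total_deriv ^^ m) F)"
  by (induction m) (auto intro: diff_hom_total_deriv)

text \<open>\<open>vector_derivative\<close> is a choice; on an interval with a < b the derivative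
  within it is unique even at the endpoints, so the choice is forced.\<close>

lemma vector_derivative_within_Icc:
  fixes f :: "real \<Rightarrow> real"
  assumes "a < b" "t \<in> {a..b}" "(g has_real_derivative d) (at t within {a..b})"
    and "\<And>s. s \<in> {a..b} \<Longrightarrow> f s = g s"
  shows "vector_derivative f (at t within {a..b}) = d"
proof -
  have "(f has_real_derivative d) (at t within {a..b})"
    using assms by (auto intro: has_field_derivative_transform_within[OF assms(3), of 1])
  then show ?thesis
    using vector_derivative_within_cbox[of a b t f d] assms
    by (simp add: has_real_derivative_iff_has_vector_derivative)
qed

text \<open>Each differentiation costs one order of smoothness and the m-th one starts from weight r
  + m - 1, hence the bound r + m \<le> K.\<close>

lemma nth_deriv_on_along_jet:
  assumes "diff_hom r F" "Ck_on K {0..T} \<gamma>" "0 < T" "r + m \<le> K" "t \<in> {0..T}"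
    and "\<And>s. s \<in> {0..T} \<Longrightarrow> f s = F (jet {0..T} \<gamma> s)"
  shows "nth_deriv_on {0..T} m f t = (total_deriv ^^ m) F (jet {0..T} \<gamma> t)"
  using assms(4,5)
proof (induction m arbitrary: t)
  case 0
  then show ?case using assms(6) by simp
next
  case (Suc m)
  then show ?case
    using vector_derivative_within_Icc[OF assms(3) Suc.prems(2)
        has_derivative_along_jet[OF diff_hom_total_deriv_funpow[OF assms(1), of m] assms(2)]]
    by simp
qed

lemma continuous_on_jet:
  assumes "Ck_on K S \<gamma>" "j \<le> K"
  shows "continuous_on S (\<lambda>t. jet S \<gamma> t j)"
proof (cases "j = K")
  case False
  then show ?thesis using assms unfolding Ck_on_def jet_def
    by (auto intro: differentiable_imp_continuous_on)
qed (use assms in \<open>auto simp: Ck_on_def jet_def\<close>)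

lemma continuous_on_along_jet:
  assumes "diff_hom r F" "Ck_on K S \<gamma>" "r \<le> K"
  shows "continuous_on S (\<lambda>t. F (jet S \<gamma> t))"
  using assms(1,3)
proof induction
  case (coord j)
  then show ?case using continuous_on_jet[OF assms(2)] by simp
qed (auto intro!: continuous_intros)

text \<open>Weights add under products exactly as powers of \<rho> do. K depends on F and M only, so
  \<rho> remains free to be a frequency or an inverse length.\<close>

lemma diff_hom_bound:
  assumes "diff_hom r F"
  shows "\<exists>K\<ge>0. \<forall>x \<rho>. 0 < \<rho> \<longrightarrow> (\<forall>j\<le>r. \<bar>x j\<bar> \<le> M * \<rho> ^ j) \<longrightarrow> \<bar>F x\<bar> \<le> K * \<rho> ^ r"
  using assms
proof induction
  case (const c)
  show ?case by (rule exI[of _ "\<bar>c\<bar>"]) auto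
next
  case (coord j)
  show ?case
  proof (rule exI[of _ "\<bar>M\<bar>"], intro conjI allI impI)
    fix x :: "nat \<Rightarrow> real" and \<rho> :: real assume "0 < \<rho>" "\<forall>i\<le>j. \<bar>x i\<bar> \<le> M * \<rho> ^ i"
    then have "\<bar>x j\<bar> \<le> M * \<rho> ^ j" by simp
    also have "\<dots> \<le> \<bar>M\<bar> * \<rho> ^ j" using \<open>0 < \<rho>\<close> by (intro mult_right_mono) auto
    finally show "\<bar>x j\<bar> \<le> \<bar>M\<bar> * \<rho> ^ j" .
  qed simp
next
  case (add r F G)
  then obtain K L where "K \<ge> 0" "L \<ge> 0"
    and KL: "\<And>x \<rho>. 0 < \<rho> \<Longrightarrow> (\<forall>j\<le>r. \<bar>x j\<bar> \<le> M * \<rho> ^ j) \<Longrightarrow> \<bar>F x\<bar> \<le> K * \<rho> ^ r"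
      "\<And>x \<rho>. 0 < \<rho> \<Longrightarrow> (\<forall>j\<le>r. \<bar>x j\<bar> \<le> M * \<rho> ^ j) \<Longrightarrow> \<bar>G x\<bar> \<le> L * \<rho> ^ r"
    by blast
  show ?case
  proof (rule exI[of _ "K + L"], intro conjI allI impI)
    fix x \<rho> assume "0 < (\<rho>::real)" "\<forall>j\<le>r. \<bar>x j\<bar> \<le> M * \<rho> ^ j"
    from KL(1)[OF this] KL(2)[OF this] show "\<bar>F x + G x\<bar> \<le> (K + L) * \<rho> ^ r"
      by (simp add: distrib_right)
  qed (use \<open>K \<ge> 0\<close> \<open>L \<ge> 0\<close> in simp)
next
  case (mult r F s G)
  then obtain K L where "K \<ge> 0" "L \<ge> 0"
    and KL: "\<And>x \<rho>. 0 < \<rho> \<Longrightarrow> (\<forall>j\<le>r. \<bar>x j\<bar> \<le> M * \<rho> ^ j) \<Longrightarrow> \<bar>F x\<bar> \<le> K * \<rho> ^ r"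
      "\<And>x \<rho>. 0 < \<rho> \<Longrightarrow> (\<forall>j\<le>s. \<bar>x j\<bar> \<le> M * \<rho> ^ j) \<Longrightarrow> \<bar>G x\<bar> \<le> L * \<rho> ^ s"
    by blast
  show ?case
  proof (rule exI[of _ "K * L"], intro conjI allI impI)
    fix x \<rho> assume *: "0 < (\<rho>::real)" "\<forall>j\<le>r + s. \<bar>x j\<bar> \<le> M * \<rho> ^ j"
    have "\<bar>F x\<bar> * \<bar>G x\<bar> \<le> (K * \<rho> ^ r) * (L * \<rho> ^ s)"
      using * by (intro mult_mono KL) (auto intro!: mult_nonneg_nonneg \<open>K \<ge> 0\<close>)
    then show "\<bar>F x * G x\<bar> \<le> K * L * \<rho> ^ (r + s)" by (simp add: abs_mult power_add ac_simps)
  qed (use \<open>K \<ge> 0\<close> \<open>L \<ge> 0\<close> in simp)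
qed

text \<open>The factor \<open>\<theta>\<close> carries either the smallness \<open>\<epsilon>\<close> of the derivatives or the size of
  the top order one: every monomial of positive weight retains at least one such factor.\<close>

lemma diff_hom_bound_factor:
  assumes "diff_hom r F" "0 < r" "0 \<le> M"
  shows "\<exists>K\<ge>0. \<forall>x \<rho> \<theta>. 0 < \<rho> \<longrightarrow> 0 \<le> \<theta> \<longrightarrow> \<bar>x 0\<bar> \<le> M \<longrightarrow> (\<forall>j<r. \<bar>x j\<bar> \<le> M * \<rho> ^ j) \<longrightarrow>
     (\<forall>j\<in>{0<..r}. \<bar>x j\<bar> \<le> \<theta> * \<rho> ^ j) \<longrightarrow> \<bar>F x\<bar> \<le> K * \<theta> * \<rho> ^ r"
  using assms(1,2)
proof induction
  case (const c)
  then show ?case by simp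
next
  case (coord j)
  then show ?case by (intro exI[of _ 1]) auto
next
  case (add r F G)
  then obtain K L where "K \<ge> 0" "L \<ge> 0"
    and KL: "\<And>x \<rho> \<theta>. 0 < \<rho> \<Longrightarrow> 0 \<le> \<theta> \<Longrightarrow> \<bar>x 0\<bar> \<le> M \<Longrightarrow> (\<forall>j<r. \<bar>x j\<bar> \<le> M * \<rho> ^ j) \<Longrightarrow>
     (\<forall>j\<in>{0<..r}. \<bar>x j\<bar> \<le> \<theta> * \<rho> ^ j) \<Longrightarrow> \<bar>F x\<bar> \<le> K * \<theta> * \<rho> ^ r"
      "\<And>x \<rho> \<theta>. 0 < \<rho> \<Longrightarrow> 0 \<le> \<theta> \<Longrightarrow> \<bar>x 0\<bar> \<le> M \<Longrightarrow> (\<forall>j<r. \<bar>x j\<bar> \<le> M * \<rho> ^ j) \<Longrightarrow>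
     (\<forall>j\<in>{0<..r}. \<bar>x j\<bar> \<le> \<theta> * \<rho> ^ j) \<Longrightarrow> \<bar>G x\<bar> \<le> L * \<theta> * \<rho> ^ r"
    by metis
  show ?case
  proof (rule exI[of _ "K + L"], intro conjI allI impI)
    fix x \<rho> \<theta> assume "0 < (\<rho>::real)" "0 \<le> (\<theta>::real)" "\<bar>x 0\<bar> \<le> M" "\<forall>j<r. \<bar>x j\<bar> \<le> M * \<rho> ^ j"
      "\<forall>j\<in>{0<..r}. \<bar>x j\<bar> \<le> \<theta> * \<rho> ^ j"
    from KL(1)[OF this] KL(2)[OF this] show "\<bar>F x + G x\<bar> \<le> (K + L) * \<theta> * \<rho> ^ r"
      by (simp add: distrib_right)
  qed (use \<open>K \<ge> 0\<close> \<open>L \<ge> 0\<close> in simp)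
next
  case (mult r F s G)
  obtain K0 L0 where "K0 \<ge> 0" "L0 \<ge> 0"
    and KL0: "\<And>x \<rho>. 0 < \<rho> \<Longrightarrow> (\<forall>j\<le>r. \<bar>x j\<bar> \<le> M * \<rho> ^ j) \<Longrightarrow> \<bar>F x\<bar> \<le> K0 * \<rho> ^ r"
      "\<And>x \<rho>. 0 < \<rho> \<Longrightarrow> (\<forall>j\<le>s. \<bar>x j\<bar> \<le> M * \<rho> ^ j) \<Longrightarrow> \<bar>G x\<bar> \<le> L0 * \<rho> ^ s"
    using diff_hom_bound[OF mult.hyps(1)] diff_hom_bound[OF mult.hyps(2)] by metis
  show ?case
  \<comment> \<open>Only a factor of positive weight can supply \<theta>. The other factor then has
    weight strictly below r + s, so the bounds on the orders below the top cover it.\<close>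
  proof (cases "r = 0")
    case True
    then have "0 < s" using mult.prems by simp
    then obtain L where "L \<ge> 0" and L: "\<And>x \<rho> \<theta>. 0 < \<rho> \<Longrightarrow> 0 \<le> \<theta> \<Longrightarrow> \<bar>x 0\<bar> \<le> M \<Longrightarrow>
       (\<forall>j<s. \<bar>x j\<bar> \<le> M * \<rho> ^ j) \<Longrightarrow> (\<forall>j\<in>{0<..s}. \<bar>x j\<bar> \<le> \<theta> * \<rho> ^ j) \<Longrightarrow> \<bar>G x\<bar> \<le> L * \<theta> * \<rho> ^ s"
      using mult.IH(2) by metis
    show ?thesis
    proof (rule exI[of _ "K0 * L"], intro conjI allI impI)
      fix x \<rho> \<theta> assume *: "0 < (\<rho>::real)" "0 \<le> (\<theta>::real)" "\<bar>x 0\<bar> \<le> M"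
        "\<forall>j<r + s. \<bar>x j\<bar> \<le> M * \<rho> ^ j" "\<forall>j\<in>{0<..r + s}. \<bar>x j\<bar> \<le> \<theta> * \<rho> ^ j"
      have "\<bar>F x\<bar> * \<bar>G x\<bar> \<le> K0 * (L * \<theta> * \<rho> ^ s)"
        using * KL0(1)[of \<rho> x] L[of \<rho> \<theta> x] True \<open>K0 \<ge> 0\<close> by (intro mult_mono) auto
      then show "\<bar>F x * G x\<bar> \<le> K0 * L * \<theta> * \<rho> ^ (r + s)"
        using True by (simp add: abs_mult ac_simps)
    qed (use \<open>K0 \<ge> 0\<close> \<open>L \<ge> 0\<close> in simp)
  next
    case False
    then obtain K where "K \<ge> 0" and K: "\<And>x \<rho> \<theta>. 0 < \<rho> \<Longrightarrow> 0 \<le> \<theta> \<Longrightarrow> \<bar>x 0\<bar> \<le> M \<Longrightarrow>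
       (\<forall>j<r. \<bar>x j\<bar> \<le> M * \<rho> ^ j) \<Longrightarrow> (\<forall>j\<in>{0<..r}. \<bar>x j\<bar> \<le> \<theta> * \<rho> ^ j) \<Longrightarrow> \<bar>F x\<bar> \<le> K * \<theta> * \<rho> ^ r"
      using mult.IH(1) by (metis gr0I)
    show ?thesis
    proof (rule exI[of _ "K * L0"], intro conjI allI impI)
      fix x \<rho> \<theta> assume *: "0 < (\<rho>::real)" "0 \<le> (\<theta>::real)" "\<bar>x 0\<bar> \<le> M"
        "\<forall>j<r + s. \<bar>x j\<bar> \<le> M * \<rho> ^ j" "\<forall>j\<in>{0<..r + s}. \<bar>x j\<bar> \<le> \<theta> * \<rho> ^ j"
      have "\<bar>F x\<bar> * \<bar>G x\<bar> \<le> (K * \<theta> * \<rho> ^ r) * (L0 * \<rho> ^ s)"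
        using * K[of \<rho> \<theta> x] KL0(2)[of \<rho> x] False \<open>K \<ge> 0\<close> by (intro mult_mono) auto
      then show "\<bar>F x * G x\<bar> \<le> K * L0 * \<theta> * \<rho> ^ (r + s)"
        by (simp add: abs_mult power_add ac_simps)
    qed (use \<open>K \<ge> 0\<close> \<open>L0 \<ge> 0\<close> in simp)
  qed
qed

section \<open>Existence of the coefficients\<close>

lemma diff_hom_power0: "diff_hom 0 F \<Longrightarrow> diff_hom 0 (\<lambda>x. F x ^ m)"
proof (induction m)
  case (Suc m)
  then show ?case using diff_hom.mult[of 0 F 0 "\<lambda>x. F x ^ m"] by simp
qed (use diff_hom.const[of 1] in simp)

lemma diff_hom_prod_mset: "diff_hom (sum_mset J) (\<lambda>x. \<Prod>j\<in>#J. x j)"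
proof (induction J)
  case (add j J)
  then show ?case using diff_hom.mult[OF diff_hom.coord] by simp
qed (use diff_hom.const[of 1] in simp)

lemma diff_hom_eval_poly:
  assumes "homogeneous r P"
  shows "diff_hom r (eval_poly P)"
proof -
  have "diff_hom r (\<lambda>x. Poly_Mapping.lookup P M * x 0 ^ fst M * (\<Prod>j\<in>#snd M. x j))"
    if "M \<in> Poly_Mapping.keys P" for M
  proof -
    have "sum_mset (snd M) = r"
      using that assms by (auto simp: homogeneous_def has_diff_weight_def)
    moreover have "diff_hom (0 + sum_mset (snd M))
        (\<lambda>x. Poly_Mapping.lookup P M * x 0 ^ fst M * (\<Prod>j\<in>#snd M. x j))"
      by (intro diff_hom.mult diff_hom_prod_mset diff_hom_scale diff_hom_power0 diff_hom.coord)
    ultimately show ?thesis by simp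
  qed
  then show ?thesis unfolding eval_poly_def by (rule diff_hom_sum)
qed

section \<open>Evaluation of formal polynomials as a linear map, and representation of homogeneous
  functions by them\<close>

lemma eval_poly_superset:
  assumes "finite I" "Poly_Mapping.keys P \<subseteq> I"
  shows "eval_poly P x = (\<Sum>M\<in>I. Poly_Mapping.lookup P M * x 0 ^ fst M * (\<Prod>j\<in>#snd M. x j))"
  unfolding eval_poly_def using assms by (intro sum.mono_neutral_left) (auto simp: in_keys_iff)

lemma eval_poly_add: "eval_poly (P + Q) x = eval_poly P x + eval_poly Q x"
proof -
  let ?I = "Poly_Mapping.keys P \<union> Poly_Mapping.keys Q"
  have "finite ?I" "Poly_Mapping.keys (P + Q) \<subseteq> ?I" by (auto simp: Poly_Mapping.keys_add)
  then show ?thesis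
    by (simp add: eval_poly_superset[of ?I] lookup_add distrib_right sum.distrib)
qed

lemma eval_poly_zero: "eval_poly 0 x = 0"
  by (simp add: eval_poly_def)

lemma eval_poly_sum: "eval_poly (\<Sum>i\<in>I. P i) x = (\<Sum>i\<in>I. eval_poly (P i) x)"
  by (induction I rule: infinite_finite_induct) (simp_all add: eval_poly_add eval_poly_zero)

lemma eval_poly_single:
  "eval_poly (Poly_Mapping.single M a) x = a * x 0 ^ fst M * (\<Prod>j\<in>#snd M. x j)"
  by (subst eval_poly_superset[of "{M}"]) (auto simp: lookup_single)

text \<open>Unlike \<open>has_diff_weight\<close>, the weight condition used here admits the empty multiset, as
  the induction passes through functions of weight 0.\<close>

lemma diff_hom_imp_poly:
  assumes "diff_hom r F"
  shows "\<exists>P. (\<forall>M\<in>Poly_Mapping.keys P. (\<forall>j\<in>#snd M. 1 \<le> j) \<and> sum_mset (snd M) = r) \<and>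
    (\<forall>x. eval_poly P x = F x)"
  using assms
proof induction
  case (const c)
  show ?case
    by (rule exI[of _ "Poly_Mapping.single (0, {#}) c"]) (simp add: eval_poly_single)
next
  case (coord j)
  show ?case
  proof (cases "j = 0")
    case True
    then show ?thesis
      by (intro exI[of _ "Poly_Mapping.single (1, {#}) 1"]) (simp add: eval_poly_single)
  next
    case False
    then show ?thesis
      by (intro exI[of _ "Poly_Mapping.single (0, {#j#}) 1"]) (simp add: eval_poly_single)
  qed
next
  case (add r F G)
  then obtain P Q where
    "\<forall>M\<in>Poly_Mapping.keys P. (\<forall>j\<in>#snd M. 1 \<le> j) \<and> sum_mset (snd M) = r" "\<forall>x. eval_poly P x = F x"
    "\<forall>M\<in>Poly_Mapping.keys Q. (\<forall>j\<in>#snd M. 1 \<le> j) \<and> sum_mset (snd M) = r" "\<forall>x. eval_poly Q x = G x"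
    by blast
  then show ?case
    using Poly_Mapping.keys_add[of P Q] by (intro exI[of _ "P + Q"]) (auto simp: eval_poly_add)
next
  case (mult r F s G)
  then obtain P Q where
    P: "\<forall>M\<in>Poly_Mapping.keys P. (\<forall>j\<in>#snd M. 1 \<le> j) \<and> sum_mset (snd M) = r" "\<forall>x. eval_poly P x = F x" and
    Q: "\<forall>M\<in>Poly_Mapping.keys Q. (\<forall>j\<in>#snd M. 1 \<le> j) \<and> sum_mset (snd M) = s" "\<forall>x. eval_poly Q x = G x"
    by blast
  let ?m = "\<lambda>M N. (fst M + fst N, snd M + snd N) :: diff_monomial"
  let ?R = "\<Sum>M\<in>Poly_Mapping.keys P. \<Sum>N\<in>Poly_Mapping.keys Q.
    Poly_Mapping.single (?m M N) (Poly_Mapping.lookup P M * Poly_Mapping.lookup Q N)"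
  \<comment> \<open>Different pairs can give the same monomial and their coefficients can cancel, so
    the keys are only included in the products; this is enough for the weight.\<close>
  have "Poly_Mapping.keys ?R \<subseteq> (\<Union>M\<in>Poly_Mapping.keys P. \<Union>N\<in>Poly_Mapping.keys Q. {?m M N})"
    by (intro order_trans[OF keys_sum] UN_mono subset_refl) simp
  then have "\<forall>M\<in>Poly_Mapping.keys ?R. (\<forall>j\<in>#snd M. 1 \<le> j) \<and> sum_mset (snd M) = r + s"
    using P(1) Q(1) by fastforce
  moreover have "eval_poly ?R x = eval_poly P x * eval_poly Q x" for x
    unfolding eval_poly_sum eval_poly_single unfolding eval_poly_def
    by (simp add: sum_product power_add ac_simps)
  ultimately show ?case using P(2) Q(2) by (intro exI[of _ ?R]) simp
qed

text \<open>With \<open>n = i - 1\<close>, \<open>quot_coeff n\<close> is \<open>a\<^sub>i / \<gamma>\<close>. The equation is the coefficient of \<open>\<mu> ^ n\<close> in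
  the first integral \<open>B\<^sup>2 + (\<mu>/2) (A A'' - A'\<^sup>2/2) = 1\<close>, where \<open>A = \<gamma> B\<close>, of
  the linear equation \<open>B' = - (\<mu>/4) \<gamma> A'''\<close>.\<close>

function quot_coeff :: "nat \<Rightarrow> (nat \<Rightarrow> real) \<Rightarrow> real" where
  "quot_coeff 0 = (\<lambda>x. 1)"
| "quot_coeff (Suc n) = (\<lambda>x. - (1/2) * ((\<Sum>j\<in>{1..n}. quot_coeff j x * quot_coeff (Suc n - j) x)
     + 1/2 * (\<Sum>j\<in>{..n}. (x 0 * quot_coeff j x)
           * (total_deriv ^^ 2) (\<lambda>x. x 0 * quot_coeff (n - j) x) x
         - 1/2 * (total_deriv (\<lambda>x. x 0 * quot_coeff j x) x
           * total_deriv (\<lambda>x. x 0 * quot_coeff (n - j) x) x))))"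
  by pat_completeness auto
termination by (relation "Wellfounded.measure id") auto

text \<open>This is a_(n+1); with the shifted index its weight is 2 * n.\<close>

definition num_coeff :: "nat \<Rightarrow> (nat \<Rightarrow> real) \<Rightarrow> real" where
  "num_coeff n = (\<lambda>x. x 0 * quot_coeff n x)"

declare quot_coeff.simps(2) [simp del]

lemma quot_coeff_Suc:
  "quot_coeff (Suc n) x = - (1/2) * ((\<Sum>j\<in>{1..n}. quot_coeff j x * quot_coeff (Suc n - j) x)
     + 1/2 * (\<Sum>j\<le>n. num_coeff j x * total_deriv (total_deriv (num_coeff (n - j))) x
         - 1/2 * (total_deriv (num_coeff j) x * total_deriv (num_coeff (n - j)) x)))"
  by (subst quot_coeff.simps) (simp add: num_coeff_def eval_nat_numeral)

lemma diff_hom_num_coeff_if: "diff_hom r (quot_coeff n) \<Longrightarrow> diff_hom r (num_coeff n)"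
  unfolding num_coeff_def using diff_hom.mult[OF diff_hom.coord[of 0]] by simp

text \<open>A product of two quotients has weight 2 * j + 2 * (n - j). In the remaining terms the
  indices add up to n - 1 only, and the two derivatives restore the missing weight 2.\<close>

lemma diff_hom_quot_coeff: "diff_hom (2 * n) (quot_coeff n)"
proof (induction n rule: less_induct)
  case (less n)
  show ?case
  proof (cases n)
    case 0
    then show ?thesis using diff_hom.const[of 1] by simp
  next
    case (Suc m)
    have eq: "quot_coeff (Suc m) = (\<lambda>x. - (1/2) *
      ((\<Sum>j\<in>{1..m}. quot_coeff j x * quot_coeff (Suc m - j) x)
     + 1/2 * (\<Sum>j\<le>m. num_coeff j x * total_deriv (total_deriv (num_coeff (m - j))) x
         - 1/2 * (total_deriv (num_coeff j) x * total_deriv (num_coeff (m - j)) x))))"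
      by (rule ext) (rule quot_coeff_Suc)
    have b: "diff_hom (2 * j) (quot_coeff j)" and a: "diff_hom (2 * j) (num_coeff j)" if "j \<le> m" for j
      using less that Suc by (auto intro: diff_hom_num_coeff_if)
    have 1: "diff_hom (2 * Suc m) (\<lambda>x. quot_coeff j x * quot_coeff (Suc m - j) x)"
      if "j \<in> {1..m}" for j
    proof -
      have e: "2 * Suc m = 2 * j + 2 * (Suc m - j)" using that by auto
      show ?thesis unfolding e using that by (intro diff_hom.mult b) auto
    qed
    have 2: "diff_hom (2 * Suc m) (\<lambda>x. num_coeff j x * total_deriv (total_deriv (num_coeff (m - j))) x)"
      if "j \<in> {..m}" for j
    proof -
      have e: "2 * Suc m = 2 * j + Suc (Suc (2 * (m - j)))" using that by auto
      show ?thesis unfolding e using that by (intro diff_hom.mult a diff_hom_total_deriv) auto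
    qed
    have 3: "diff_hom (2 * Suc m) (\<lambda>x. total_deriv (num_coeff j) x * total_deriv (num_coeff (m - j)) x)"
      if "j \<in> {..m}" for j
    proof -
      have e: "2 * Suc m = Suc (2 * j) + Suc (2 * (m - j))" using that by auto
      show ?thesis unfolding e using that by (intro diff_hom.mult a diff_hom_total_deriv) auto
    qed
    show ?thesis unfolding Suc eq
      by (intro diff_hom_scale diff_hom.add diff_hom_sum diff_hom_diff 1 2 3)
  qed
qed

lemma diff_hom_num_coeff: "diff_hom (2 * n) (num_coeff n)"
  by (intro diff_hom_num_coeff_if diff_hom_quot_coeff)

text \<open>In the coefficient of \<mu>^N of B^2 the unknown \<open>quot_coeff N\<close> occurs
  twice, at j = 0 and at j = N, each time with factor \<open>quot_coeff 0\<close> = 1. The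
  definition solved for it; putting it back restores the full sum.\<close>

lemma quot_coeff_first_integral:
  assumes "0 < N"
  shows "(\<Sum>j\<le>N. quot_coeff j x * quot_coeff (N - j) x)
    + 1/2 * (\<Sum>j<N. num_coeff j x * total_deriv (total_deriv (num_coeff (N - 1 - j))) x
         - 1/2 * (total_deriv (num_coeff j) x * total_deriv (num_coeff (N - 1 - j)) x)) = 0"
proof -
  have aux: "s2 + 1/2 * r = 0" if "s2 = 2 * b + s" "b = - (1/2) * (s + 1/2 * r)" for s2 b s r :: real
    using that by (simp add: field_simps)
  obtain n where N: "N = Suc n" using assms gr0_conv_Suc by auto
  have "(\<Sum>j\<le>Suc n. quot_coeff j x * quot_coeff (Suc n - j) x)
    = quot_coeff 0 x * quot_coeff (Suc n) x + (\<Sum>j\<in>{1..Suc n}. quot_coeff j x * quot_coeff (Suc n - j) x)"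
    using sum.atLeast_Suc_atMost[of 0 "Suc n" "\<lambda>j. quot_coeff j x * quot_coeff (Suc n - j) x"]
    by (simp add: atLeast0AtMost)
  also have "\<dots> = 2 * quot_coeff (Suc n) x + (\<Sum>j\<in>{1..n}. quot_coeff j x * quot_coeff (Suc n - j) x)"
    by simp
  finally show ?thesis
    unfolding N diff_Suc_1 lessThan_Suc_atMost by (rule aux[OF _ quot_coeff_Suc[of n x]])
qed

text \<open>Differentiating B^2 + (\<mu>/2) (A A'' - A'^2 / 2) = 1 gives 2 B B' + (\<mu>/2) A A''' =
  0, that is 2 B (B' + (\<mu>/4) \<gamma> A''') = 0. As B starts with 1, the second factor vanishes
  coefficient by coefficient.\<close>

lemma total_deriv_quot_coeff:
  "total_deriv (quot_coeff (Suc n)) x = - (1/4) * x 0 * (total_deriv ^^ 3) (num_coeff n) x"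
proof -
  let ?b = quot_coeff and ?a = num_coeff and ?D = total_deriv
  \<comment> \<open>The coefficient of \<mu>^N in B' + (\<mu>/4) \<gamma> A'''. At N = 0 it is 0
    because B starts with a constant.\<close>
  define d where "d N = (if N = 0 then 0 else
      ?D (?b N) x + 1/4 * x 0 * ?D (?D (?D (?a (N - 1)))) x)" for N
  define p where "p s = (\<lambda>j. x j + s * x (Suc j))" for s
  have p0: "p 0 = x" by (auto simp: p_def)
  have der: "((\<lambda>s. F (p s)) has_real_derivative ?D F x) (at 0)" if "diff_hom r F" for r F
    using total_deriv_has_derivative[OF that] unfolding p_def .
  note db = der[OF diff_hom_quot_coeff]
  note da = der[OF diff_hom_num_coeff]
  note da1 = der[OF diff_hom_total_deriv[OF diff_hom_num_coeff]]
  note da2 = der[OF diff_hom_total_deriv[OF diff_hom_total_deriv[OF diff_hom_num_coeff]]]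
  have D0: "?D (?b 0) x = 0" by (rule total_deriv_eqI) simp
  have key: "(\<Sum>j\<le>N. ?b j x * d (N - j)) = 0" if "0 < N" for N
  proof -
    have d1: "((\<lambda>s. ?b j (p s) * ?b (N - j) (p s)) has_real_derivative
        ?b j x * ?D (?b (N - j)) x + ?D (?b j) x * ?b (N - j) x) (at 0)" for j
      using DERIV_mult'[OF db[of j] db[of "N - j"]] by (simp only: p0)
    have d2: "((\<lambda>s. ?a j (p s) * ?D (?D (?a (N - 1 - j))) (p s)
         - 1/2 * (?D (?a j) (p s) * ?D (?a (N - 1 - j)) (p s))) has_real_derivative
        (?a j x * ?D (?D (?D (?a (N - 1 - j)))) x + ?D (?a j) x * ?D (?D (?a (N - 1 - j))) x)
         - 1/2 * (?D (?a j) x * ?D (?D (?a (N - 1 - j))) x + ?D (?D (?a j)) x * ?D (?a (N - 1 - j)) x))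
        (at 0)" for j
      using DERIV_diff[OF DERIV_mult'[OF da[of j] da2[of "N - 1 - j"]]
          DERIV_cmult[OF DERIV_mult'[OF da1[of j] da1[of "N - 1 - j"]], of "1/2"]]
      by (simp only: p0)
    have D: "((\<lambda>s. (\<Sum>j\<le>N. ?b j (p s) * ?b (N - j) (p s))
        + 1/2 * (\<Sum>j<N. ?a j (p s) * ?D (?D (?a (N - 1 - j))) (p s)
         - 1/2 * (?D (?a j) (p s) * ?D (?a (N - 1 - j)) (p s)))) has_real_derivative
        (\<Sum>j\<le>N. ?b j x * ?D (?b (N - j)) x + ?D (?b j) x * ?b (N - j) x)
        + 1/2 * (\<Sum>j<N. (?a j x * ?D (?D (?D (?a (N - 1 - j)))) x
             + ?D (?a j) x * ?D (?D (?a (N - 1 - j))) x)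
         - 1/2 * (?D (?a j) x * ?D (?D (?a (N - 1 - j))) x
             + ?D (?D (?a j)) x * ?D (?a (N - 1 - j)) x))) (at 0)"
      by (rule DERIV_add[OF DERIV_sum[OF d1] DERIV_cmult[OF DERIV_sum[OF d2]]])
    have E: "(\<lambda>s. (\<Sum>j\<le>N. ?b j (p s) * ?b (N - j) (p s))
        + 1/2 * (\<Sum>j<N. ?a j (p s) * ?D (?D (?a (N - 1 - j))) (p s)
         - 1/2 * (?D (?a j) (p s) * ?D (?a (N - 1 - j)) (p s)))) = (\<lambda>s. 0)"
      by (rule ext) (rule quot_coeff_first_integral[OF that])
    have eq0: "(\<Sum>j\<le>N. ?b j x * ?D (?b (N - j)) x + ?D (?b j) x * ?b (N - j) x)
        + 1/2 * (\<Sum>j<N. (?a j x * ?D (?D (?D (?a (N - 1 - j)))) x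
             + ?D (?a j) x * ?D (?D (?a (N - 1 - j))) x)
         - 1/2 * (?D (?a j) x * ?D (?D (?a (N - 1 - j))) x
             + ?D (?D (?a j)) x * ?D (?a (N - 1 - j)) x)) = 0"
      by (rule DERIV_unique[OF D[unfolded E] DERIV_const])
    have aux: "2 * s1 + 1/2 * r = 0"
      if "s1 + s1' + 1/2 * (r + q - 1/2 * (q + q')) = 0" "s1' = s1" "q' = q" for s1 s1' r q q' :: real
      using that by (simp add: field_simps)
    \<comment> \<open>Reversing the order of summation identifies the two halves of each product
      rule: the square contributes 2 B B', and A' A'' cancels against the derivative of A'^2 /
      2.\<close>
    have S1: "(\<Sum>j\<le>N. ?D (?b j) x * ?b (N - j) x) = (\<Sum>j\<le>N. ?b j x * ?D (?b (N - j)) x)"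
      by (subst sum.nat_diff_reindex[of "\<lambda>j. ?D (?b j) x * ?b (N - j) x" "Suc N", symmetric, unfolded lessThan_Suc_atMost])
        (auto intro!: sum.cong)
    have S2: "(\<Sum>j<N. ?D (?D (?a j)) x * ?D (?a (N - 1 - j)) x)
        = (\<Sum>j<N. ?D (?a j) x * ?D (?D (?a (N - 1 - j))) x)"
      by (subst sum.nat_diff_reindex[symmetric]) (auto intro!: sum.cong)
    have R: "2 * (\<Sum>j\<le>N. ?b j x * ?D (?b (N - j)) x)
        + 1/2 * (\<Sum>j<N. ?a j x * ?D (?D (?D (?a (N - 1 - j)))) x) = 0"
      by (rule aux[OF eq0[unfolded sum.distrib sum_subtractf sum_distrib_left[symmetric]] S1 S2])
    have S3: "(\<Sum>j\<le>N. ?b j x * d (N - j)) = (\<Sum>j<N. ?b j x * d (N - j))"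
      by (simp add: lessThan_Suc_atMost[symmetric] d_def)
    have S4: "(\<Sum>j\<le>N. ?b j x * ?D (?b (N - j)) x) = (\<Sum>j<N. ?b j x * ?D (?b (N - j)) x)"
      using D0 by (simp add: lessThan_Suc_atMost[symmetric])
    have S5: "(\<Sum>j<N. ?b j x * d (N - j)) = (\<Sum>j<N. ?b j x * ?D (?b (N - j)) x)
        + 1/4 * (\<Sum>j<N. ?a j x * ?D (?D (?D (?a (N - 1 - j)))) x)"
      unfolding sum_distrib_left sum.distrib[symmetric]
      by (intro sum.cong) (auto simp: d_def num_coeff_def algebra_simps)
    have "s3 = 0" if "2 * s1 + 1/2 * r = 0" "s3' = s1 + 1/4 * r" "s3 = s3'" for s1 r s3 s3' :: real
      using that by (simp add: field_simps)
    from this[OF R[unfolded S4] S5 S3] show ?thesis .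
  qed
  \<comment> \<open>The convolution is triangular: its term at j = 0 is d N itself, and all others
    contain an earlier d.\<close>
  have "d N = 0" for N
  proof (induction N rule: less_induct)
    case (less N)
    show ?case
    proof (cases "N = 0")
      case False
      have "(\<Sum>j\<le>N. ?b j x * d (N - j)) = ?b 0 x * d N + (\<Sum>j\<in>{1..N}. ?b j x * d (N - j))"
        using sum.atLeast_Suc_atMost[of 0 N "\<lambda>j. ?b j x * d (N - j)"] by (simp add: atLeast0AtMost)
      also have "(\<Sum>j\<in>{1..N}. ?b j x * d (N - j)) = 0"
        by (intro sum.neutral) (auto intro!: less)
      finally show ?thesis using key[of N] False by simp
    qed (simp add: d_def)
  qed
  from this[of "Suc n"] show ?thesis by (simp add: d_def eval_nat_numeral)
qed

lemma coeff_family_exists: "\<exists>P. coeff_family P"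
proof -
  have "\<forall>i. \<exists>P. (\<forall>M\<in>Poly_Mapping.keys P. (\<forall>j\<in>#snd M. 1 \<le> j) \<and> sum_mset (snd M) = 2 * (i - 1)) \<and>
    (\<forall>x. eval_poly P x = num_coeff (i - 1) x)"
    using diff_hom_imp_poly[OF diff_hom_num_coeff] by blast
  then obtain P where
    P: "\<And>i M. M \<in> Poly_Mapping.keys (P i) \<Longrightarrow> (\<forall>j\<in>#snd M. 1 \<le> j) \<and> sum_mset (snd M) = 2 * (i - 1)"
      "\<And>i x. eval_poly (P i) x = num_coeff (i - 1) x"
    by metis
  have "homogeneous (2 * i - 2) (P i)" if "2 \<le> i" for i
    unfolding homogeneous_def has_diff_weight_def
  proof (rule ballI)
    fix M assume "M \<in> Poly_Mapping.keys (P i)"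
    \<comment> \<open>For i at least 2 the weight is positive, which rules out the empty
      multiset.\<close>
    from P(1)[OF this] that show "snd M \<noteq> {#} \<and> (\<forall>j\<in>#snd M. 1 \<le> j) \<and> \<Sum>\<^sub># (snd M) = 2 * i - 2"
      by (cases "snd M = {#}") (simp_all add: diff_mult_distrib2)
  qed
  moreover have "((\<lambda>s. coeff_of P {0..T} \<gamma> i s / \<gamma> s) has_real_derivative
                 - (1/4) * \<gamma> t * nth_deriv_on {0..T} 3 (coeff_of P {0..T} \<gamma> (i - 1)) t)
              (at t within {0..T})"
    if h: "2 \<le> i" "0 < T" "Ck_on (2 * i - 1) {0..T} \<gamma>" "\<forall>t\<in>{0..T}. 0 < \<gamma> t" "t \<in> {0..T}" for i T \<gamma> t
  proof -
    \<comment> \<open>In this indexing a_i / \<gamma> is \<open>quot_coeff (Suc n)\<close> and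
      a_(i-1) is \<open>num_coeff n\<close>.\<close>
    obtain n where i: "i = Suc (Suc n)" using h(1) by (metis add_2_eq_Suc le_Suc_ex)
    have c: "coeff_of P {0..T} \<gamma> j s = num_coeff (j - 1) (jet {0..T} \<gamma> s)" if "1 \<le> j" for j s
      using that P(2)[of j] unfolding coeff_of_def eval_along_def jet_def num_coeff_def
      by (cases "j = 1") auto
    have 1: "nth_deriv_on {0..T} 3 (coeff_of P {0..T} \<gamma> (i - 1)) t
        = (total_deriv ^^ 3) (num_coeff n) (jet {0..T} \<gamma> t)"
      by (rule nth_deriv_on_along_jet[OF diff_hom_num_coeff h(3,2) _ h(5)]) (auto simp: i c)
    have "((\<lambda>s. quot_coeff (Suc n) (jet {0..T} \<gamma> s)) has_real_derivative
        total_deriv (quot_coeff (Suc n)) (jet {0..T} \<gamma> t)) (at t within {0..T})"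
      by (rule has_derivative_along_jet[OF diff_hom_quot_coeff h(3) _ h(5)]) (auto simp: i)
    moreover have nz: "\<gamma> s \<noteq> 0" if "s \<in> {0..T}" for s
      using h(4) that by force
    ultimately have "((\<lambda>s. coeff_of P {0..T} \<gamma> i s / \<gamma> s) has_real_derivative
        total_deriv (quot_coeff (Suc n)) (jet {0..T} \<gamma> t)) (at t within {0..T})"
      by - (rule has_field_derivative_transform_within[of _ _ _ _ 1],
        use h(5) nz in \<open>simp_all add: c i num_coeff_def jet_def\<close>)
    then show ?thesis unfolding total_deriv_quot_coeff 1 by (simp add: jet_def)
  qed
  ultimately show ?thesis unfolding coeff_family_def by blast
qed

text \<open>From here on the coefficients enter only through homogeneity and the recursion.\<close>

lemma coeff_polys_family: "coeff_family coeff_polys"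
  unfolding coeff_polys_def using coeff_family_exists by (rule someI_ex)

section \<open>An interpolation inequality for homogeneous polynomials\<close>

lemma integral_positive_subinterval_mono:
  fixes g :: "real \<Rightarrow> real"
  assumes "continuous_on {0..T} g" "\<And>t. t \<in> {0..T} \<Longrightarrow> 0 \<le> g t" "0 \<le> a'" "a' \<le> a" "a \<le> b" "b \<le> b'" "b' \<le> T"
  shows "integral {a..b} g \<le> integral {a'..b'} g"
proof (rule integral_subset_le)
  show "g integrable_on {a..b}" "g integrable_on {a'..b'}"
    by (rule integrable_continuous_real, rule continuous_on_subset[OF assms(1)], use assms in auto)+
qed (use assms in auto)

text \<open>The greedy partition: starting from \<open>a\<close>, cut off intervals of length \<open>h\<close> with
  \<open>h ^ n * integral I g = 1\<close>. The remainder at the right end may be too short, so it is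
  enlarged to the left until equality holds again.\<close>

lemma integral_le_by_scaled_partition:
  fixes W g :: "real \<Rightarrow> real"
  assumes "0 < T" "0 < n" "0 \<le> K"
    and W: "continuous_on {0..T} W" "\<And>t. t \<in> {0..T} \<Longrightarrow> 0 \<le> W t"
    and g: "continuous_on {0..T} g" "\<And>t. t \<in> {0..T} \<Longrightarrow> 0 \<le> g t"
    and loc: "\<And>a b. 0 \<le> a \<Longrightarrow> a < b \<Longrightarrow> b \<le> T \<Longrightarrow> (b - a) ^ n * integral {a..b} g \<le> 1 \<Longrightarrow>
       integral {a..b} W \<le> K * (1 / (b - a) ^ n + integral {a..b} g)"
  shows "integral {0..T} W \<le> K * (1 / T ^ n + 4 * integral {0..T} g)"
proof -
  define G where "G = integral {0..T} g"
  have ig: "g integrable_on {a..b}" and iW: "W integrable_on {a..b}" if "0 \<le> a" "b \<le> T" for a b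
    by (rule integrable_continuous_real, rule continuous_on_subset[OF g(1)], use that in auto)
       (rule integrable_continuous_real, rule continuous_on_subset[OF W(1)], use that in auto)
  have pos: "0 \<le> integral {a..b} g" if "0 \<le> a" "b \<le> T" for a b
    by (rule integral_nonneg[OF ig[OF that]]) (use that g in auto)
  have G0: "0 \<le> G" unfolding G_def using pos[of 0 T] by simp
  show ?thesis
  proof (cases "T ^ n * G \<le> 1")
    case True
    have "integral {0..T} W \<le> K * (1 / T ^ n + G)"
      using loc[of 0 T] True assms(1) by (simp add: G_def)
    also have "\<dots> \<le> K * (1 / T ^ n + 4 * G)"
      using G0 \<open>0 \<le> K\<close> by (intro mult_left_mono) auto
    finally show ?thesis by (simp add: G_def)
  next
    case False
    \<comment> \<open>Any interval on which the scaled integral equals 1 is longer than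
      \<open>h0\<close>, so the greedy partition is finite.\<close>
    define h0 where "h0 = 1 / (1 + G)"
    have h0: "0 < h0" "h0 ^ n * G < 1"
    proof -
      show "0 < h0" using G0 by (simp add: h0_def)
      have "h0 ^ n \<le> h0 ^ 1"
        by (rule power_decreasing) (use G0 \<open>0 < n\<close> in \<open>auto simp: h0_def\<close>)
      then have "h0 ^ n * G \<le> h0 * G" using G0 by (intro mult_right_mono) auto
      also have "h0 * G < 1" using G0 by (simp add: h0_def)
      finally show "h0 ^ n * G < 1" .
    qed
    \<comment> \<open>At equality the two terms on the right of \<open>loc\<close> coincide, which
      gives the factor 2.\<close>
    have exact: "integral {a..b} W \<le> 2 * K * integral {a..b} g"
      if "0 \<le> a" "a < b" "b \<le> T" "(b - a) ^ n * integral {a..b} g = 1" for a b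
    proof -
      have "integral {a..b} g = 1 / (b - a) ^ n"
        using that by (simp add: field_simps)
      then show ?thesis using loc[OF that(1-3)] that(4) by (simp add: mult.commute)
    qed
    have cont_r: "continuous_on {a..T} (\<lambda>s. (s - a) ^ n * integral {a..s} g)" if "0 \<le> a" for a
      by (intro continuous_intros indefinite_integral_continuous_1 ig that) simp
    \<comment> \<open>N bounds the number of cuts still possible. The additive
      \<open>2 * K * G\<close> pays once for the enlarged last interval, which overlaps the earlier
      ones; taken at a = 0 both summands are \<open>2 * K * G\<close>, whence the factor 4.\<close>
    have "integral {a..T} W \<le> 2 * K * integral {a..T} g + 2 * K * G"
      if "a \<in> {0..T}" "T - a \<le> real N * h0" for a N
      using that
    proof (induction N arbitrary: a)
      case 0
      then have "a = T" by simp
      then show ?case using G0 \<open>0 \<le> K\<close> by simp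
    next
      case (Suc N)
      show ?case
      proof (cases "1 \<le> (T - a) ^ n * integral {a..T} g")
        case True
        have "\<exists>s\<ge>a. s \<le> T \<and> (s - a) ^ n * integral {a..s} g = 1"
          by (rule IVT') (use True Suc.prems \<open>0 < n\<close> cont_r in auto)
        then obtain s where s: "a \<le> s" "s \<le> T" "(s - a) ^ n * integral {a..s} g = 1" by blast
        have "h0 < s - a"
        proof (rule ccontr)
          assume "\<not> h0 < s - a"
          then have "(s - a) ^ n * integral {a..s} g \<le> h0 ^ n * G"
            using s Suc.prems \<open>0 < h0\<close> unfolding G_def
            by (intro mult_mono power_mono integral_positive_subinterval_mono[OF g] pos) auto
          then show False using h0 s by simp
        qed
        then have "integral {s..T} W \<le> 2 * K * integral {s..T} g + 2 * K * G"
          using s Suc.prems by (intro Suc.IH) (auto simp: algebra_simps)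
        moreover have "integral {a..s} W \<le> 2 * K * integral {a..s} g"
          using exact[of a s] s Suc.prems \<open>h0 < s - a\<close> h0 by auto
        moreover have "integral {a..T} W = integral {a..s} W + integral {s..T} W"
          "integral {a..T} g = integral {a..s} g + integral {s..T} g"
          using Henstock_Kurzweil_Integration.integral_combine[of a s T W] Henstock_Kurzweil_Integration.integral_combine[of a s T g] ig[of a T] iW[of a T] Suc.prems s by simp_all
        ultimately show ?thesis by (simp add: distrib_left)
      next
        case F: False
        \<comment> \<open>The integral up to T is written as \<open>G\<close> minus an integral from
          0, so that continuity in the left endpoint is that of an indefinite integral. The value is
          below 1 at s = a and above 1 at s = 0.\<close>
        let ?\<phi> = "\<lambda>s. (T - s) ^ n * (G - integral {0..s} g)"
        have \<phi>: "G - integral {0..s} g = integral {s..T} g" if "s \<in> {0..T}" for s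
          unfolding G_def using Henstock_Kurzweil_Integration.integral_combine[of 0 s T g] that ig by simp
        have "\<exists>s\<ge>0. s \<le> a \<and> ?\<phi> s = 1"
        proof (rule IVT2')
          show "continuous_on {0..a} ?\<phi>"
            using Suc.prems by (intro continuous_intros indefinite_integral_continuous_1 ig) auto
        qed (use F Suc.prems \<phi> \<open>\<not> T ^ n * G \<le> 1\<close> in auto)
        then obtain s where s: "0 \<le> s" "s \<le> a" "(T - s) ^ n * integral {s..T} g = 1"
          using \<phi> Suc.prems by auto
        have "s < T" using s Suc.prems \<open>0 < n\<close> by (cases "s = T") auto
        have "integral {a..T} W \<le> integral {s..T} W"
          using s Suc.prems by (intro integral_positive_subinterval_mono[OF W]) auto
        also have "\<dots> \<le> 2 * K * integral {s..T} g"
          using exact[of s T] s \<open>s < T\<close> by auto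
        also have "\<dots> \<le> 2 * K * G" unfolding G_def
          using s Suc.prems \<open>0 \<le> K\<close>
          by (intro mult_left_mono integral_positive_subinterval_mono[OF g]) auto
        also have "\<dots> \<le> 2 * K * integral {a..T} g + 2 * K * G"
          using pos[of a T] Suc.prems \<open>0 \<le> K\<close> by simp
        finally show ?thesis .
      qed
    qed
    note step = this
    obtain N :: nat where "T / h0 \<le> real N" using real_arch_simple by blast
    then have "integral {0..T} W \<le> 2 * K * G + 2 * K * G"
      using step[of 0 N] assms(1) h0(1) unfolding G_def by (simp add: field_simps)
    also have "\<dots> \<le> K * (1 / T ^ n + 4 * G)"
      using assms(1) \<open>0 \<le> K\<close> by (simp add: distrib_left)
    finally show ?thesis by (simp add: G_def)
  qed
qed

text \<open>Repeated application of the mean value theorem between points chosen in the outer thirds.\<close>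

lemma exists_small_derivative:
  "\<exists>C>0. \<forall>f :: nat \<Rightarrow> real \<Rightarrow> real. \<forall>a b M. a < b \<longrightarrow>
    (\<forall>j<n. \<forall>t\<in>{a..b}. (f j has_real_derivative f (Suc j) t) (at t within {a..b})) \<longrightarrow>
    (\<forall>t\<in>{a..b}. \<bar>f 0 t\<bar> \<le> M) \<longrightarrow> (\<exists>\<xi>\<in>{a..b}. \<bar>f n \<xi>\<bar> \<le> C * M / (b - a) ^ n)"
proof (induction n)
  case 0
  show ?case by (rule exI[of _ 1]) auto
next
  case (Suc n)
  then obtain C where "C > 0" and C: "\<And>(f :: nat \<Rightarrow> real \<Rightarrow> real) a b M. a < b \<Longrightarrow>
    (\<forall>j<n. \<forall>t\<in>{a..b}. (f j has_real_derivative f (Suc j) t) (at t within {a..b})) \<Longrightarrow>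
    (\<forall>t\<in>{a..b}. \<bar>f 0 t\<bar> \<le> M) \<Longrightarrow> (\<exists>\<xi>\<in>{a..b}. \<bar>f n \<xi>\<bar> \<le> C * M / (b - a) ^ n)"
    by metis
  show ?case
  \<comment> \<open>Each outer third has length h = (b - a) / 3, which costs 3^n; dividing by the
    distance of the two points, at least h, costs another 3, and the two values together give the
    2.\<close>
  proof (rule exI[of _ "2 * 3 ^ Suc n * C"], intro conjI allI impI)
    fix f :: "nat \<Rightarrow> real \<Rightarrow> real" and a b M :: real
    assume "a < b"
      and d: "\<forall>j<Suc n. \<forall>t\<in>{a..b}. (f j has_real_derivative f (Suc j) t) (at t within {a..b})"
      and M: "\<forall>t\<in>{a..b}. \<bar>f 0 t\<bar> \<le> M"
    define h where "h = (b - a) / 3"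
    have h: "0 < h" "b = a + 3 * h" using \<open>a < b\<close> by (auto simp: h_def field_simps)
    have M0: "0 \<le> M" using order_trans[OF abs_ge_zero bspec[OF M, of a]] \<open>a < b\<close> by simp
    have sub: "\<exists>\<xi>\<in>{c..c + h}. \<bar>f n \<xi>\<bar> \<le> C * M / h ^ n" if "{c..c + h} \<subseteq> {a..b}" for c
    proof -
      have "\<exists>\<xi>\<in>{c..c + h}. \<bar>f n \<xi>\<bar> \<le> C * M / (c + h - c) ^ n"
        by (rule C) (use that d M h in \<open>auto intro!: has_field_derivative_subset[of _ _ _ "{a..b}" "{c..c + h}"]\<close>)
      then show ?thesis by simp
    qed
    obtain x where x: "a \<le> x" "x \<le> a + h" "\<bar>f n x\<bar> \<le> C * M / h ^ n" using sub[of a] h by auto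
    obtain y where y: "a + 2 * h \<le> y" "y \<le> b" "\<bar>f n y\<bar> \<le> C * M / h ^ n"
      using sub[of "a + 2 * h"] h by auto
    have "x < y" using x y h by simp
    have "\<exists>\<xi>\<in>{x..y}. f n y - f n x = f (Suc n) \<xi> * (y - x)"
    proof (rule mvt_very_simple[of x y "f n" "\<lambda>\<xi> z. f (Suc n) \<xi> * z"])
      fix s assume "x \<le> s" "s \<le> y"
      then show "(f n has_derivative (\<lambda>z. f (Suc n) s * z)) (at s within {x..y})"
        using d x y h unfolding has_field_derivative_def[symmetric]
        by (auto intro!: has_field_derivative_subset[of _ _ _ "{a..b}" "{x..y}"])
    qed (use \<open>x < y\<close> in simp)
    then obtain \<xi> where \<xi>: "x \<le> \<xi>" "\<xi> \<le> y" "f n y - f n x = f (Suc n) \<xi> * (y - x)" by auto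
    have "h * \<bar>f (Suc n) \<xi>\<bar> \<le> (y - x) * \<bar>f (Suc n) \<xi>\<bar>"
      using x y h by (intro mult_right_mono) auto
    also have "\<dots> = \<bar>f n y - f n x\<bar>" using \<xi> \<open>x < y\<close> by (simp add: abs_mult)
    also have "\<dots> \<le> 2 * (C * M / h ^ n)" using x y by linarith
    finally have "\<bar>f (Suc n) \<xi>\<bar> \<le> 2 * (C * M / h ^ n) / h" using h by (simp add: field_simps)
    also have "\<dots> = 2 * 3 ^ Suc n * C * M / (b - a) ^ Suc n"
      unfolding h_def using \<open>a < b\<close> by (simp add: field_simps power_divide)
    finally show "\<exists>\<xi>\<in>{a..b}. \<bar>f (Suc n) \<xi>\<bar> \<le> 2 * 3 ^ Suc n * C * M / (b - a) ^ Suc n"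
      using \<xi> x y h by (intro bexI[of _ \<xi>]) auto
  qed (use \<open>C > 0\<close> in simp)
qed

text \<open>f is a function with its successive derivatives. The last condition says that the
  integral of |f^(n+1)| is at most 1 / (b - a)^n, the size that scaling alone predicts for f^(n);
  under it all intermediate derivatives have their scaling size.\<close>

definition scaled_jet :: "nat \<Rightarrow> real \<Rightarrow> real \<Rightarrow> real \<Rightarrow> (nat \<Rightarrow> real \<Rightarrow> real) \<Rightarrow> bool" where
  "scaled_jet n M a b f \<longleftrightarrow> a < b \<and>
    (\<forall>j\<le>n. \<forall>t\<in>{a..b}. (f j has_real_derivative f (Suc j) t) (at t within {a..b})) \<and>
    continuous_on {a..b} (f (Suc n)) \<and> (\<forall>t\<in>{a..b}. \<bar>f 0 t\<bar> \<le> M) \<and>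
    (b - a) ^ n * integral {a..b} (\<lambda>t. \<bar>f (Suc n) t\<bar>) \<le> 1"

text \<open>Descent from the top order, with i counting the steps down. At order n the deviation
  from a point where f^(n) has scaling size is at most the integral of |f^(n+1)|, the origin of the
  1 in M + 1. At a lower order it is at most the length times the bound one order above, which
  restores one power of b - a.\<close>

lemma derivative_bounds_on_interval_aux:
  assumes "i \<le> n"
  shows "\<exists>C>0. \<forall>f :: nat \<Rightarrow> real \<Rightarrow> real. \<forall>a b M. scaled_jet n M a b f \<longrightarrow> (\<forall>t\<in>{a..b}. \<bar>f (n - i) t\<bar> \<le> C * (M + 1) / (b - a) ^ (n - i))"
  using assms
proof (induction i)
  case 0
  obtain C where "C > 0" and C: "\<And>(f :: nat \<Rightarrow> real \<Rightarrow> real) a b M. a < b \<Longrightarrow>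
    (\<forall>j<n. \<forall>t\<in>{a..b}. (f j has_real_derivative f (Suc j) t) (at t within {a..b})) \<Longrightarrow>
    (\<forall>t\<in>{a..b}. \<bar>f 0 t\<bar> \<le> M) \<Longrightarrow> (\<exists>\<xi>\<in>{a..b}. \<bar>f n \<xi>\<bar> \<le> C * M / (b - a) ^ n)"
    using exists_small_derivative[of n] by metis
  show ?case
  proof (rule exI[of _ "C + 1"], intro conjI allI impI ballI)
    fix f :: "nat \<Rightarrow> real \<Rightarrow> real" and a b M t :: real
    assume sj: "scaled_jet n M a b f" and t: "t \<in> {a..b}"
    then have "a < b"
      and d: "\<forall>j\<le>n. \<forall>t\<in>{a..b}. (f j has_real_derivative f (Suc j) t) (at t within {a..b})"
      and c: "continuous_on {a..b} (f (Suc n))"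
      and M: "\<forall>t\<in>{a..b}. \<bar>f 0 t\<bar> \<le> M"
      and G: "(b - a) ^ n * integral {a..b} (\<lambda>t. \<bar>f (Suc n) t\<bar>) \<le> 1"
      by (auto simp: scaled_jet_def)
    have M0: "0 \<le> M" using order_trans[OF abs_ge_zero bspec[OF M, of a]] \<open>a < b\<close> by simp
    obtain \<xi> where \<xi>: "\<xi> \<in> {a..b}" "\<bar>f n \<xi>\<bar> \<le> C * M / (b - a) ^ n"
      using C[of a b f M] \<open>a < b\<close> d M by auto
    have ftc: "\<bar>f n q - f n p\<bar> \<le> integral {a..b} (\<lambda>t. \<bar>f (Suc n) t\<bar>)" if "p \<in> {a..b}" "q \<in> {a..b}" "p \<le> q" for p q
    proof -
      have "(f (Suc n) has_integral f n q - f n p) {p..q}"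
        by (rule fundamental_theorem_of_calculus)
          (use that d in \<open>auto simp: has_real_derivative_iff_has_vector_derivative[symmetric]
            intro!: has_field_derivative_subset[of _ _ _ "{a..b}" "{p..q}"]\<close>)
      then have "f n q - f n p = integral {p..q} (f (Suc n))" by (simp add: integral_unique)
      also have "\<bar>\<dots>\<bar> \<le> integral {p..q} (\<lambda>t. \<bar>f (Suc n) t\<bar>)"
      proof -
        have c': "continuous_on {p..q} (f (Suc n))"
          using that by (intro continuous_on_subset[OF c]) auto
        show ?thesis
          using integral_norm_bound_integral[of "f (Suc n)" "{p..q}" "\<lambda>t. \<bar>f (Suc n) t\<bar>"]
            integrable_continuous_real[OF c'] integrable_continuous_real[OF continuous_on_rabs[OF c']]
          by simp
      qed
      also have "\<dots> \<le> integral {a..b} (\<lambda>t. \<bar>f (Suc n) t\<bar>)"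
      proof -
        have sub: "{p..q} \<subseteq> {a..b}" using that by auto
        show ?thesis
          by (intro integral_subset_le sub integrable_continuous_real continuous_on_rabs
              continuous_on_subset[OF c]) auto
      qed
      finally show ?thesis .
    qed
    have "\<bar>f n t - f n \<xi>\<bar> \<le> integral {a..b} (\<lambda>t. \<bar>f (Suc n) t\<bar>)"
      using ftc[of t \<xi>] ftc[of \<xi> t] \<xi> t by (cases "t \<le> \<xi>") (auto simp: abs_minus_commute)
    also have "\<dots> \<le> 1 / (b - a) ^ n" using G \<open>a < b\<close> by (simp add: field_simps)
    finally have "\<bar>f n t\<bar> \<le> C * M / (b - a) ^ n + 1 / (b - a) ^ n" using \<xi> by linarith
    also have "\<dots> = (C * M + 1) / (b - a) ^ n" by (simp add: add_divide_distrib)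
    also have "\<dots> \<le> (C + 1) * (M + 1) / (b - a) ^ n"
      using \<open>a < b\<close> M0 \<open>C > 0\<close> by (intro divide_right_mono) (auto simp: algebra_simps)
    finally show "\<bar>f (n - 0) t\<bar> \<le> (C + 1) * (M + 1) / (b - a) ^ (n - 0)" by simp
  qed (use \<open>C > 0\<close> in simp)
next
  case (Suc i)
  define m where "m = n - Suc i"
  have m: "n - i = Suc m" "m < n" using Suc.prems by (auto simp: m_def)
  obtain C where "C > 0" and C: "\<And>(f :: nat \<Rightarrow> real \<Rightarrow> real) a b M. a < b \<Longrightarrow>
    (\<forall>j<m. \<forall>t\<in>{a..b}. (f j has_real_derivative f (Suc j) t) (at t within {a..b})) \<Longrightarrow>
    (\<forall>t\<in>{a..b}. \<bar>f 0 t\<bar> \<le> M) \<Longrightarrow> (\<exists>\<xi>\<in>{a..b}. \<bar>f m \<xi>\<bar> \<le> C * M / (b - a) ^ m)"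
    using exists_small_derivative[of m] by metis
  obtain B where "B > 0" and B: "\<And>(f :: nat \<Rightarrow> real \<Rightarrow> real) a b M t. scaled_jet n M a b f \<Longrightarrow> t\<in>{a..b} \<Longrightarrow> \<bar>f (Suc m) t\<bar> \<le> B * (M + 1) / (b - a) ^ (Suc m)"
    using Suc.IH[OF Suc_leD[OF Suc.prems]] unfolding m(1) by metis
  show ?case unfolding m_def[symmetric]
  proof (rule exI[of _ "C + B"], intro conjI allI impI ballI)
    fix f :: "nat \<Rightarrow> real \<Rightarrow> real" and a b M t :: real
    assume sj: "scaled_jet n M a b f" and t: "t \<in> {a..b}"
    then have "a < b"
      and d: "\<forall>j\<le>n. \<forall>t\<in>{a..b}. (f j has_real_derivative f (Suc j) t) (at t within {a..b})"
      and c: "continuous_on {a..b} (f (Suc n))"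
      and M: "\<forall>t\<in>{a..b}. \<bar>f 0 t\<bar> \<le> M"
      and G: "(b - a) ^ n * integral {a..b} (\<lambda>t. \<bar>f (Suc n) t\<bar>) \<le> 1"
      by (auto simp: scaled_jet_def)
    have M0: "0 \<le> M" using order_trans[OF abs_ge_zero bspec[OF M, of a]] \<open>a < b\<close> by simp
    obtain \<xi> where \<xi>: "\<xi> \<in> {a..b}" "\<bar>f m \<xi>\<bar> \<le> C * M / (b - a) ^ m"
      using C[of a b f M] \<open>a < b\<close> d M m by auto
    have "\<bar>f m t - f m \<xi>\<bar> \<le> B * (M + 1) / (b - a) ^ (Suc m) * \<bar>t - \<xi>\<bar>"
    proof -
      have "norm (f m t - f m \<xi>) \<le> B * (M + 1) / (b - a) ^ (Suc m) * norm (t - \<xi>)"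
        by (rule field_differentiable_bound[of "{a..b}" "f m" "f (Suc m)"])
          (use B[OF sj] d m \<xi> t in auto)
      then show ?thesis by simp
    qed
    also have "\<dots> \<le> B * (M + 1) / (b - a) ^ (Suc m) * (b - a)"
      using \<xi> t \<open>a < b\<close> \<open>B > 0\<close> M0 by (intro mult_left_mono) auto
    also have "\<dots> = B * (M + 1) / (b - a) ^ m" using \<open>a < b\<close> by simp
    finally have "\<bar>f m t\<bar> \<le> C * M / (b - a) ^ m + B * (M + 1) / (b - a) ^ m" using \<xi> by linarith
    also have "\<dots> = (C * M + B * (M + 1)) / (b - a) ^ m" by (simp add: add_divide_distrib)
    also have "\<dots> \<le> (C + B) * (M + 1) / (b - a) ^ m"
      using \<open>a < b\<close> M0 \<open>C > 0\<close> by (intro divide_right_mono) (auto simp: algebra_simps)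
    finally show "\<bar>f m t\<bar> \<le> (C + B) * (M + 1) / (b - a) ^ m" .
  qed (use \<open>C > 0\<close> \<open>B > 0\<close> in simp)
qed

lemma derivative_bounds_on_interval:
  "\<exists>C>0. \<forall>f :: nat \<Rightarrow> real \<Rightarrow> real. \<forall>a b M. scaled_jet n M a b f \<longrightarrow> (\<forall>j\<le>n. \<forall>t\<in>{a..b}. \<bar>f j t\<bar> \<le> C * (M + 1) / (b - a) ^ j)"
proof -
  obtain C where C: "\<And>i. i \<le> n \<Longrightarrow> C i > 0" and CB: "\<And>i (f :: nat \<Rightarrow> real \<Rightarrow> real) a b M t. i \<le> n \<Longrightarrow> scaled_jet n M a b f \<Longrightarrow> t\<in>{a..b} \<Longrightarrow> \<bar>f (n - i) t\<bar> \<le> C i * (M + 1) / (b - a) ^ (n - i)"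
    using derivative_bounds_on_interval_aux[of _ n] by metis
  have Cs: "C i \<le> (\<Sum>i\<le>n. C i)" if "i \<le> n" for i
    using that C by (intro member_le_sum) (auto intro: less_imp_le)
  show ?thesis
  proof (rule exI[of _ "\<Sum>i\<le>n. C i"], intro conjI allI impI ballI)
    show "0 < (\<Sum>i\<le>n. C i)" using C by (intro sum_pos) auto
  next
    fix f :: "nat \<Rightarrow> real \<Rightarrow> real" and a b M t :: real and j
    assume h: "scaled_jet n M a b f" "t \<in> {a..b}" and j: "j \<le> n"
    then have "a < b" and M: "\<forall>t\<in>{a..b}. \<bar>f 0 t\<bar> \<le> M" by (auto simp: scaled_jet_def)
    then have M0: "0 \<le> M" using order_trans[OF abs_ge_zero bspec[OF M, of a]] by simp
    have "\<bar>f j t\<bar> \<le> C (n - j) * (M + 1) / (b - a) ^ j"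
      using CB[of "n - j", OF _ h] j by simp
    also have "\<dots> \<le> (\<Sum>i\<le>n. C i) * (M + 1) / (b - a) ^ j"
      using \<open>a < b\<close> M0 Cs[of "n - j"] by (intro divide_right_mono mult_right_mono) auto
    finally show "\<bar>f j t\<bar> \<le> (\<Sum>i\<le>n. C i) * (M + 1) / (b - a) ^ j" .
  qed
qed

text \<open>On a piece of length h the derivatives below order k scale like h^(-j), so weight k
  bounds |F| by a multiple of h^(-k) + |\<gamma>^(k)|. Integrated over the piece, h^(-k) becomes
  h^(-n) with n = k - 1, which is the local hypothesis of the partition lemma; k \<ge> 2 makes n
  positive, as that lemma requires.\<close>

lemma integral_along_jet_bound:
  assumes F: "diff_hom k F" and "2 \<le> k" "0 < T" "0 \<le> M"
  shows "\<exists>C>0. \<forall>\<gamma>. Ck_on k {0..T} \<gamma> \<longrightarrow> (\<forall>t\<in>{0..T}. \<bar>\<gamma> t\<bar> \<le> M) \<longrightarrow>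
    integral {0..T} (\<lambda>t. \<bar>F (jet {0..T} \<gamma> t)\<bar>)
      \<le> C * (1 + integral {0..T} (\<lambda>t. \<bar>nth_deriv_on {0..T} k \<gamma> t\<bar>))"
proof -
  obtain n where k: "k = Suc n" "0 < n" using assms(2) by (cases k) auto
  obtain D where "D > 0" and D: "\<And>(f :: nat \<Rightarrow> real \<Rightarrow> real) a b M j t. scaled_jet n M a b f \<Longrightarrow> j \<le> n \<Longrightarrow> t\<in>{a..b} \<Longrightarrow> \<bar>f j t\<bar> \<le> D * (M + 1) / (b - a) ^ j"
    using derivative_bounds_on_interval[of n] by metis
  define M' where "M' = max M (D * (M + 1))"
  have M': "M \<le> M'" "D * (M + 1) \<le> M'" "0 \<le> M'" using assms(4) by (auto simp: M'_def)
  obtain L where "L \<ge> 0" and L: "\<And>x \<rho> \<theta>. 0 < \<rho> \<Longrightarrow> 0 \<le> \<theta> \<Longrightarrow> \<bar>x 0\<bar> \<le> M' \<Longrightarrow>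
     (\<forall>j<k. \<bar>x j\<bar> \<le> M' * \<rho> ^ j) \<Longrightarrow> (\<forall>j\<in>{0<..k}. \<bar>x j\<bar> \<le> \<theta> * \<rho> ^ j) \<Longrightarrow> \<bar>F x\<bar> \<le> L * \<theta> * \<rho> ^ k"
    using diff_hom_bound_factor[OF F _ M'(3)] k by auto
  define K where "K = L * (M' * 1 + 1)"
  have K0: "0 \<le> K" using M'(3) \<open>L \<ge> 0\<close> by (simp add: K_def)
  have pt: "\<bar>F x\<bar> \<le> K * (\<rho> ^ k + \<bar>x k\<bar>)" if "0 < \<rho>" "\<forall>j<k. \<bar>x j\<bar> \<le> M' * \<rho> ^ j" for x :: "nat \<Rightarrow> real" and \<rho>
  proof -
    have x0: "\<bar>x 0\<bar> \<le> M'" using that(2) k by auto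
    \<comment> \<open>This \<theta> serves all orders at once: M' covers those below k, and at the
      top order \<theta> \<rho>^k exceeds |x_k|. The bound is therefore linear in |x_k|.\<close>
    have "\<bar>F x\<bar> \<le> L * (M' + \<bar>x k\<bar> / \<rho> ^ k) * \<rho> ^ k"
    proof (rule L[OF \<open>0 < \<rho>\<close> _ x0 that(2)], use M' that(1) in simp, rule ballI)
      fix j assume j: "j \<in> {0<..k}"
      show "\<bar>x j\<bar> \<le> (M' + \<bar>x k\<bar> / \<rho> ^ k) * \<rho> ^ j"
      proof (cases "j = k")
        case True
        then show ?thesis using that(1) M' by (simp add: distrib_right)
      next
        case False
        then have "\<bar>x j\<bar> \<le> M' * \<rho> ^ j" using j that by auto
        also have "\<dots> \<le> (M' + \<bar>x k\<bar> / \<rho> ^ k) * \<rho> ^ j" using that(1) by (intro mult_right_mono) auto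
        finally show ?thesis .
      qed
    qed
    also have "\<dots> = L * (M' * \<rho> ^ k + \<bar>x k\<bar>)" using that(1) by (simp add: field_simps)
    also have "\<dots> \<le> K * (\<rho> ^ k + \<bar>x k\<bar>)"
      unfolding K_def mult.assoc using \<open>L \<ge> 0\<close> M'(3) that(1)
      by (intro mult_left_mono) (auto simp: algebra_simps)
    finally show ?thesis .
  qed
  show ?thesis
  proof (rule exI[of _ "K * (1 / T ^ n + 4) + 1"], intro conjI allI impI)
    show "0 < K * (1 / T ^ n + 4) + 1" using K0 \<open>0 < T\<close> by (intro add_nonneg_pos) auto
  next
    fix \<gamma> assume \<gamma>: "Ck_on k {0..T} \<gamma>" and M: "\<forall>t\<in>{0..T}. \<bar>\<gamma> t\<bar> \<le> M"
    let ?W = "\<lambda>t. \<bar>F (jet {0..T} \<gamma> t)\<bar>" and ?g = "\<lambda>t. \<bar>nth_deriv_on {0..T} k \<gamma> t\<bar>"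
    have cW: "continuous_on {0..T} ?W"
      by (intro continuous_intros continuous_on_along_jet[OF F \<gamma>]) simp
    have cg: "continuous_on {0..T} ?g"
      using continuous_on_jet[OF \<gamma>, of k] by (auto simp: jet_def intro!: continuous_intros)
    have "integral {0..T} ?W \<le> K * (1 / T ^ n + 4 * integral {0..T} ?g)"
    proof (rule integral_le_by_scaled_partition[OF \<open>0 < T\<close> \<open>0 < n\<close> K0 cW _ cg])
      fix a b assume ab: "0 \<le> a" "a < b" "b \<le> T" and G: "(b - a) ^ n * integral {a..b} ?g \<le> 1"
      have sub: "{a..b} \<subseteq> {0..T}" using ab by auto
      have dd: "\<bar>nth_deriv_on {0..T} j \<gamma> t\<bar> \<le> D * (M + 1) / (b - a) ^ j" if "j < k" "t \<in> {a..b}" for j t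
      proof -
        have "\<forall>j\<le>n. \<forall>t\<in>{a..b}. (nth_deriv_on {0..T} j \<gamma> has_real_derivative
            nth_deriv_on {0..T} (Suc j) \<gamma> t) (at t within {a..b})"
          using nth_deriv_on_has_derivative[OF \<gamma>] sub k unfolding jet_def
          by (meson has_field_derivative_subset in_mono le_imp_less_Suc)
        moreover have "continuous_on {a..b} (nth_deriv_on {0..T} (Suc n) \<gamma>)"
          using continuous_on_subset[OF continuous_on_jet[OF \<gamma>, of k] sub] k by (simp add: jet_def)
        ultimately have "scaled_jet n M a b (\<lambda>j. nth_deriv_on {0..T} j \<gamma>)"
          using M sub G ab k unfolding scaled_jet_def by auto
        from D[OF this, of j t] that k show ?thesis by simp
      qed
      have "?W t \<le> K * ((1 / (b - a)) ^ k + ?g t)" if "t \<in> {a..b}" for t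
      proof -
        have "\<bar>jet {0..T} \<gamma> t j\<bar> \<le> M' * (1 / (b - a)) ^ j" if "j < k" for j
        proof -
          have "\<bar>jet {0..T} \<gamma> t j\<bar> \<le> D * (M + 1) / (b - a) ^ j"
            unfolding jet_def using dd[OF that \<open>t \<in> {a..b}\<close>] .
          also have "\<dots> \<le> M' / (b - a) ^ j" using M'(2) ab by (intro divide_right_mono) auto
          finally show ?thesis by (simp add: power_divide)
        qed
        then show ?thesis using pt[of "1 / (b - a)" "jet {0..T} \<gamma> t"] ab by (simp add: jet_def)
      qed
      then have "integral {a..b} ?W \<le> integral {a..b} (\<lambda>t. K * ((1 / (b - a)) ^ k + ?g t))"
        by (intro integral_le integrable_continuous_real continuous_intros
            continuous_on_subset[OF cW sub] continuous_on_subset[OF cg sub]) auto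
      also have "\<dots> = K * integral {a..b} (\<lambda>t. (1 / (b - a)) ^ k + ?g t)"
        by simp
      also have "integral {a..b} (\<lambda>t. (1 / (b - a)) ^ k + ?g t)
          = integral {a..b} (\<lambda>t. (1 / (b - a)) ^ k) + integral {a..b} ?g"
        by (intro Henstock_Kurzweil_Integration.integral_add integrable_continuous_real continuous_intros
            continuous_on_subset[OF cg sub])
      also have "integral {a..b} (\<lambda>t. (1 / (b - a)) ^ k) = 1 / (b - a) ^ n"
        using ab k by (simp add: power_divide)
      finally show "integral {a..b} ?W \<le> K * (1 / (b - a) ^ n + integral {a..b} ?g)" .
    qed auto
    also have "\<dots> \<le> (K * (1 / T ^ n + 4) + 1) * (1 + integral {0..T} ?g)"
    proof -
      have "0 \<le> integral {0..T} ?g" by (intro integral_nonneg integrable_continuous_real cg) auto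
      then show ?thesis using K0 \<open>0 < T\<close> by (simp add: algebra_simps)
    qed
    finally show "integral {0..T} ?W \<le> (K * (1 / T ^ n + 4) + 1) * (1 + integral {0..T} ?g)" .
  qed
qed

section \<open>Absolutely continuous functions and Gronwall's lemma\<close>

lemma abs_cont_on_subset:
  assumes "abs_cont_on S f" "R \<subseteq> S"
  shows "abs_cont_on R f"
  unfolding abs_cont_on_def
proof (intro allI impI)
  fix e :: real assume "0 < e"
  from assms(1)[unfolded abs_cont_on_def, rule_format, OF \<open>0 < e\<close>]
  obtain d where d: "d > 0 \<and> (\<forall>D :: (real \<times> real) set.
        finite D \<longrightarrow> (\<forall>(a, b)\<in>D. a \<le> b \<and> {a..b} \<subseteq> S) \<longrightarrow>
        disjoint_family_on (\<lambda>(a, b). {a<..<b}) D \<longrightarrow> (\<Sum>(a, b)\<in>D. b - a) < d \<longrightarrow>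
        (\<Sum>(a, b)\<in>D. \<bar>f b - f a\<bar>) < e)" ..
  show "\<exists>d>0. \<forall>D :: (real \<times> real) set.
        finite D \<longrightarrow> (\<forall>(a, b)\<in>D. a \<le> b \<and> {a..b} \<subseteq> R) \<longrightarrow>
        disjoint_family_on (\<lambda>(a, b). {a<..<b}) D \<longrightarrow> (\<Sum>(a, b)\<in>D. b - a) < d \<longrightarrow>
        (\<Sum>(a, b)\<in>D. \<bar>f b - f a\<bar>) < e"
  proof (rule exI[of _ d], intro conjI allI impI)
    show "0 < d" using d ..
    fix D :: "(real \<times> real) set"
    assume D: "finite D" "\<forall>(a, b)\<in>D. a \<le> b \<and> {a..b} \<subseteq> R"
      "disjoint_family_on (\<lambda>(a, b). {a<..<b}) D" "(\<Sum>(a, b)\<in>D. b - a) < d"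
    have "\<forall>(a, b)\<in>D. a \<le> b \<and> {a..b} \<subseteq> S"
      using D(2) assms(2) by (auto dest!: bspec)
    with D d show "(\<Sum>(a, b)\<in>D. \<bar>f b - f a\<bar>) < e" by blast
  qed
qed

text \<open>Evaluate \<open>h q - h p\<close> on a fine tagged partition. The cells whose tag lies in \<open>N\<close> are contained
  in an open set of small measure, so absolute continuity makes their total contribution small.\<close>

lemma derivative_le_imp_diff_le:
  fixes h \<psi> v :: "real \<Rightarrow> real"
  assumes "p \<le> q" and ac: "abs_cont_on {p..q} v" and "0 \<le> L"
    and dom: "\<And>a b. a \<in> {p..q} \<Longrightarrow> b \<in> {p..q} \<Longrightarrow> \<bar>h b - h a\<bar> \<le> L * (\<bar>b - a\<bar> + \<bar>v b - v a\<bar>)"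
    and N: "negligible N"
    and der: "\<And>t. t \<in> {p..q} - N \<Longrightarrow> (h has_real_derivative h' t) (at t within {p..q})"
    and le: "\<And>t. t \<in> {p..q} - N \<Longrightarrow> h' t \<le> \<psi> t"
    and int: "\<psi> integrable_on {p..q}"
  shows "h q - h p \<le> integral {p..q} \<psi>"
proof -
  \<comment> \<open>With value 0 on N, the cells tagged in N drop out of the Riemann sums while the
    integral is unchanged.\<close>
  define \<psi>' where "\<psi>' = (\<lambda>t. if t \<in> N then 0 else \<psi> t)"
  define I where "I = integral {p..q} \<psi>"
  have hi: "(\<psi>' has_integral I) {p..q}"
    unfolding I_def by (rule has_integral_spike[OF N _ integrable_integral[OF int]]) (auto simp: \<psi>'_def)
  have main: "h q - h p \<le> I + (1 + (q - p) + 2 * L) * e" if "0 < e" for e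
  proof -
    from ac[unfolded abs_cont_on_def, rule_format, OF \<open>0 < e\<close>]
    obtain d where d: "d > 0 \<and> (\<forall>D :: (real \<times> real) set.
        finite D \<longrightarrow> (\<forall>(a, b)\<in>D. a \<le> b \<and> {a..b} \<subseteq> {p..q}) \<longrightarrow>
        disjoint_family_on (\<lambda>(a, b). {a<..<b}) D \<longrightarrow> (\<Sum>(a, b)\<in>D. b - a) < d \<longrightarrow>
        (\<Sum>(a, b)\<in>D. \<bar>v b - v a\<bar>) < e)" ..
    then have "0 < d" ..
    \<comment> \<open>Measure below d makes the variation of v small; measure below e controls the
      length term in \<open>dom\<close>.\<close>
    obtain U where U: "open U" "N \<subseteq> U" "U \<in> lmeasurable" "measure lebesgue U < min d e"
    proof -
      have nN: "N \<in> null_sets lebesgue" using N by (simp add: negligible_iff_null_sets)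
      have "0 < min d e" using \<open>0 < d\<close> \<open>0 < e\<close> by simp
      from sets_lebesgue_outer_open[OF null_setsD2[OF nN] this]
      obtain U where U: "open U" "N \<subseteq> U" "emeasure lebesgue (U - N) < ennreal (min d e)" by metis
      have "emeasure lebesgue U < ennreal (min d e)"
        using U(3) emeasure_Diff_null_set[OF nN, of U] U(1) by simp
      moreover from this have "U \<in> lmeasurable"
        using U(1) by (intro fmeasurableI) (auto simp: order.strict_trans ennreal_less_top)
      ultimately show thesis
        using that[OF U(1,2)] by (simp add: emeasure_eq_measure2 ennreal_less_iff)
    qed
    have "\<exists>\<delta>>0. \<forall>y\<in>{p..q}. \<bar>y - t\<bar> < \<delta> \<longrightarrow> \<bar>h y - h t - h' t * (y - t)\<bar> \<le> e * \<bar>y - t\<bar>"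
      if "t \<in> {p..q} - N" for t
      using der[OF that] \<open>0 < e\<close> unfolding has_field_derivative_def has_derivative_within_alt by auto
    then obtain \<delta> where \<delta>: "\<And>t. t \<in> {p..q} - N \<Longrightarrow> 0 < \<delta> t"
      "\<And>t y. t \<in> {p..q} - N \<Longrightarrow> y \<in> {p..q} \<Longrightarrow> \<bar>y - t\<bar> < \<delta> t \<Longrightarrow> \<bar>h y - h t - h' t * (y - t)\<bar> \<le> e * \<bar>y - t\<bar>"
      by metis
    obtain g1 where g1: "gauge g1" "\<And>P. P tagged_division_of {p..q} \<Longrightarrow> g1 fine P \<Longrightarrow>
        \<bar>(\<Sum>(x, k)\<in>P. measure lborel k * \<psi>' x) - I\<bar> < e"
      using hi \<open>0 < e\<close> unfolding has_integral_real by (auto simp: mult.commute)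
    \<comment> \<open>Fineness puts a cell tagged in N inside U and makes every other cell obey the
      difference quotient estimate; the radius 1 off {p..q} merely completes the gauge.\<close>
    define g2 where "g2 t = (if t \<in> N then U else if t \<in> {p..q} then ball t (\<delta> t) else ball t 1)" for t
    have "gauge g2" using U \<delta> by (auto simp: gauge_def g2_def)
    obtain P where P: "P tagged_division_of {p..q}" "(\<lambda>x. g1 x \<inter> g2 x) fine P"
      using fine_division_exists_real[OF gauge_Int[OF g1(1) \<open>gauge g2\<close>]] by blast
    have fine: "g1 fine P" "g2 fine P" using P(2) by (auto simp: fine_Int)
    have finP: "finite P" using P(1) by blast
    have cell: "x \<in> {p..q} \<and> Inf k \<le> x \<and> x \<le> Sup k \<and> k = {Inf k..Sup k} \<and> k \<subseteq> {p..q} \<and> k \<subseteq> g2 x \<and>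
       measure lborel k = Sup k - Inf k"
      if xk: "(x, k) \<in> P" for x k
    proof -
      obtain a b where k: "k = {a..b}" using tagged_division_ofD(4)[OF P(1) xk] by (auto simp: box_real)
      moreover have "x \<in> k" "k \<subseteq> {p..q}" using tagged_division_ofD(2,3)[OF P(1) xk] by auto
      ultimately show ?thesis using fine(2) xk by (auto simp: fine_def)
    qed
    define A where "A = {(x, k) \<in> P. x \<notin> N}"
    \<comment> \<open>Degenerate cells are left out: they contribute 0, and without them a cell is
      determined by its endpoints, which makes the passage to the set of intervals D
      injective.\<close>
    define B where "B = {(x, k) \<in> P. x \<in> N \<and> Inf k < Sup k}"
    have fin: "finite A" "finite B" using finP
      by (auto simp: A_def B_def intro: finite_subset[of _ P])
    let ?h = "\<lambda>(x :: real, k :: real set). h (Sup k) - h (Inf k)"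
    have "h q - h p = (\<Sum>z\<in>P. ?h z)"
      using additive_tagged_division_1[OF \<open>p \<le> q\<close> P(1), of h] by simp
    also have "\<dots> = (\<Sum>z\<in>A \<union> B. ?h z)"
    proof (rule sum.mono_neutral_right[OF finP])
      show "\<forall>z\<in>P - (A \<union> B). ?h z = 0"
      proof
        fix z assume z: "z \<in> P - (A \<union> B)"
        obtain x k where [simp]: "z = (x, k)" by (cases z)
        have "\<not> Inf k < Sup k" "Inf k \<le> Sup k" using z cell[of x k] by (auto simp: A_def B_def)
        then show "?h z = 0" by simp
      qed
    qed (auto simp: A_def B_def)
    also have "\<dots> = (\<Sum>z\<in>A. ?h z) + (\<Sum>z\<in>B. ?h z)"
      by (rule sum.union_disjoint) (use fin in \<open>auto simp: A_def B_def\<close>)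
    also have "(\<Sum>z\<in>A. ?h z) \<le> I + e + e * (q - p)"
    proof -
      have "(\<Sum>z\<in>A. ?h z) \<le> (\<Sum>(x, k)\<in>A. measure lborel k * \<psi>' x + e * measure lborel k)"
      proof (rule sum_mono)
        fix z assume z: "z \<in> A"
        obtain x k where zz [simp]: "z = (x, k)" by (cases z)
        have xk: "(x, k) \<in> P" "x \<notin> N" using z by (auto simp: A_def)
        note c = cell[OF xk(1)]
        have "Inf k \<in> k" "Sup k \<in> k" using c by auto
        then have b: "\<bar>Inf k - x\<bar> < \<delta> x" "\<bar>Sup k - x\<bar> < \<delta> x" and m: "Inf k \<in> {p..q}" "Sup k \<in> {p..q}"
          using c xk(2) by (auto simp: g2_def dist_real_def)
        have x: "x \<in> {p..q} - N" using c xk(2) by auto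
        have "h (Sup k) - h (Inf k) \<le> h' x * (Sup k - Inf k) + e * (Sup k - Inf k)"
          using \<delta>(2)[OF x m(1) b(1)] \<delta>(2)[OF x m(2) b(2)] c by (auto simp: algebra_simps abs_if split: if_splits)
        also have "h' x * (Sup k - Inf k) \<le> \<psi> x * (Sup k - Inf k)"
          using le[OF x] c by (intro mult_right_mono) auto
        finally show "?h z \<le> (case z of (x, k) \<Rightarrow> measure lborel k * \<psi>' x + e * measure lborel k)"
          using c xk(2) by (simp add: \<psi>'_def mult.commute)
      qed
      also have "\<dots> = (\<Sum>(x, k)\<in>A. measure lborel k * \<psi>' x) + e * (\<Sum>(x, k)\<in>A. measure lborel k)"
        by (simp add: sum.distrib case_prod_unfold sum_distrib_left)
      also have "(\<Sum>(x, k)\<in>A. measure lborel k * \<psi>' x) = (\<Sum>(x, k)\<in>P. measure lborel k * \<psi>' x)"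
        by (rule sum.mono_neutral_left[OF finP]) (auto simp: A_def \<psi>'_def)
      also have "(\<Sum>(x, k)\<in>P. measure lborel k * \<psi>' x) \<le> I + e"
        using g1(2)[OF P(1) fine(1)] by linarith
      also have "(\<Sum>(x, k)\<in>A. measure lborel k) \<le> (\<Sum>(x, k)\<in>P. measure lborel k)"
        by (rule sum_mono2[OF finP]) (auto simp: A_def)
      also have "(\<Sum>(x, k)\<in>P. measure lborel k) = q - p"
        using additive_content_tagged_division[of P p q] P(1) \<open>p \<le> q\<close> by (simp add: box_real)
      finally show ?thesis using \<open>0 < e\<close> by simp
    qed
    also have "(\<Sum>z\<in>B. ?h z) \<le> L * (e + e)"
    proof -
      define D where "D = (\<lambda>(x, k). (Inf k, Sup k)) ` B"
      have dj: "interior k1 \<inter> interior k2 = {}" if "(x1, k1) \<in> B" "(x2, k2) \<in> B" "(x1, k1) \<noteq> (x2, k2)" for x1 k1 x2 k2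
        by (rule tagged_division_ofD(5)[OF P(1) _ _ that(3)]) (use that in \<open>auto simp: B_def\<close>)
      have ik: "interior k = {Inf k<..<Sup k}" if "(x, k) \<in> B" for x k
        using cell[of x k] that interior_atLeastAtMost_real[of "Inf k" "Sup k"] by (auto simp: B_def)
      have inj: "inj_on (\<lambda>(x, k). (Inf k, Sup k)) B"
      proof (rule inj_onI, clarify)
        fix x1 k1 x2 k2 :: real and K1 K2 :: "real set"
        assume h: "(x1, K1) \<in> B" "(x2, K2) \<in> B" "Inf K1 = Inf K2" "Sup K1 = Sup K2"
        show "x1 = x2 \<and> K1 = K2"
        proof (rule ccontr)
          assume "\<not> (x1 = x2 \<and> K1 = K2)"
          then have "{Inf K1<..<Sup K1} = {}" using dj[OF h(1,2)] ik[OF h(1)] ik[OF h(2)] h by auto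
          then show False using h(1) by (auto simp: B_def)
        qed
      qed
      have Dfam: "disjoint_family_on (\<lambda>(a, b). {a<..<b}) D"
      proof (unfold disjoint_family_on_def, intro ballI impI)
        fix z1 z2 assume z: "z1 \<in> D" "z2 \<in> D" "z1 \<noteq> z2"
        from z(1,2) obtain x1 k1 x2 k2 where h: "(x1, k1) \<in> B" "(x2, k2) \<in> B"
          "z1 = (Inf k1, Sup k1)" "z2 = (Inf k2, Sup k2)" by (auto simp: D_def)
        with z(3) have "(x1, k1) \<noteq> (x2, k2)" by auto
        from dj[OF h(1,2) this]
        show "(case z1 of (a, b) \<Rightarrow> {a<..<b}) \<inter> (case z2 of (a, b) \<Rightarrow> {a<..<b}) = {}"
          using ik[OF h(1)] ik[OF h(2)] h by simp
      qed
      have Dsub: "a \<le> b \<and> {a..b} \<subseteq> {p..q} \<and> {a..b} \<subseteq> U" if ab: "(a, b) \<in> D" for a b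
      proof -
        obtain x k where h: "(x, k) \<in> B" "a = Inf k" "b = Sup k" using ab by (auto simp: D_def)
        then have "(x, k) \<in> P" "x \<in> N" by (auto simp: B_def)
        with cell[of x k] h(2,3) show ?thesis by (simp add: g2_def)
      qed
      have finD: "finite D" using fin by (simp add: D_def)
      have "(\<Sum>(a, b)\<in>D. b - a) = (\<Sum>z\<in>D. measure lebesgue ((\<lambda>(a, b). {a<..<b}) z))"
        using Dsub by (intro sum.cong) auto
      also have "\<dots> = measure lebesgue (\<Union>z\<in>D. (\<lambda>(a, b). {a<..<b}) z)"
        by (rule measure_finite_Union[symmetric, OF finD _ Dfam])
          (use Dsub in \<open>auto simp: emeasure_lborel_Ioo\<close>)
      also have "\<dots> \<le> measure lebesgue U"
      proof (rule measure_mono_fmeasurable)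
        show "(\<Union>z\<in>D. (\<lambda>(a, b). {a<..<b}) z) \<subseteq> U"
        proof (rule UN_least)
          fix z assume "z \<in> D"
          then show "(\<lambda>(a, b). {a<..<b}) z \<subseteq> U"
            using Dsub[of "fst z" "snd z"] greaterThanLessThan_subseteq_atLeastAtMost_iff[of "fst z" "snd z" "fst z" "snd z"]
            by (auto simp: case_prod_unfold)
        qed
        show "(\<Union>z\<in>D. (\<lambda>(a, b). {a<..<b}) z) \<in> sets lebesgue"
          using finD by (intro sets.finite_UN) auto
      qed (rule U(3))
      finally have len: "(\<Sum>(a, b)\<in>D. b - a) < min d e" using U by linarith
      have var: "(\<Sum>(a, b)\<in>D. \<bar>v b - v a\<bar>) < e"
        using d finD Dfam Dsub len by auto
      have "(\<Sum>z\<in>B. ?h z) = (\<Sum>(a, b)\<in>D. h b - h a)"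
        unfolding D_def by (subst sum.reindex[OF inj]) (auto intro!: sum.cong)
      also have "\<dots> \<le> (\<Sum>(a, b)\<in>D. L * ((b - a) + \<bar>v b - v a\<bar>))"
      proof (rule sum_mono, clarify)
        fix a b assume "(a, b) \<in> D"
        then show "h b - h a \<le> L * ((b - a) + \<bar>v b - v a\<bar>)"
          using dom[of a b] Dsub[of a b] by auto
      qed
      also have "\<dots> = L * ((\<Sum>(a, b)\<in>D. b - a) + (\<Sum>(a, b)\<in>D. \<bar>v b - v a\<bar>))"
        unfolding case_prod_unfold by (simp only: sum_distrib_left[symmetric] sum.distrib)
      also have "\<dots> \<le> L * (e + e)"
        using len var \<open>0 \<le> L\<close> by (intro mult_left_mono) auto
      finally show ?thesis .
    qed
    finally show ?thesis by (simp add: algebra_simps)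
  qed
  have "h q - h p \<le> I + \<epsilon>" if "0 < \<epsilon>" for \<epsilon>
  proof -
    let ?c = "1 + (q - p) + 2 * L"
    have "0 < ?c" using \<open>p \<le> q\<close> \<open>0 \<le> L\<close> by simp
    then show ?thesis using main[of "\<epsilon> / ?c"] that by simp
  qed
  then show ?thesis unfolding I_def by (rule field_le_epsilon)
qed

text \<open>Since \<open>E\<close> may vanish, the logarithm is taken of \<open>E + \<eta>\<close>, and then \<open>\<eta>\<close> tends to 0.\<close>

lemma gronwall_abs_cont:
  fixes E \<phi> v :: "real \<Rightarrow> real"
  assumes ac: "abs_cont_on {0..T} v" and "0 \<le> L"
    and dom: "\<And>a b. a \<in> {0..T} \<Longrightarrow> b \<in> {0..T} \<Longrightarrow> \<bar>E b - E a\<bar> \<le> L * (\<bar>b - a\<bar> + \<bar>v b - v a\<bar>)"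
    and N: "negligible N"
    and der: "\<And>t. t \<in> {0..T} - N \<Longrightarrow>
       \<exists>D. (E has_real_derivative D) (at t within {0..T}) \<and> \<bar>D\<bar> \<le> \<phi> t * E t"
    and \<phi>: "\<phi> integrable_on {0..T}" "\<And>t. t \<in> {0..T} \<Longrightarrow> 0 \<le> \<phi> t"
    and E: "\<And>t. t \<in> {0..T} \<Longrightarrow> 0 \<le> E t"
    and t: "t \<in> {0..T}"
  shows "E 0 * exp (- integral {0..T} \<phi>) \<le> E t" "E t \<le> E 0 * exp (integral {0..T} \<phi>)"
proof -
  define J where "J = integral {0..T} \<phi>"
  obtain E' where E': "\<And>s. s \<in> {0..T} - N \<Longrightarrow> (E has_real_derivative E' s) (at s within {0..T})"
    "\<And>s. s \<in> {0..T} - N \<Longrightarrow> \<bar>E' s\<bar> \<le> \<phi> s * E s"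
    using der by metis
  have sub: "{0..t} \<subseteq> {0..T}" using t by auto
  have ac': "abs_cont_on {0..t} v" by (rule abs_cont_on_subset[OF ac sub])
  have \<phi>': "\<phi> integrable_on {0..t}" by (rule integrable_subinterval_real[OF \<phi>(1) sub])
  have J: "integral {0..t} \<phi> \<le> J"
    unfolding J_def by (rule integral_subset_le[OF sub \<phi>' \<phi>(1)]) (use \<phi>(2) in blast)
  \<comment> \<open>On values at least \<eta> the logarithm has Lipschitz constant 1 / \<eta>, so
    the control of increments by v passes from E to ln (E + \<eta>).\<close>
  have ln_lip: "\<bar>ln y - ln x\<bar> \<le> \<bar>y - x\<bar> / \<eta>" if "0 < \<eta>" "\<eta> \<le> x" "\<eta> \<le> y" for x y \<eta> :: real
  proof -
    have *: "ln b - ln a \<le> \<bar>b - a\<bar> / \<eta>" if "\<eta> \<le> a" "\<eta> \<le> b" for a b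
    proof -
      have "ln b - ln a \<le> (b - a) / a" using ln_diff_le[of b a] that \<open>0 < \<eta>\<close> by simp
      also have "\<dots> \<le> \<bar>b - a\<bar> / a" using that \<open>0 < \<eta>\<close> by (intro divide_right_mono) auto
      also have "\<dots> \<le> \<bar>b - a\<bar> / \<eta>" using that \<open>0 < \<eta>\<close> by (intro divide_left_mono) auto
      finally show ?thesis .
    qed
    show ?thesis using *[of x y] *[of y x] that by (auto simp: abs_if split: if_splits)
  qed
  have bounds: "\<bar>ln (E t + \<eta>) - ln (E 0 + \<eta>)\<bar> \<le> J" if \<eta>: "0 < \<eta>" for \<eta>
  proof -
    let ?h = "\<lambda>s. ln (E s + \<eta>)" and ?h' = "\<lambda>s. E' s / (E s + \<eta>)"
    have d1: "\<bar>?h b - ?h a\<bar> \<le> L / \<eta> * (\<bar>b - a\<bar> + \<bar>v b - v a\<bar>)" if "a \<in> {0..t}" "b \<in> {0..t}" for a b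
    proof -
      have "a \<in> {0..T}" "b \<in> {0..T}" using that sub by auto
      note ab = this
      have "\<bar>?h b - ?h a\<bar> \<le> \<bar>E b - E a\<bar> / \<eta>" using ln_lip[OF \<eta>, of "E a + \<eta>" "E b + \<eta>"] E ab by simp
      also have "\<dots> \<le> L * (\<bar>b - a\<bar> + \<bar>v b - v a\<bar>) / \<eta>"
        using \<eta> by (intro divide_right_mono dom ab) auto
      finally show ?thesis by simp
    qed
    have d2: "(?h has_real_derivative ?h' s) (at s within {0..t})" if "s \<in> {0..t} - N" for s
    proof -
      have s: "s \<in> {0..T} - N" using that sub by auto
      have "0 < E s + \<eta>" using E[of s] s \<eta> by simp
      then show ?thesis
        using has_field_derivative_subset[OF E'(1)[OF s] sub]
        by (auto intro!: derivative_eq_intros simp: field_simps)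
    qed
    have d3: "\<bar>?h' s\<bar> \<le> \<phi> s" if "s \<in> {0..t} - N" for s
    proof -
      have s: "s \<in> {0..T} - N" using that sub by auto
      have p: "0 < E s + \<eta>" using E[of s] s \<eta> by simp
      have "\<bar>E' s\<bar> \<le> \<phi> s * (E s + \<eta>)"
        using E'(2)[OF s] \<phi>(2)[of s] s \<eta> by (auto simp: distrib_left intro: order_trans)
      then show ?thesis using p by (simp add: pos_divide_le_eq)
    qed
    have L: "0 \<le> L / \<eta>" using \<open>0 \<le> L\<close> \<eta> by simp
    have t0: "0 \<le> t" using t by simp
    have "?h t - ?h 0 \<le> integral {0..t} \<phi>"
      by (rule derivative_le_imp_diff_le[OF t0 ac' L d1 N d2 abs_le_D1[OF d3] \<phi>'])
    moreover have "- ?h t - (- ?h 0) \<le> integral {0..t} \<phi>"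
      by (rule derivative_le_imp_diff_le[OF t0 ac' L _ N DERIV_minus[OF d2] abs_le_D2[OF d3] \<phi>'])
        (use d1 in \<open>auto simp: abs_minus_commute\<close>)
    ultimately show ?thesis using J by linarith
  qed
  have pos: "0 \<le> E t" "0 \<le> E 0" using E t by auto
  have est: "x \<le> y * exp J" if "\<And>\<eta>. 0 < \<eta> \<Longrightarrow> ln (x + \<eta>) - ln (y + \<eta>) \<le> J" "0 \<le> x" "0 \<le> y" for x y
  proof (rule field_le_epsilon)
    fix \<epsilon> :: real assume "0 < \<epsilon>"
    define \<eta> where "\<eta> = \<epsilon> / exp J"
    have \<eta>: "0 < \<eta>" using \<open>0 < \<epsilon>\<close> by (simp add: \<eta>_def)
    have "ln (x + \<eta>) \<le> ln (y + \<eta>) + J" using that(1)[OF \<eta>] by simp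
    then have "exp (ln (x + \<eta>)) \<le> exp (ln (y + \<eta>) + J)" by simp
    then have "x + \<eta> \<le> (y + \<eta>) * exp J"
      using \<eta> that by (simp add: exp_add)
    then show "x \<le> y * exp J + \<epsilon>" using \<eta> by (simp add: distrib_right \<eta>_def)
  qed
  show "E t \<le> E 0 * exp (integral {0..T} \<phi>)"
    unfolding J_def[symmetric] by (rule est[OF _ pos]) (use bounds in \<open>force simp: abs_le_iff\<close>)
  have "E 0 \<le> E t * exp J" by (rule est[OF _ pos(2,1)]) (use bounds in \<open>force simp: abs_le_iff\<close>)
  then show "E 0 * exp (- integral {0..T} \<phi>) \<le> E t"
    unfolding J_def[symmetric] by (simp add: exp_minus field_simps)
qed

section \<open>The energies and their derivatives\<close>

text \<open>The r-th derivative of a_i as a function on jets. In this form it carries its weight 2 *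
  i - 2 + r, and its bounds can be fixed before \<gamma> is chosen.\<close>

definition coeff_jet :: "nat \<Rightarrow> nat \<Rightarrow> (nat \<Rightarrow> real) \<Rightarrow> real" where
  "coeff_jet i r = (total_deriv ^^ r) (if i \<le> 1 then \<lambda>x. x 0 else eval_poly (coeff_polys i))"

lemma diff_hom_coeff_jet: "1 \<le> i \<Longrightarrow> diff_hom (2 * i - 2 + r) (coeff_jet i r)"
proof -
  assume "1 \<le> i"
  then have "diff_hom (2 * i - 2) (if i \<le> 1 then \<lambda>x. x 0 else eval_poly (coeff_polys i))"
    using coeff_polys_family diff_hom.coord[of 0]
    by (auto simp: coeff_family_def intro!: diff_hom_eval_poly)
  then show ?thesis unfolding coeff_jet_def by (rule diff_hom_total_deriv_funpow)
qed

lemma a_coeff_eq_coeff_jet: "a_coeff S \<gamma> i s = coeff_jet i 0 (jet S \<gamma> s)"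
  by (simp add: coeff_of_def coeff_jet_def eval_along_def jet_def)

lemma total_deriv_coeff_jet: "total_deriv (coeff_jet i r) = coeff_jet i (Suc r)"
  by (simp add: coeff_jet_def)

lemma funpow_total_deriv_coeff_jet: "(total_deriv ^^ r) (coeff_jet i 0) = coeff_jet i r"
  by (simp add: coeff_jet_def)

lemma nth_deriv_a_coeff:
  assumes "1 \<le> i" "Ck_on k {0..T} \<gamma>" "0 < T" "2 * i - 2 + r \<le> k" "t \<in> {0..T}"
  shows "nth_deriv_on {0..T} r (a_coeff {0..T} \<gamma> i) t = coeff_jet i r (jet {0..T} \<gamma> t)"
  using nth_deriv_on_along_jet[OF diff_hom_coeff_jet[OF assms(1), of 0] assms(2,3) _ assms(5)
      a_coeff_eq_coeff_jet, of r] assms(4)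
  by (simp add: funpow_total_deriv_coeff_jet)

lemma coeff_jet_has_derivative:
  assumes "1 \<le> i" "Ck_on k S \<gamma>" "2 * i - 2 + r < k" "t \<in> S"
  shows "((\<lambda>s. coeff_jet i r (jet S \<gamma> s)) has_real_derivative coeff_jet i (Suc r) (jet S \<gamma> t)) (at t within S)"
  using has_derivative_along_jet[OF diff_hom_coeff_jet[OF assms(1)] assms(2-4)]
  by (simp add: total_deriv_coeff_jet)

lemma Ck_on_mono: "Ck_on k S \<gamma> \<Longrightarrow> j \<le> k \<Longrightarrow> Ck_on j S \<gamma>"
  using continuous_on_jet[of k S \<gamma> j] unfolding Ck_on_def jet_def by auto

text \<open>The recursion after the quotient rule, multiplied by \<gamma>^2; the two expressions for
  the derivative agree since derivatives within a nondegenerate interval are unique. For i = 1 the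
  quotient a_1 / \<gamma> is constant.\<close>

lemma coeff_jet_recursion:
  assumes "1 \<le> i" "0 < T" and \<gamma>: "Ck_on k {0..T} \<gamma>" "\<And>s. s \<in> {0..T} \<Longrightarrow> 0 < \<gamma> s"
    and "2 * i \<le> k" "t \<in> {0..T}"
  shows "coeff_jet i 1 (jet {0..T} \<gamma> t) * \<gamma> t - coeff_jet i 0 (jet {0..T} \<gamma> t) * jet {0..T} \<gamma> t 1
    = (if i = 1 then 0 else - (1/4) * (\<gamma> t) ^ 3 * coeff_jet (i - 1) 3 (jet {0..T} \<gamma> t))"
proof -
  let ?A = "\<lambda>i r s. coeff_jet i r (jet {0..T} \<gamma> s)" and ?S = "{0..T}"
  have nz: "\<gamma> t \<noteq> 0" using \<gamma>(2)[OF assms(6)] by simp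
  show ?thesis
  proof (cases "i = 1")
    case True
    have "coeff_jet 1 0 = (\<lambda>x. x 0)" "coeff_jet 1 1 = total_deriv (\<lambda>x. x 0)"
      by (auto simp: coeff_jet_def)
    moreover have "total_deriv (\<lambda>x. x 0) = (\<lambda>x. x 1)"
      by (rule ext, rule total_deriv_eqI) (auto intro!: derivative_eq_intros)
    ultimately show ?thesis using True by (simp add: jet_def)
  next
    case False
    then have i2: "2 \<le> i" using assms by simp
    have C: "Ck_on (2 * i - 1) ?S \<gamma>" by (rule Ck_on_mono[OF \<gamma>(1)]) (use assms in simp)
    have d1: "((\<lambda>s. a_coeff ?S \<gamma> i s / \<gamma> s) has_real_derivative
        - (1/4) * \<gamma> t * nth_deriv_on ?S 3 (a_coeff ?S \<gamma> (i - 1)) t) (at t within ?S)"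
      using coeff_polys_family i2 C \<gamma>(2) assms unfolding coeff_family_def by blast
    have n3: "nth_deriv_on ?S 3 (a_coeff ?S \<gamma> (i - 1)) t = ?A (i - 1) 3 t"
      by (rule nth_deriv_a_coeff[OF _ \<gamma>(1)]) (use i2 assms in auto)
    have d2: "((\<lambda>s. a_coeff ?S \<gamma> i s / \<gamma> s) has_real_derivative
        (?A i 1 t * \<gamma> t - ?A i 0 t * jet ?S \<gamma> t 1) / (\<gamma> t * \<gamma> t)) (at t within ?S)"
      unfolding a_coeff_eq_coeff_jet
      using DERIV_divide[OF coeff_jet_has_derivative[OF assms(1) \<gamma>(1), of 0 t]
          nth_deriv_on_has_derivative[OF \<gamma>(1), of 0 t]] nz assms
      by (simp add: jet_def)
    have "- (1/4) * \<gamma> t * ?A (i - 1) 3 t = (?A i 1 t * \<gamma> t - ?A i 0 t * jet ?S \<gamma> t 1) / (\<gamma> t * \<gamma> t)"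
      using vector_derivative_within_Icc[OF assms(2,6) d1 refl]
        vector_derivative_within_Icc[OF assms(2,6) d2 refl] n3 by simp
    then show ?thesis using nz False by (simp add: field_simps power3_eq_cube)
  qed
qed

text \<open>The term added in passing from index 2 * i - 1 to 2 * i. For i = 1 it is the whole
  energy of index 2: the quadratic form of index 1 together with - a_1' u u'.\<close>

definition energy_block :: "real \<Rightarrow> (real \<Rightarrow> real) \<Rightarrow> real \<Rightarrow> (real \<Rightarrow> real) \<Rightarrow> nat \<Rightarrow> real \<Rightarrow> real" where
  "energy_block T \<gamma> lam u i t = 1 / lam ^ (2 * i - 2) *
     (coeff_jet i 0 (jet {0..T} \<gamma> t) *
        ((nth_deriv_on {0..T} 1 u t)\<^sup>2 + lam\<^sup>2 * (1 / (\<gamma> t)\<^sup>2) * (u t)\<^sup>2)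
      - coeff_jet i 1 (jet {0..T} \<gamma> t) * u t * nth_deriv_on {0..T} 1 u t)"

definition energy_corr :: "real \<Rightarrow> (real \<Rightarrow> real) \<Rightarrow> real \<Rightarrow> (real \<Rightarrow> real) \<Rightarrow> nat \<Rightarrow> real \<Rightarrow> real" where
  "energy_corr T \<gamma> lam u i t =
     1/2 * (1 / lam ^ (2 * i - 2)) * coeff_jet i 2 (jet {0..T} \<gamma> t) * (u t)\<^sup>2"

text \<open>Both parities go through one induction, since each index builds on the one below
  it.\<close>

lemma energy_as_blocks:
  assumes \<gamma>: "Ck_on k {0..T} \<gamma>" "0 < T" and t: "t \<in> {0..T}" and "1 \<le> m"
  shows "2 * m \<le> k \<Longrightarrow> energy T \<gamma> lam u (2 * m) t
      = (\<Sum>i\<in>{1..<m}. energy_block T \<gamma> lam u i t + energy_corr T \<gamma> lam u i t) + energy_block T \<gamma> lam u m t"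
    and "2 * m + 1 \<le> k \<Longrightarrow> energy T \<gamma> lam u (2 * m + 1) t
      = (\<Sum>i\<in>{1..<Suc m}. energy_block T \<gamma> lam u i t + energy_corr T \<gamma> lam u i t)"
proof -
  note nd = nth_deriv_a_coeff[OF _ \<gamma> _ t]
  have step: "energy T \<gamma> lam u (2 * m + 1) t = energy T \<gamma> lam u (2 * m) t + energy_corr T \<gamma> lam u m t"
    if "1 \<le> m" "2 * m + 1 \<le> k" for m
  proof (cases "m = 1")
    case True
    then show ?thesis using nd[of 1 2] that fun_cong[OF energy.simps(2)[of T \<gamma> lam u 2], of t]
      by (simp add: energy_corr_def Let_def)
  next
    case False
    then show ?thesis using nd[of m 2] that
      by (simp add: energy_corr_def Let_def)
  qed
  have "(2 * m \<le> k \<longrightarrow> energy T \<gamma> lam u (2 * m) t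
      = (\<Sum>i\<in>{1..<m}. energy_block T \<gamma> lam u i t + energy_corr T \<gamma> lam u i t) + energy_block T \<gamma> lam u m t) \<and>
    (2 * m + 1 \<le> k \<longrightarrow> energy T \<gamma> lam u (2 * m + 1) t
      = (\<Sum>i\<in>{1..<Suc m}. energy_block T \<gamma> lam u i t + energy_corr T \<gamma> lam u i t))"
    using \<open>1 \<le> m\<close>
  proof (induction m rule: dec_induct)
    case base
    have e2: "energy T \<gamma> lam u 2 t = energy_block T \<gamma> lam u 1 t" if "2 \<le> k"
      using nd[of 1 1] that
      by (simp add: energy_block_def Let_def a_coeff_eq_coeff_jet eval_nat_numeral)
    then show ?case using step[of 1] by simp
  next
    case (step m)
    have e: "energy T \<gamma> lam u (2 * Suc m) t = energy T \<gamma> lam u (2 * m + 1) t + energy_block T \<gamma> lam u (Suc m) t"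
      if "2 * Suc m \<le> k"
      using nd[of "Suc m" 1] that step.hyps
      by (simp add: energy_block_def Let_def a_coeff_eq_coeff_jet)
    show ?case using step.IH e \<open>1 \<le> m\<close> step.hyps \<open>\<And>m. 1 \<le> m \<Longrightarrow> 2 * m + 1 \<le> k \<Longrightarrow> _\<close>[of "Suc m"]
      by auto
  qed
  then show "2 * m \<le> k \<Longrightarrow> energy T \<gamma> lam u (2 * m) t
      = (\<Sum>i\<in>{1..<m}. energy_block T \<gamma> lam u i t + energy_corr T \<gamma> lam u i t) + energy_block T \<gamma> lam u m t"
    and "2 * m + 1 \<le> k \<Longrightarrow> energy T \<gamma> lam u (2 * m + 1) t
      = (\<Sum>i\<in>{1..<Suc m}. energy_block T \<gamma> lam u i t + energy_corr T \<gamma> lam u i t)" by auto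
qed

text \<open>What the derivative of block i gains because u'' is - \<lambda>^2 c^2 u instead of -
  \<lambda>^2 \<gamma>^(-2) u.\<close>

definition energy_perturbation :: "real \<Rightarrow> (real \<Rightarrow> real) \<Rightarrow> real \<Rightarrow> (real \<Rightarrow> real) \<Rightarrow> (real \<Rightarrow> real) \<Rightarrow> nat \<Rightarrow> real \<Rightarrow> real" where
  "energy_perturbation T \<gamma> lam c u i t = 1 / lam ^ (2 * i - 2) * (lam\<^sup>2 * ((c t)\<^sup>2 - 1 / (\<gamma> t)\<^sup>2) *
     (coeff_jet i 1 (jet {0..T} \<gamma> t) * (u t)\<^sup>2
      - 2 * coeff_jet i 0 (jet {0..T} \<gamma> t) * (u t * nth_deriv_on {0..T} 1 u t)))"

text \<open>By the recursion, the flux left over by the correction of index \<open>i\<close> is cancelled by the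
  block of index \<open>i + 1\<close>.\<close>

definition energy_flux :: "real \<Rightarrow> (real \<Rightarrow> real) \<Rightarrow> real \<Rightarrow> (real \<Rightarrow> real) \<Rightarrow> nat \<Rightarrow> real \<Rightarrow> real" where
  "energy_flux T \<gamma> lam u i t = (if i = 0 then 0 else
     1/2 * (1 / lam ^ (2 * i - 2)) * coeff_jet i 3 (jet {0..T} \<gamma> t) * (u t)\<^sup>2)"

lemma lam_abs_mult_le: "0 < lam \<Longrightarrow> lam * \<bar>x * y\<bar> \<le> y\<^sup>2 + lam\<^sup>2 * x\<^sup>2" for lam x y :: real
proof -
  assume "0 < lam"
  then have "lam * \<bar>x * y\<bar> = (lam * \<bar>x\<bar>) * \<bar>y\<bar>" by (simp add: abs_mult)
  also have "\<dots> \<le> 2 * ((lam * \<bar>x\<bar>) * \<bar>y\<bar>)" using \<open>0 < lam\<close> by simp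
  also have "\<dots> \<le> y\<^sup>2 + lam\<^sup>2 * x\<^sup>2"
    using sum_squares_bound[of "lam * \<bar>x\<bar>" "\<bar>y\<bar>"] by (simp add: power_mult_distrib)
  finally show ?thesis .
qed

section \<open>Derivatives of the energies at a time where the equation holds\<close>

context
  fixes T lam :: real and \<gamma> c u v :: "real \<Rightarrow> real" and k :: nat and t :: real
  assumes T: "0 < T" and t: "t \<in> {0..T}" and lam: "0 < lam"
    and \<gamma>: "Ck_on k {0..T} \<gamma>" "\<And>s. s \<in> {0..T} \<Longrightarrow> 0 < \<gamma> s"
    and v: "v = nth_deriv_on {0..T} 1 u"
    and du: "(u has_real_derivative v t) (at t within {0..T})"
    and dv: "(v has_real_derivative - (lam\<^sup>2 * (c t)\<^sup>2 * u t)) (at t within {0..T})"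
begin

lemma Q_has_derivative:
  assumes "1 \<le> k"
  shows "((\<lambda>s. (v s)\<^sup>2 + lam\<^sup>2 * (1 / (\<gamma> s)\<^sup>2) * (u s)\<^sup>2) has_real_derivative
     2 * lam\<^sup>2 * u t * v t * (1 / (\<gamma> t)\<^sup>2 - (c t)\<^sup>2)
      - 2 * lam\<^sup>2 * jet {0..T} \<gamma> t 1 / (\<gamma> t) ^ 3 * (u t)\<^sup>2) (at t within {0..T})"
proof -
  have dg: "(\<gamma> has_real_derivative jet {0..T} \<gamma> t 1) (at t within {0..T})"
    using nth_deriv_on_has_derivative[OF \<gamma>(1), of 0 t] assms t by (simp add: jet_def)
  have nz: "\<gamma> t \<noteq> 0" using \<gamma>(2)[OF t] by simp
  show ?thesis
    by (rule derivative_eq_intros du dv dg refl | simp add: nz)+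
      (simp add: nz field_simps power2_eq_square power3_eq_cube power4_eq_xxxx)
qed

text \<open>In the derivative of a Q - a' u u' the terms a' u'^2 cancel. Once \<lambda>^2 (c^2 -
  \<gamma>^(-2)) a' u^2 is split off, the u^2 terms combine to 2 \<lambda>^2 u^2 (a' \<gamma> - a
  \<gamma>') / \<gamma>^3, which the recursion turns into - \<lambda>^2 a_(i-1)''' u^2 / 2. The
  extra \<lambda>^2 shifts the prefactor to that of index i - 1.\<close>

lemma energy_block_has_derivative:
  assumes "1 \<le> i" "2 * i \<le> k"
  shows "(energy_block T \<gamma> lam u i has_real_derivative
     energy_perturbation T \<gamma> lam c u i t
     - 1 / lam ^ (2 * i - 2) * coeff_jet i 2 (jet {0..T} \<gamma> t) * (u t * v t)
     - energy_flux T \<gamma> lam u (i - 1) t) (at t within {0..T})"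
proof -
  let ?A = "\<lambda>i r s. coeff_jet i r (jet {0..T} \<gamma> s)"
  define P where "P = 1 / lam ^ (2 * i - 2)"
  define g g1 a0 a1 a2 where "g = \<gamma> t" "g1 = jet {0..T} \<gamma> t 1" "a0 = ?A i 0 t" "a1 = ?A i 1 t" "a2 = ?A i 2 t"
  note defs = this
  have nz: "g \<noteq> 0" using \<gamma>(2)[OF t] by (simp add: defs)
  have d0: "(?A i 0 has_real_derivative a1) (at t within {0..T})"
    using coeff_jet_has_derivative[OF assms(1) \<gamma>(1), of 0 t] assms t by (simp add: defs)
  have d1: "(?A i 1 has_real_derivative a2) (at t within {0..T})"
    using coeff_jet_has_derivative[OF assms(1) \<gamma>(1), of 1 t] assms t by (simp add: defs numeral_2_eq_2)
  have "(energy_block T \<gamma> lam u i has_real_derivative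
      P * (a0 * (2 * lam\<^sup>2 * u t * v t * (1 / g\<^sup>2 - (c t)\<^sup>2) - 2 * lam\<^sup>2 * g1 / g ^ 3 * (u t)\<^sup>2)
         + a1 * ((v t)\<^sup>2 + lam\<^sup>2 * (1 / g\<^sup>2) * (u t)\<^sup>2)
      - (a1 * u t * (- (lam\<^sup>2 * (c t)\<^sup>2 * u t)) + (a1 * v t + a2 * u t) * v t))) (at t within {0..T})"
    unfolding energy_block_def[abs_def] P_def[symmetric] v[symmetric] defs
    by (intro DERIV_cmult DERIV_diff DERIV_mult' Q_has_derivative du dv d0[unfolded defs] d1[unfolded defs])
      (use assms in simp)
  moreover have "P * (a0 * (2 * lam\<^sup>2 * u t * v t * (1 / g\<^sup>2 - (c t)\<^sup>2) - 2 * lam\<^sup>2 * g1 / g ^ 3 * (u t)\<^sup>2)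
         + a1 * ((v t)\<^sup>2 + lam\<^sup>2 * (1 / g\<^sup>2) * (u t)\<^sup>2)
      - (a1 * u t * (- (lam\<^sup>2 * (c t)\<^sup>2 * u t)) + (a1 * v t + a2 * u t) * v t))
    = P * (lam\<^sup>2 * ((c t)\<^sup>2 - 1 / g\<^sup>2) * (a1 * (u t)\<^sup>2 - 2 * a0 * (u t * v t)))
      - P * a2 * (u t * v t) + P * (2 * lam\<^sup>2 * (u t)\<^sup>2 / g ^ 3 * (a1 * g - a0 * g1))"
    using nz by (simp add: field_simps power2_eq_square power3_eq_cube)
  moreover have "P * (2 * lam\<^sup>2 * (u t)\<^sup>2 / g ^ 3 * (a1 * g - a0 * g1)) = - energy_flux T \<gamma> lam u (i - 1) t"
  proof (cases "i = 1")
    case True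
    then show ?thesis using coeff_jet_recursion[OF assms(1) T \<gamma> assms(2) t]
      by (simp add: energy_flux_def defs)
  next
    case False
    then obtain n where n: "i = Suc (Suc n)" using assms(1) by (metis One_nat_def Suc_le_D not0_implies_Suc)
    have "P * lam\<^sup>2 = 1 / lam ^ (2 * (i - 1) - 2)"
      using lam by (simp add: P_def n field_simps power2_eq_square)
    moreover have "P * (2 * lam\<^sup>2 * (u t)\<^sup>2 / g ^ 3 * (a1 * g - a0 * g1))
        = - (1/2 * (P * lam\<^sup>2) * ?A (i - 1) 3 t * (u t)\<^sup>2)"
    proof -
      have R: "a1 * g - a0 * g1 = - (1/4) * g ^ 3 * ?A (i - 1) 3 t"
        using coeff_jet_recursion[OF assms(1) T \<gamma> assms(2) t] False by (simp add: defs)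
      show ?thesis unfolding R using nz by simp
    qed
    ultimately show ?thesis using False assms(1) by (simp add: energy_flux_def)
  qed
  ultimately show ?thesis
    by (simp add: energy_perturbation_def v P_def defs)
qed

text \<open>Because u^2 / 2 has derivative u u', the first term cancels the a_i'' term left by the
  block of the same index; the price is a_i'''.\<close>

lemma energy_corr_has_derivative:
  assumes "1 \<le> i" "2 * i < k"
  shows "(energy_corr T \<gamma> lam u i has_real_derivative
     1 / lam ^ (2 * i - 2) * coeff_jet i 2 (jet {0..T} \<gamma> t) * (u t * v t)
     + energy_flux T \<gamma> lam u i t) (at t within {0..T})"
proof -
  let ?A = "\<lambda>i r s. coeff_jet i r (jet {0..T} \<gamma> s)"
  have d2: "(?A i 2 has_real_derivative ?A i 3 t) (at t within {0..T})"
    using coeff_jet_has_derivative[OF assms(1) \<gamma>(1), of 2 t] assms t by (simp add: numeral_3_eq_3 numeral_2_eq_2)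
  have "(energy_corr T \<gamma> lam u i has_real_derivative
      1/2 * (1 / lam ^ (2 * i - 2)) * ?A i 2 t * (2 * u t * v t)
      + 1/2 * (1 / lam ^ (2 * i - 2)) * ?A i 3 t * (u t)\<^sup>2) (at t within {0..T})"
    unfolding energy_corr_def[abs_def]
    by (rule derivative_eq_intros d2 du refl | simp)+
  then show ?thesis using assms(1) by (simp add: energy_flux_def mult.assoc)
qed

lemma energy_sum_has_derivative:
  assumes "2 * n < k"
  shows "((\<lambda>s. \<Sum>i\<in>{1..<Suc n}. energy_block T \<gamma> lam u i s + energy_corr T \<gamma> lam u i s) has_real_derivative
     (\<Sum>i\<in>{1..<Suc n}. energy_perturbation T \<gamma> lam c u i t) + energy_flux T \<gamma> lam u n t) (at t within {0..T})"
  using assms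
proof (induction n)
  case 0
  then show ?case by (simp add: energy_flux_def)
next
  case (Suc n)
  have "((\<lambda>s. (\<Sum>i\<in>{1..<Suc n}. energy_block T \<gamma> lam u i s + energy_corr T \<gamma> lam u i s)
       + (energy_block T \<gamma> lam u (Suc n) s + energy_corr T \<gamma> lam u (Suc n) s)) has_real_derivative
     ((\<Sum>i\<in>{1..<Suc n}. energy_perturbation T \<gamma> lam c u i t) + energy_flux T \<gamma> lam u n t)
     + ((energy_perturbation T \<gamma> lam c u (Suc n) t
       - 1 / lam ^ (2 * Suc n - 2) * coeff_jet (Suc n) 2 (jet {0..T} \<gamma> t) * (u t * v t)
       - energy_flux T \<gamma> lam u (Suc n - 1) t)
       + (1 / lam ^ (2 * Suc n - 2) * coeff_jet (Suc n) 2 (jet {0..T} \<gamma> t) * (u t * v t)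
       + energy_flux T \<gamma> lam u (Suc n) t))) (at t within {0..T})"
    by (intro DERIV_add energy_block_has_derivative energy_corr_has_derivative Suc.IH)
      (use Suc.prems in auto)
  moreover have "sum f {1..<Suc (Suc n)} = sum f {1..<Suc n} + f (Suc n)" for f :: "nat \<Rightarrow> real"
    by (rule sum.atLeastLessThan_Suc) simp
  ultimately show ?case by (simp add: algebra_simps del: sum.op_ivl_Suc)
qed

text \<open>Let m = k div 2. For even k the last correction is absent and a_m'' u u' survives; for
  odd k it is the flux a_m''' u^2 / 2. As \<lambda> |u u'| and \<lambda>^2 u^2 are at most
  \<open>energy0\<close>, they absorb one or two powers of \<lambda>, so the prefactor becomes
  \<lambda>^(-(k-1)) in both cases. The weight of the surviving coefficient is 2 m - 2 + 2 + k mod 2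
  = k.\<close>

lemma energy_has_derivative:
  assumes "2 \<le> k"
  shows "\<exists>D. (energy T \<gamma> lam u k has_real_derivative
      (\<Sum>i\<in>{1..<Suc (k div 2)}. energy_perturbation T \<gamma> lam c u i t) + D) (at t within {0..T}) \<and>
     \<bar>D\<bar> \<le> 1 / lam ^ (k - 1) * \<bar>coeff_jet (k div 2) (2 + k mod 2) (jet {0..T} \<gamma> t)\<bar> * ((v t)\<^sup>2 + lam\<^sup>2 * (u t)\<^sup>2)"
proof -
  let ?A = "\<lambda>i r s. coeff_jet i r (jet {0..T} \<gamma> s)"
  define m where "m = k div 2"
  have m1: "1 \<le> m" using assms by (simp add: m_def)
  obtain n where n: "m = Suc n" using m1 by (cases m) auto
  show ?thesis
  proof (cases "even k")
    case True
    then have k: "k = 2 * m" by (simp add: m_def)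
    have "((\<lambda>s. (\<Sum>i\<in>{1..<Suc n}. energy_block T \<gamma> lam u i s + energy_corr T \<gamma> lam u i s)
        + energy_block T \<gamma> lam u m s) has_real_derivative
      ((\<Sum>i\<in>{1..<Suc n}. energy_perturbation T \<gamma> lam c u i t) + energy_flux T \<gamma> lam u n t)
      + (energy_perturbation T \<gamma> lam c u m t - 1 / lam ^ (2 * m - 2) * ?A m 2 t * (u t * v t)
         - energy_flux T \<gamma> lam u (m - 1) t)) (at t within {0..T})"
      by (intro DERIV_add energy_sum_has_derivative energy_block_has_derivative) (use m1 k n in auto)
    moreover have "sum f {1..<Suc (Suc n)} = sum f {1..<Suc n} + f (Suc n)" for f :: "nat \<Rightarrow> real"
      by (rule sum.atLeastLessThan_Suc) simp
    ultimately have "((\<lambda>s. (\<Sum>i\<in>{1..<m}. energy_block T \<gamma> lam u i s + energy_corr T \<gamma> lam u i s)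
        + energy_block T \<gamma> lam u m s) has_real_derivative
      (\<Sum>i\<in>{1..<Suc m}. energy_perturbation T \<gamma> lam c u i t)
       + (- (1 / lam ^ (2 * m - 2) * ?A m 2 t * (u t * v t)))) (at t within {0..T})"
      unfolding n by (simp add: algebra_simps del: sum.op_ivl_Suc)
    then have "(energy T \<gamma> lam u k has_real_derivative
      (\<Sum>i\<in>{1..<Suc m}. energy_perturbation T \<gamma> lam c u i t)
       + (- (1 / lam ^ (2 * m - 2) * ?A m 2 t * (u t * v t)))) (at t within {0..T})"
      by (rule has_field_derivative_transform_within[OF _ zero_less_one t])
        (use energy_as_blocks(1)[OF \<gamma>(1) T _ m1] k in auto)
    moreover have "\<bar>- (1 / lam ^ (2 * m - 2) * ?A m 2 t * (u t * v t))\<bar>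
        \<le> 1 / lam ^ (k - 1) * \<bar>?A m 2 t\<bar> * ((v t)\<^sup>2 + lam\<^sup>2 * (u t)\<^sup>2)"
    proof -
      have e: "lam ^ (k - 1) = lam ^ (2 * m - 2) * lam" unfolding k n by simp
      have "lam * \<bar>u t * v t\<bar> \<le> (v t)\<^sup>2 + lam\<^sup>2 * (u t)\<^sup>2"
        using lam_abs_mult_le[OF lam, of "u t" "v t"] .
      then have "1 / lam ^ (k - 1) * \<bar>?A m 2 t\<bar> * (lam * \<bar>u t * v t\<bar>)
          \<le> 1 / lam ^ (k - 1) * \<bar>?A m 2 t\<bar> * ((v t)\<^sup>2 + lam\<^sup>2 * (u t)\<^sup>2)"
        using lam by (intro mult_left_mono) auto
      moreover have "\<bar>- (1 / lam ^ (2 * m - 2) * ?A m 2 t * (u t * v t))\<bar>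
          = 1 / lam ^ (k - 1) * \<bar>?A m 2 t\<bar> * (lam * \<bar>u t * v t\<bar>)"
        using lam unfolding e by (simp add: abs_mult)
      ultimately show ?thesis by simp
    qed
    moreover have "2 + k mod 2 = 2" using True by simp
    ultimately show ?thesis unfolding m_def[symmetric] by (simp only:) blast
  next
    case False
    then have k: "k = 2 * m + 1" by (simp add: m_def)
    have "((\<lambda>s. \<Sum>i\<in>{1..<Suc m}. energy_block T \<gamma> lam u i s + energy_corr T \<gamma> lam u i s) has_real_derivative
     (\<Sum>i\<in>{1..<Suc m}. energy_perturbation T \<gamma> lam c u i t) + energy_flux T \<gamma> lam u m t) (at t within {0..T})"
      by (rule energy_sum_has_derivative) (use k in simp)
    then have "(energy T \<gamma> lam u k has_real_derivative
     (\<Sum>i\<in>{1..<Suc m}. energy_perturbation T \<gamma> lam c u i t) + energy_flux T \<gamma> lam u m t) (at t within {0..T})"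
      by (rule has_field_derivative_transform_within[OF _ zero_less_one t])
        (use energy_as_blocks(2)[OF \<gamma>(1) T _ m1] k in auto)
    moreover have "\<bar>energy_flux T \<gamma> lam u m t\<bar> \<le> 1 / lam ^ (k - 1) * \<bar>?A m 3 t\<bar> * ((v t)\<^sup>2 + lam\<^sup>2 * (u t)\<^sup>2)"
    proof -
      have e: "lam ^ (k - 1) = lam ^ (2 * m - 2) * lam\<^sup>2" unfolding k n by (simp add: power2_eq_square)
      have "1/2 * (lam\<^sup>2 * (u t)\<^sup>2) \<le> (v t)\<^sup>2 + lam\<^sup>2 * (u t)\<^sup>2" by simp
      then have "1 / lam ^ (k - 1) * \<bar>?A m 3 t\<bar> * (1/2 * (lam\<^sup>2 * (u t)\<^sup>2))
          \<le> 1 / lam ^ (k - 1) * \<bar>?A m 3 t\<bar> * ((v t)\<^sup>2 + lam\<^sup>2 * (u t)\<^sup>2)"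
        using lam by (intro mult_left_mono) auto
      moreover have "\<bar>energy_flux T \<gamma> lam u m t\<bar> = 1 / lam ^ (k - 1) * \<bar>?A m 3 t\<bar> * (1/2 * (lam\<^sup>2 * (u t)\<^sup>2))"
        using lam m1 unfolding e by (simp add: energy_flux_def abs_mult)
      ultimately show ?thesis by simp
    qed
    moreover have "2 + k mod 2 = 3" using False by (simp add: odd_iff_mod_2_eq_one)
    ultimately show ?thesis unfolding m_def[symmetric] by (simp only:) blast
  qed
qed

end

section \<open>Pointwise estimates\<close>

text \<open>The factor bound with \<theta> = \<epsilon> and \<rho> = \<open>lam\<close>, made
  uniform by summing the constants over finitely many pairs (i, r). Positive weight excludes the
  pair (1, 0): a_1 = \<gamma> itself is not small.\<close>

lemma coeff_jet_bounds:
  assumes "0 \<le> M"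
  shows "\<exists>K\<ge>0. \<forall>i r x lam \<epsilon>. 1 \<le> i \<longrightarrow> i \<le> m \<longrightarrow> r \<le> 2 \<longrightarrow> 0 < 2 * i - 2 + r \<longrightarrow> 0 < lam \<longrightarrow> 0 \<le> \<epsilon> \<longrightarrow> \<epsilon> \<le> 1 \<longrightarrow>
    \<bar>x 0\<bar> \<le> M \<longrightarrow> (\<forall>j\<in>{1..2 * i - 2 + r}. \<bar>x j\<bar> \<le> \<epsilon> * lam ^ j) \<longrightarrow>
    \<bar>coeff_jet i r x\<bar> \<le> K * \<epsilon> * lam ^ (2 * i - 2 + r)"
proof -
  define M' where "M' = max M 1"
  have M': "0 \<le> M'" "M \<le> M'" "1 \<le> M'" by (auto simp: M'_def)
  have "\<exists>K\<ge>0. \<forall>x lam \<epsilon>. 0 < lam \<longrightarrow> 0 \<le> \<epsilon> \<longrightarrow> \<epsilon> \<le> 1 \<longrightarrow>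
    \<bar>x 0\<bar> \<le> M \<longrightarrow> (\<forall>j\<in>{1..2 * i - 2 + r}. \<bar>x j\<bar> \<le> \<epsilon> * lam ^ j) \<longrightarrow>
    \<bar>coeff_jet i r x\<bar> \<le> K * \<epsilon> * lam ^ (2 * i - 2 + r)" if i: "1 \<le> i" "0 < 2 * i - 2 + r" for i r
  proof -
    obtain K where "K \<ge> 0" and K: "\<And>x \<rho> \<theta>. 0 < \<rho> \<Longrightarrow> 0 \<le> \<theta> \<Longrightarrow> \<bar>x 0\<bar> \<le> M' \<Longrightarrow>
       (\<forall>j<2 * i - 2 + r. \<bar>x j\<bar> \<le> M' * \<rho> ^ j) \<Longrightarrow> (\<forall>j\<in>{0<..2 * i - 2 + r}. \<bar>x j\<bar> \<le> \<theta> * \<rho> ^ j) \<Longrightarrow>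
       \<bar>coeff_jet i r x\<bar> \<le> K * \<theta> * \<rho> ^ (2 * i - 2 + r)"
      using diff_hom_bound_factor[OF diff_hom_coeff_jet[OF i(1), of r] i(2) M'(1)] by metis
    show ?thesis
    proof (rule exI[of _ K], intro conjI allI impI)
      fix x lam \<epsilon> assume h: "0 < (lam::real)" "0 \<le> (\<epsilon>::real)" "\<epsilon> \<le> 1" "\<bar>x 0\<bar> \<le> M"
        "\<forall>j\<in>{1..2 * i - 2 + r}. \<bar>x j\<bar> \<le> \<epsilon> * lam ^ j"
      have "\<bar>x j\<bar> \<le> M' * lam ^ j" if "j < 2 * i - 2 + r" for j
      proof (cases "j = 0")
        case False
        then have "\<bar>x j\<bar> \<le> \<epsilon> * lam ^ j" using h(5) that by auto
        also have "\<dots> \<le> M' * lam ^ j" using h M' by (intro mult_right_mono) auto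
        finally show ?thesis .
      qed (use h M' in auto)
      moreover have "\<bar>x 0\<bar> \<le> M'" using h M' by simp
      ultimately show "\<bar>coeff_jet i r x\<bar> \<le> K * \<epsilon> * lam ^ (2 * i - 2 + r)"
        using h by (intro K) auto
    qed (rule \<open>K \<ge> 0\<close>)
  qed
  then obtain K where K0: "\<And>i r. 1 \<le> i \<Longrightarrow> 0 < 2 * i - 2 + r \<Longrightarrow> K i r \<ge> 0" and
    K: "\<And>i r x lam \<epsilon>. 1 \<le> i \<Longrightarrow> 0 < 2 * i - 2 + r \<Longrightarrow> 0 < lam \<Longrightarrow> 0 \<le> \<epsilon> \<Longrightarrow> \<epsilon> \<le> 1 \<Longrightarrow>
    \<bar>x 0\<bar> \<le> M \<Longrightarrow> (\<forall>j\<in>{1..2 * i - 2 + r}. \<bar>x j\<bar> \<le> \<epsilon> * lam ^ j) \<Longrightarrow>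
    \<bar>coeff_jet i r x\<bar> \<le> K i r * \<epsilon> * lam ^ (2 * i - 2 + r)" by metis
  define I where "I = {(i, r). 1 \<le> i \<and> i \<le> m \<and> r \<le> 2 \<and> 0 < 2 * i - 2 + r}"
  have fI: "finite I"
    by (rule finite_subset[of _ "{..m} \<times> {..2}"]) (auto simp: I_def)
  have KI: "0 \<le> (case z of (i, r) \<Rightarrow> K i r)" if "z \<in> I" for z
    using that unfolding I_def case_prod_unfold mem_Collect_eq by (elim conjE) (rule K0)
  define K' where "K' = (\<Sum>(i, r)\<in>I. K i r)"
  show ?thesis
  proof (rule exI[of _ K'], intro conjI allI impI)
    show "0 \<le> K'" unfolding K'_def by (rule sum_nonneg) (rule KI)
    fix i r and x lam \<epsilon> assume h: "1 \<le> i" "i \<le> m" "r \<le> 2" "0 < 2 * i - 2 + r" "0 < (lam::real)" "0 \<le> (\<epsilon>::real)" "\<epsilon> \<le> 1" "\<bar>x 0\<bar> \<le> M"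
        "\<forall>j\<in>{1..2 * i - 2 + r}. \<bar>x j\<bar> \<le> \<epsilon> * lam ^ j"
    have "(i, r) \<in> I" unfolding I_def using h(1-4) by blast
    then have "(\<lambda>(i, r). K i r) (i, r) \<le> K'"
      unfolding K'_def by (rule member_le_sum) (use KI fI in blast)+
    then have "K i r * (\<epsilon> * lam ^ (2 * i - 2 + r)) \<le> K' * (\<epsilon> * lam ^ (2 * i - 2 + r))"
      using h by (intro mult_right_mono) auto
    from order_trans[OF K[OF h(1,4-9), unfolded mult.assoc] this]
    show "\<bar>coeff_jet i r x\<bar> \<le> K' * \<epsilon> * lam ^ (2 * i - 2 + r)"
      unfolding mult.assoc .
  qed
qed

text \<open>One formula for both parities: at i = k div 2 the correction is present exactly for odd
  k.\<close>

lemma energy_as_sum: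
  assumes "Ck_on k {0..T} \<gamma>" "0 < T" "t \<in> {0..T}" "2 \<le> k"
  shows "energy T \<gamma> lam u k t
    = (\<Sum>i\<in>{1..<Suc (k div 2)}. energy_block T \<gamma> lam u i t + (if 2 * i < k then energy_corr T \<gamma> lam u i t else 0))"
proof -
  define m where "m = k div 2"
  have m: "1 \<le> m" using assms(4) by (simp add: m_def)
  show ?thesis
  proof (cases "even k")
    case True
    then have k: "k = 2 * m" by (simp add: m_def)
    have "(\<Sum>i\<in>{1..<Suc m}. energy_block T \<gamma> lam u i t + (if 2 * i < k then energy_corr T \<gamma> lam u i t else 0))
      = (\<Sum>i\<in>{1..<m}. energy_block T \<gamma> lam u i t + (if 2 * i < k then energy_corr T \<gamma> lam u i t else 0)) + energy_block T \<gamma> lam u m t"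
      using m by (subst sum.atLeastLessThan_Suc) (auto simp: k)
    also have "(\<Sum>i\<in>{1..<m}. energy_block T \<gamma> lam u i t + (if 2 * i < k then energy_corr T \<gamma> lam u i t else 0))
      = (\<Sum>i\<in>{1..<m}. energy_block T \<gamma> lam u i t + energy_corr T \<gamma> lam u i t)"
      by (rule sum.cong) (auto simp: k)
    finally show ?thesis unfolding m_def[symmetric]
      using energy_as_blocks(1)[OF assms(1-3) m, of lam u] k by simp
  next
    case False
    then have k: "k = 2 * m + 1" by (simp add: m_def)
    have "(\<Sum>i\<in>{1..<Suc m}. energy_block T \<gamma> lam u i t + (if 2 * i < k then energy_corr T \<gamma> lam u i t else 0))
      = (\<Sum>i\<in>{1..<Suc m}. energy_block T \<gamma> lam u i t + energy_corr T \<gamma> lam u i t)"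
      by (rule sum.cong) (auto simp: k)
    then show ?thesis unfolding m_def[symmetric]
      using energy_as_blocks(2)[OF assms(1-3) m, of lam u] k by simp
  qed
qed

text \<open>The leading term is \<gamma> u'^2 + \<gamma>^(-1) \<lambda>^2 u^2, with weights \<gamma>
  in [1/\<nu>2, 1/\<nu>1] and 1/\<gamma> in [\<nu>1, \<nu>2].\<close>

lemma wave_form_bounds:
  fixes \<nu>1 \<nu>2 g x y lam :: real
  assumes "0 < \<nu>1" "0 < \<nu>2" "1 / \<nu>2 \<le> g" "g \<le> 1 / \<nu>1"
  shows "min (1 / \<nu>2) \<nu>1 * (y\<^sup>2 + lam\<^sup>2 * x\<^sup>2) \<le> g * (y\<^sup>2 + lam\<^sup>2 * (1 / g\<^sup>2) * x\<^sup>2)"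
    and "g * (y\<^sup>2 + lam\<^sup>2 * (1 / g\<^sup>2) * x\<^sup>2) \<le> max (1 / \<nu>1) \<nu>2 * (y\<^sup>2 + lam\<^sup>2 * x\<^sup>2)"
    and "y\<^sup>2 + lam\<^sup>2 * (1 / g\<^sup>2) * x\<^sup>2 \<le> (1 + \<nu>2\<^sup>2) * (y\<^sup>2 + lam\<^sup>2 * x\<^sup>2)"
    and "1 / g\<^sup>2 \<le> \<nu>2\<^sup>2"
proof -
  have g: "0 < g" using assms less_le_trans[of 0 "1 / \<nu>2" g] by simp
  have ig: "\<nu>1 \<le> 1 / g" "1 / g \<le> \<nu>2" using assms g by (auto simp: field_simps)
  have e: "g * (y\<^sup>2 + lam\<^sup>2 * (1 / g\<^sup>2) * x\<^sup>2) = g * y\<^sup>2 + 1 / g * (lam\<^sup>2 * x\<^sup>2)"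
    using g by (simp add: field_simps power2_eq_square)
  have nn: "0 \<le> y\<^sup>2" "0 \<le> lam\<^sup>2 * x\<^sup>2" by auto
  have "min (1 / \<nu>2) \<nu>1 * y\<^sup>2 \<le> g * y\<^sup>2" "min (1 / \<nu>2) \<nu>1 * (lam\<^sup>2 * x\<^sup>2) \<le> 1 / g * (lam\<^sup>2 * x\<^sup>2)"
    by (rule mult_right_mono[OF _ nn(1)], use assms in linarith, rule mult_right_mono[OF _ nn(2)], use ig in linarith)
  then show "min (1 / \<nu>2) \<nu>1 * (y\<^sup>2 + lam\<^sup>2 * x\<^sup>2) \<le> g * (y\<^sup>2 + lam\<^sup>2 * (1 / g\<^sup>2) * x\<^sup>2)"
    unfolding e unfolding distrib_left by linarith
  have "g * y\<^sup>2 \<le> max (1 / \<nu>1) \<nu>2 * y\<^sup>2" "1 / g * (lam\<^sup>2 * x\<^sup>2) \<le> max (1 / \<nu>1) \<nu>2 * (lam\<^sup>2 * x\<^sup>2)"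
    by (rule mult_right_mono[OF _ nn(1)], use assms in linarith, rule mult_right_mono[OF _ nn(2)], use ig in linarith)
  then show "g * (y\<^sup>2 + lam\<^sup>2 * (1 / g\<^sup>2) * x\<^sup>2) \<le> max (1 / \<nu>1) \<nu>2 * (y\<^sup>2 + lam\<^sup>2 * x\<^sup>2)"
    unfolding e unfolding distrib_left by linarith
  have "(1 / g)\<^sup>2 \<le> \<nu>2\<^sup>2" using ig g by (intro power_mono) auto
  then show ig2: "1 / g\<^sup>2 \<le> \<nu>2\<^sup>2" by (simp add: power_divide)
  have "1 / g\<^sup>2 * (lam\<^sup>2 * x\<^sup>2) \<le> \<nu>2\<^sup>2 * (lam\<^sup>2 * x\<^sup>2)" using ig2 nn by (intro mult_right_mono) auto
  moreover have "0 \<le> \<nu>2\<^sup>2 * y\<^sup>2" by simp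
  moreover have "lam\<^sup>2 * (1 / g\<^sup>2) * x\<^sup>2 = 1 / g\<^sup>2 * (lam\<^sup>2 * x\<^sup>2)" by simp
  ultimately show "y\<^sup>2 + lam\<^sup>2 * (1 / g\<^sup>2) * x\<^sup>2 \<le> (1 + \<nu>2\<^sup>2) * (y\<^sup>2 + lam\<^sup>2 * x\<^sup>2)"
    unfolding distrib_right distrib_left using nn by linarith
qed

text \<open>Factorization: c^2 - 1/g^2 = (c + 1/g) (c/g) (g - 1/c).\<close>

lemma square_difference_bound:
  fixes \<nu>2 g c :: real
  assumes "0 < \<nu>2" "1 / \<nu>2 \<le> g" "0 < c" "c \<le> \<nu>2"
  shows "\<bar>c\<^sup>2 - 1 / g\<^sup>2\<bar> \<le> 2 * \<nu>2 ^ 3 * \<bar>g - 1 / c\<bar>"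
proof -
  have g: "0 < g" using assms less_le_trans[of 0 "1 / \<nu>2" g] by simp
  have ig: "0 < 1 / g" "1 / g \<le> \<nu>2" using assms g by (auto simp: field_simps)
  have "c\<^sup>2 - 1 / g\<^sup>2 = (c + 1 / g) * (c * (1 / g)) * (g - 1 / c)"
    using g assms by (simp add: field_simps power2_eq_square)
  then have "\<bar>c\<^sup>2 - 1 / g\<^sup>2\<bar> = (c + 1 / g) * (c * (1 / g)) * \<bar>g - 1 / c\<bar>"
    using g assms by (simp add: abs_mult)
  also have "\<dots> \<le> (\<nu>2 + \<nu>2) * (\<nu>2 * \<nu>2) * \<bar>g - 1 / c\<bar>"
    using assms ig by (intro mult_right_mono mult_mono add_mono) auto
  also have "\<dots> = 2 * \<nu>2 ^ 3 * \<bar>g - 1 / c\<bar>" by (simp add: power3_eq_cube)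
  finally show ?thesis .
qed

section \<open>Comparison of the energies with \<open>energy0\<close> under the smallness
  assumption\<close>

context
  fixes T lam \<nu>1 \<nu>2 K \<epsilon> :: real and \<gamma> u v :: "real \<Rightarrow> real" and k :: nat and t :: real
  assumes T: "0 < T" and t: "t \<in> {0..T}" and lam: "0 < lam" and \<nu>: "0 < \<nu>1" "0 < \<nu>2" and K: "0 \<le> K"
    and \<epsilon>: "0 \<le> \<epsilon>" "\<epsilon> \<le> 1"
    and \<gamma>: "Ck_on k {0..T} \<gamma>" "1 / \<nu>2 \<le> \<gamma> t" "\<gamma> t \<le> 1 / \<nu>1"
    and v: "v = nth_deriv_on {0..T} 1 u"
    and small: "\<forall>j\<in>{1..k-1}. \<bar>nth_deriv_on {0..T} j \<gamma> t\<bar> \<le> \<epsilon> * lam ^ j"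
    and KB: "\<And>i r x lam \<epsilon>. 1 \<le> i \<Longrightarrow> i \<le> k div 2 \<Longrightarrow> r \<le> 2 \<Longrightarrow> 0 < 2 * i - 2 + r \<Longrightarrow> 0 < lam \<Longrightarrow> 0 \<le> \<epsilon> \<Longrightarrow> \<epsilon> \<le> 1 \<Longrightarrow>
      \<bar>x 0\<bar> \<le> 1 / \<nu>1 \<Longrightarrow> (\<forall>j\<in>{1..2 * i - 2 + r}. \<bar>x j\<bar> \<le> \<epsilon> * lam ^ j) \<Longrightarrow>
      \<bar>coeff_jet i r x\<bar> \<le> K * \<epsilon> * lam ^ (2 * i - 2 + r)"
begin

lemma energy0_facts:
  shows "lam\<^sup>2 * (u t)\<^sup>2 \<le> energy0 T lam u t" "lam * \<bar>u t * v t\<bar> \<le> energy0 T lam u t" "0 \<le> energy0 T lam u t"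
  using lam_abs_mult_le[OF lam, of "u t" "v t"] by (auto simp: energy0_def v)

lemma gamma_pos: "0 < \<gamma> t"
  using \<gamma>(2) \<nu> less_le_trans[of 0 "1 / \<nu>2" "\<gamma> t"] by simp

text \<open>The weight 2 * i - 2 + r matches the prefactor up to \<open>lam ^ r\<close>. It has to
  stay below k because smallness is assumed up to order k - 1 only.\<close>

lemma scaled_coeff_bound:
  assumes "1 \<le> i" "2 * i \<le> k" "r \<le> 2" "0 < 2 * i - 2 + r" "2 * i - 2 + r < k"
  shows "\<bar>1 / lam ^ (2 * i - 2) * coeff_jet i r (jet {0..T} \<gamma> t)\<bar> \<le> K * \<epsilon> * lam ^ r"
proof -
  have "\<bar>coeff_jet i r (jet {0..T} \<gamma> t)\<bar> \<le> K * \<epsilon> * lam ^ (2 * i - 2 + r)"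
    by (rule KB) (use assms lam \<epsilon> \<gamma> gamma_pos small in \<open>auto simp: jet_def\<close>)
  then show ?thesis using lam by (simp add: abs_mult power_add pos_divide_le_eq mult_ac)
qed

text \<open>For i = 1 the coefficient is \<gamma>, bounded but not small; hence the summand 1 /
  \<nu>1.\<close>

lemma scaled_coeff0_bound:
  assumes "1 \<le> i" "2 * i \<le> k"
  shows "\<bar>1 / lam ^ (2 * i - 2) * coeff_jet i 0 (jet {0..T} \<gamma> t)\<bar> \<le> K + 1 / \<nu>1"
proof (cases "i = 1")
  case True
  then show ?thesis using \<gamma> gamma_pos K by (simp add: coeff_jet_def jet_def)
next
  case False
  have "\<bar>1 / lam ^ (2 * i - 2) * coeff_jet i 0 (jet {0..T} \<gamma> t)\<bar> \<le> K * \<epsilon> * lam ^ 0"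
    by (rule scaled_coeff_bound) (use assms False in auto)
  also have "\<dots> \<le> K + 1 / \<nu>1" using K \<epsilon> \<nu> mult_left_mono[of \<epsilon> 1 K] by (simp add: add_increasing2)
  finally show ?thesis .
qed

text \<open>Apart from the leading term \<gamma> Q of the first block, every term has a coefficient
  of positive weight and so a factor \<epsilon>. Q contributes 1 + \<nu>2^2 and u u' contributes
  1.\<close>

lemma energy_block_bound:
  assumes "1 \<le> i" "2 * i \<le> k"
  shows "\<bar>energy_block T \<gamma> lam u i t - (if i = 1 then \<gamma> t * ((v t)\<^sup>2 + lam\<^sup>2 * (1 / (\<gamma> t)\<^sup>2) * (u t)\<^sup>2) else 0)\<bar>
     \<le> K * \<epsilon> * (2 + \<nu>2\<^sup>2) * energy0 T lam u t"
proof -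
  let ?Q = "(v t)\<^sup>2 + lam\<^sup>2 * (1 / (\<gamma> t)\<^sup>2) * (u t)\<^sup>2" and ?P = "1 / lam ^ (2 * i - 2)"
  let ?E = "energy0 T lam u t"
  have Q: "0 \<le> ?Q" "?Q \<le> (1 + \<nu>2\<^sup>2) * ?E"
    using wave_form_bounds(3)[OF \<nu> \<gamma>(2,3), of "v t" lam "u t"] by (auto simp: energy0_def v)
  have a1: "\<bar>?P * coeff_jet i 1 (jet {0..T} \<gamma> t)\<bar> \<le> K * \<epsilon> * lam ^ 1"
    by (rule scaled_coeff_bound) (use assms in auto)
  have "\<bar>(?P * coeff_jet i 1 (jet {0..T} \<gamma> t)) * (u t * v t)\<bar> \<le> (K * \<epsilon> * lam ^ 1) * \<bar>u t * v t\<bar>"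
    unfolding abs_mult[of "?P * coeff_jet i 1 (jet {0..T} \<gamma> t)"] by (rule mult_right_mono[OF a1]) simp
  also have "\<dots> = K * \<epsilon> * (lam * \<bar>u t * v t\<bar>)" by simp
  also have "\<dots> \<le> K * \<epsilon> * ?E" using K \<epsilon> by (intro mult_left_mono energy0_facts) auto
  finally have 1: "\<bar>(?P * coeff_jet i 1 (jet {0..T} \<gamma> t)) * (u t * v t)\<bar> \<le> K * \<epsilon> * ?E" .
  have 0: "\<bar>?P * coeff_jet i 0 (jet {0..T} \<gamma> t) * ?Q - (if i = 1 then \<gamma> t * ?Q else 0)\<bar> \<le> K * \<epsilon> * ((1 + \<nu>2\<^sup>2) * ?E)"
  proof (cases "i = 1")
    case True
    have "0 \<le> K * \<epsilon> * ((1 + \<nu>2\<^sup>2) * ?E)" using K \<epsilon> energy0_facts by simp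
    with True show ?thesis by (simp add: coeff_jet_def jet_def)
  next
    case False
    have a0: "\<bar>?P * coeff_jet i 0 (jet {0..T} \<gamma> t)\<bar> \<le> K * \<epsilon> * lam ^ 0"
      by (rule scaled_coeff_bound) (use assms False in auto)
    have "\<bar>(?P * coeff_jet i 0 (jet {0..T} \<gamma> t)) * ?Q\<bar> \<le> (K * \<epsilon> * lam ^ 0) * ((1 + \<nu>2\<^sup>2) * ?E)"
      unfolding abs_mult[of "?P * coeff_jet i 0 (jet {0..T} \<gamma> t)"]
      by (rule mult_mono[OF a0]) (use Q K \<epsilon> in auto)
    with False show ?thesis by simp
  qed
  have "energy_block T \<gamma> lam u i t - (if i = 1 then \<gamma> t * ?Q else 0)
      = (?P * coeff_jet i 0 (jet {0..T} \<gamma> t) * ?Q - (if i = 1 then \<gamma> t * ?Q else 0))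
        - (?P * coeff_jet i 1 (jet {0..T} \<gamma> t)) * (u t * v t)"
    unfolding energy_block_def v by (simp only: right_diff_distrib mult.assoc)
  also have "\<bar>\<dots>\<bar> \<le> K * \<epsilon> * ((1 + \<nu>2\<^sup>2) * ?E) + K * \<epsilon> * ?E" using 0 1 by linarith
  also have "\<dots> = K * \<epsilon> * (2 + \<nu>2\<^sup>2) * ?E" by (simp add: algebra_simps)
  finally show ?thesis .
qed

lemma energy_corr_bound:
  assumes "1 \<le> i" "2 * i < k"
  shows "\<bar>energy_corr T \<gamma> lam u i t\<bar> \<le> K * \<epsilon> * energy0 T lam u t"
proof -
  have a2: "\<bar>1 / lam ^ (2 * i - 2) * coeff_jet i 2 (jet {0..T} \<gamma> t)\<bar> \<le> K * \<epsilon> * lam ^ 2"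
    by (rule scaled_coeff_bound) (use assms in auto)
  have "\<bar>energy_corr T \<gamma> lam u i t\<bar>
      = 1/2 * (\<bar>1 / lam ^ (2 * i - 2) * coeff_jet i 2 (jet {0..T} \<gamma> t)\<bar> * (u t)\<^sup>2)"
    by (simp add: energy_corr_def abs_mult)
  also have "\<dots> \<le> 1 * (K * \<epsilon> * lam ^ 2 * (u t)\<^sup>2)"
    by (intro mult_mono mult_right_mono a2) auto
  also have "\<dots> \<le> K * \<epsilon> * energy0 T lam u t"
    using K \<epsilon> mult_left_mono[OF energy0_facts(1), of "K * \<epsilon>"] by (simp add: mult.assoc)
  finally show ?thesis .
qed

text \<open>Each of the k div 2 indices contributes 2 + \<nu>2^2 from its block and at most 1 from
  its correction.\<close>

lemma energy_close:
  assumes "2 \<le> k"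
  shows "\<bar>energy T \<gamma> lam u k t - \<gamma> t * ((v t)\<^sup>2 + lam\<^sup>2 * (1 / (\<gamma> t)\<^sup>2) * (u t)\<^sup>2)\<bar>
     \<le> real (k div 2) * (K * \<epsilon> * (3 + \<nu>2\<^sup>2)) * energy0 T lam u t"
proof -
  let ?R = "\<gamma> t * ((v t)\<^sup>2 + lam\<^sup>2 * (1 / (\<gamma> t)\<^sup>2) * (u t)\<^sup>2)" and ?I = "{1..<Suc (k div 2)}"
  let ?c = "\<lambda>i. if 2 * i < k then energy_corr T \<gamma> lam u i t else 0"
  have "(\<Sum>i\<in>?I. if i = 1 then ?R else 0) = ?R"
    by (subst sum.delta, simp) (use assms in \<open>simp add: div_greater_zero_iff\<close>)
  then have "energy T \<gamma> lam u k t - ?R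
      = (\<Sum>i\<in>?I. energy_block T \<gamma> lam u i t + ?c i) - (\<Sum>i\<in>?I. if i = 1 then ?R else 0)"
    by (rule arg_cong2[of _ _ _ _ "(-)", OF energy_as_sum[OF \<gamma>(1) T t assms] sym])
  also have "\<dots> = (\<Sum>i\<in>?I. (energy_block T \<gamma> lam u i t - (if i = 1 then ?R else 0)) + ?c i)"
    unfolding sum_subtractf[symmetric] by (rule sum.cong[OF refl]) simp
  finally have eq: "energy T \<gamma> lam u k t - ?R
      = (\<Sum>i\<in>?I. (energy_block T \<gamma> lam u i t - (if i = 1 then ?R else 0)) + ?c i)" .
  have "\<bar>energy T \<gamma> lam u k t - ?R\<bar> \<le> (\<Sum>i\<in>?I. K * \<epsilon> * (3 + \<nu>2\<^sup>2) * energy0 T lam u t)"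
    unfolding eq
  proof (rule order_trans[OF sum_abs sum_mono])
    fix i assume i: "i \<in> ?I"
    have b: "\<bar>energy_block T \<gamma> lam u i t - (if i = 1 then ?R else 0)\<bar> \<le> K * \<epsilon> * (2 + \<nu>2\<^sup>2) * energy0 T lam u t"
      by (rule energy_block_bound) (use i in auto)
    have c: "\<bar>?c i\<bar> \<le> K * \<epsilon> * energy0 T lam u t"
    proof (cases "2 * i < k")
      case True
      with energy_corr_bound[of i] i show ?thesis by simp
    next
      case False
      then show ?thesis using K \<epsilon>(1) energy0_facts(3) by simp
    qed
    have "K * \<epsilon> * (2 + \<nu>2\<^sup>2) * energy0 T lam u t + K * \<epsilon> * energy0 T lam u t
      = K * \<epsilon> * (3 + \<nu>2\<^sup>2) * energy0 T lam u t"
      by (simp add: algebra_simps)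
    with order_trans[OF abs_triangle_ineq add_mono[OF b c]]
    show "\<bar>(energy_block T \<gamma> lam u i t - (if i = 1 then ?R else 0)) + ?c i\<bar>
        \<le> K * \<epsilon> * (3 + \<nu>2\<^sup>2) * energy0 T lam u t"
      by (simp only:)
  qed
  also have "\<dots> = real (k div 2) * (K * \<epsilon> * (3 + \<nu>2\<^sup>2)) * energy0 T lam u t"
    by (simp del: sum.op_ivl_Suc)
  finally show ?thesis .
qed

text \<open>The powers of \<lambda> are distributed so that one is left over: \<lambda>^2 u^2 goes
  with the scaled a_i', which is at most K \<lambda>, and \<lambda> u u' with \<lambda> times the
  scaled a_i. What remains, \<lambda> |\<gamma> - 1/c|, is the second integrand of
  \<open>error_term\<close>.\<close>

lemma energy_perturbation_bound:
  assumes "1 \<le> i" "2 * i \<le> k" "0 < c t" "c t \<le> \<nu>2"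
  shows "\<bar>energy_perturbation T \<gamma> lam c u i t\<bar>
    \<le> 2 * \<nu>2 ^ 3 * (3 * K + 2 / \<nu>1) * (lam * \<bar>\<gamma> t - 1 / c t\<bar>) * energy0 T lam u t"
proof -
  let ?P = "1 / lam ^ (2 * i - 2)" and ?\<delta> = "(c t)\<^sup>2 - 1 / (\<gamma> t)\<^sup>2" and ?E = "energy0 T lam u t"
  let ?a0 = "?P * coeff_jet i 0 (jet {0..T} \<gamma> t)" and ?a1 = "?P * coeff_jet i 1 (jet {0..T} \<gamma> t)"
  have "\<bar>?a1\<bar> \<le> K * \<epsilon> * lam ^ 1" by (rule scaled_coeff_bound) (use assms in auto)
  also have "\<dots> \<le> K * lam" using lam mult_right_mono[OF mult_left_mono[OF \<epsilon>(2) K], of lam] by simp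
  finally have a1: "\<bar>?a1\<bar> \<le> K * lam" .
  have "\<bar>?a1 * (lam\<^sup>2 * (u t)\<^sup>2)\<bar> \<le> (K * lam) * ?E"
    unfolding abs_mult[of ?a1] by (rule mult_mono[OF a1]) (use energy0_facts K lam in auto)
  moreover have "\<bar>2 * lam * ?a0 * (lam * (u t * v t))\<bar> \<le> 2 * lam * (K + 1 / \<nu>1) * ?E"
    unfolding abs_mult[of "2 * lam * ?a0"] abs_mult[of "2 * lam" ?a0]
    by (intro mult_mono scaled_coeff0_bound assms)
      (use energy0_facts K lam \<nu> in \<open>auto simp: abs_mult\<close>)
  ultimately have "\<bar>?a1 * (lam\<^sup>2 * (u t)\<^sup>2) - 2 * lam * ?a0 * (lam * (u t * v t))\<bar>
      \<le> (K * lam) * ?E + 2 * lam * (K + 1 / \<nu>1) * ?E" by linarith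
  also have "\<dots> = (3 * K + 2 / \<nu>1) * (lam * ?E)" by (simp add: algebra_simps)
  finally have b: "\<bar>?a1 * (lam\<^sup>2 * (u t)\<^sup>2) - 2 * lam * ?a0 * (lam * (u t * v t))\<bar> \<le> (3 * K + 2 / \<nu>1) * (lam * ?E)" .
  have "energy_perturbation T \<gamma> lam c u i t
    = ?\<delta> * (?a1 * (lam\<^sup>2 * (u t)\<^sup>2) - 2 * lam * ?a0 * (lam * (u t * v t)))"
  proof -
    have "P * (lam\<^sup>2 * d * (A1 * U - 2 * A0 * W)) = d * (P * A1 * (lam\<^sup>2 * U) - 2 * lam * (P * A0) * (lam * W))"
      for P d A1 U A0 W :: real
      by (simp add: power2_eq_square algebra_simps)
    then show ?thesis unfolding energy_perturbation_def v .
  qed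
  also have "\<bar>\<dots>\<bar> \<le> (2 * \<nu>2 ^ 3 * \<bar>\<gamma> t - 1 / c t\<bar>) * ((3 * K + 2 / \<nu>1) * (lam * ?E))"
    unfolding abs_mult[of ?\<delta>]
    by (rule mult_mono[OF square_difference_bound b]) (use \<nu> \<gamma> assms in auto)
  finally show ?thesis by (simp add: mult_ac)
qed

lemma energy_derivative_bound:
  assumes "2 \<le> k" and c: "0 < c t" "c t \<le> \<nu>2" and pos: "\<And>s. s \<in> {0..T} \<Longrightarrow> 0 < \<gamma> s"
    and du: "(u has_real_derivative v t) (at t within {0..T})"
    and dv: "(v has_real_derivative - (lam\<^sup>2 * (c t)\<^sup>2 * u t)) (at t within {0..T})"
  shows "\<exists>D. (energy T \<gamma> lam u k has_real_derivative D) (at t within {0..T}) \<and>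
     \<bar>D\<bar> \<le> (1 / lam ^ (k - 1) * \<bar>coeff_jet (k div 2) (2 + k mod 2) (jet {0..T} \<gamma> t)\<bar>
        + real (k div 2) * (2 * \<nu>2 ^ 3 * (3 * K + 2 / \<nu>1)) * lam * \<bar>\<gamma> t - 1 / c t\<bar>) * energy0 T lam u t"
proof -
  let ?I = "{1..<Suc (k div 2)}"
  obtain D where D: "(energy T \<gamma> lam u k has_real_derivative
      (\<Sum>i\<in>?I. energy_perturbation T \<gamma> lam c u i t) + D) (at t within {0..T})"
     "\<bar>D\<bar> \<le> 1 / lam ^ (k - 1) * \<bar>coeff_jet (k div 2) (2 + k mod 2) (jet {0..T} \<gamma> t)\<bar> * energy0 T lam u t"
    using energy_has_derivative[where c = c, OF T t lam \<gamma>(1) pos v du dv assms(1)] by (auto simp: energy0_def v)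
  have "\<bar>\<Sum>i\<in>?I. energy_perturbation T \<gamma> lam c u i t\<bar>
      \<le> (\<Sum>i\<in>?I. 2 * \<nu>2 ^ 3 * (3 * K + 2 / \<nu>1) * (lam * \<bar>\<gamma> t - 1 / c t\<bar>) * energy0 T lam u t)"
    by (rule order_trans[OF sum_abs sum_mono], rule energy_perturbation_bound) (use c in auto)
  also have "\<dots> = real (k div 2) * (2 * \<nu>2 ^ 3 * (3 * K + 2 / \<nu>1)) * lam * \<bar>\<gamma> t - 1 / c t\<bar> * energy0 T lam u t"
    by (simp del: sum.op_ivl_Suc)
  finally have "\<bar>(\<Sum>i\<in>?I. energy_perturbation T \<gamma> lam c u i t) + D\<bar>
      \<le> (1 / lam ^ (k - 1) * \<bar>coeff_jet (k div 2) (2 + k mod 2) (jet {0..T} \<gamma> t)\<bar>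
        + real (k div 2) * (2 * \<nu>2 ^ 3 * (3 * K + 2 / \<nu>1)) * lam * \<bar>\<gamma> t - 1 / c t\<bar>) * energy0 T lam u t"
    using D(2) unfolding distrib_right by linarith
  with D(1) show ?thesis by blast
qed

end

section \<open>Growth of the energies\<close>

text \<open>On a compact interval with v continuous this is an algebra containing v and all C^1
  functions; the boundedness clause closes it under products. The Lipschitz clause is the form in
  which Gronwall's lemma exploits the absolute continuity of v = u'.\<close>

definition dominated_on :: "real set \<Rightarrow> (real \<Rightarrow> real) \<Rightarrow> (real \<Rightarrow> real) \<Rightarrow> bool" where
  "dominated_on S v f \<longleftrightarrow> (\<exists>B\<ge>0. \<exists>L\<ge>0. \<forall>a\<in>S. \<bar>f a\<bar> \<le> B \<and>
     (\<forall>b\<in>S. \<bar>f b - f a\<bar> \<le> L * (\<bar>b - a\<bar> + \<bar>v b - v a\<bar>)))"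

lemma dominated_on_const: "dominated_on S v (\<lambda>t. c)"
  unfolding dominated_on_def by (intro exI[of _ "\<bar>c\<bar>"] exI[of _ 0] conjI) auto

lemma dominated_on_add:
  assumes "dominated_on S v f" "dominated_on S v g"
  shows "dominated_on S v (\<lambda>t. f t + g t)"
proof -
  from assms(1) obtain B L where f: "0 \<le> B" "0 \<le> L" "\<And>a. a \<in> S \<Longrightarrow> \<bar>f a\<bar> \<le> B"
     "\<And>a b. a \<in> S \<Longrightarrow> b \<in> S \<Longrightarrow> \<bar>f b - f a\<bar> \<le> L * (\<bar>b - a\<bar> + \<bar>v b - v a\<bar>)"
    unfolding dominated_on_def by blast
  from assms(2) obtain B' L' where g: "0 \<le> B'" "0 \<le> L'" "\<And>a. a \<in> S \<Longrightarrow> \<bar>g a\<bar> \<le> B'"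
     "\<And>a b. a \<in> S \<Longrightarrow> b \<in> S \<Longrightarrow> \<bar>g b - g a\<bar> \<le> L' * (\<bar>b - a\<bar> + \<bar>v b - v a\<bar>)"
    unfolding dominated_on_def by blast
  show ?thesis
    unfolding dominated_on_def
  proof (rule exI[of _ "B + B'"], intro conjI exI[of _ "L + L'"] ballI)
    fix a assume a: "a \<in> S"
    show "\<bar>f a + g a\<bar> \<le> B + B'" using f(3)[OF a] g(3)[OF a] by linarith
    fix b assume b: "b \<in> S"
    show "\<bar>f b + g b - (f a + g a)\<bar> \<le> (L + L') * (\<bar>b - a\<bar> + \<bar>v b - v a\<bar>)"
      using f(4)[OF a b] g(4)[OF a b] unfolding distrib_right[of L L'] by linarith
  qed (use f(1,2) g(1,2) in simp_all)
qed

lemma dominated_on_mult: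
  assumes "dominated_on S v f" "dominated_on S v g"
  shows "dominated_on S v (\<lambda>t. f t * g t)"
proof -
  from assms(1) obtain B L where f: "0 \<le> B" "0 \<le> L" "\<And>a. a \<in> S \<Longrightarrow> \<bar>f a\<bar> \<le> B"
     "\<And>a b. a \<in> S \<Longrightarrow> b \<in> S \<Longrightarrow> \<bar>f b - f a\<bar> \<le> L * (\<bar>b - a\<bar> + \<bar>v b - v a\<bar>)"
    unfolding dominated_on_def by blast
  from assms(2) obtain B' L' where g: "0 \<le> B'" "0 \<le> L'" "\<And>a. a \<in> S \<Longrightarrow> \<bar>g a\<bar> \<le> B'"
     "\<And>a b. a \<in> S \<Longrightarrow> b \<in> S \<Longrightarrow> \<bar>g b - g a\<bar> \<le> L' * (\<bar>b - a\<bar> + \<bar>v b - v a\<bar>)"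
    unfolding dominated_on_def by blast
  show ?thesis
    unfolding dominated_on_def
  proof (rule exI[of _ "B * B'"], intro conjI exI[of _ "L * B' + B * L'"] ballI)
    fix a assume a: "a \<in> S"
    show "\<bar>f a * g a\<bar> \<le> B * B'"
      unfolding abs_mult using f(3)[OF a] g(3)[OF a] f(1) by (intro mult_mono) auto
    fix b assume b: "b \<in> S"
    let ?d = "\<bar>b - a\<bar> + \<bar>v b - v a\<bar>"
    have "f b * g b - f a * g a = (f b - f a) * g b + f a * (g b - g a)" by (simp add: algebra_simps)
    then have "\<bar>f b * g b - f a * g a\<bar> \<le> \<bar>f b - f a\<bar> * \<bar>g b\<bar> + \<bar>f a\<bar> * \<bar>g b - g a\<bar>"
      by (simp only: abs_mult[symmetric] abs_triangle_ineq)
    also have "\<dots> \<le> (L * ?d) * B' + B * (L' * ?d)"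
      using f g a b by (intro add_mono mult_mono) auto
    finally show "\<bar>f b * g b - f a * g a\<bar> \<le> (L * B' + B * L') * ?d"
      by (simp add: algebra_simps)
  qed (use f(1,2) g(1,2) in simp_all)
qed

lemma dominated_on_diff:
  "dominated_on S v f \<Longrightarrow> dominated_on S v g \<Longrightarrow> dominated_on S v (\<lambda>t. f t - g t)"
  using dominated_on_add[of S v f "\<lambda>t. (-1) * g t"] dominated_on_mult[OF dominated_on_const[of S v "-1"], of g]
  by simp

lemma dominated_on_sum:
  assumes "\<And>i. i \<in> I \<Longrightarrow> dominated_on S v (f i)"
  shows "dominated_on S v (\<lambda>t. \<Sum>i\<in>I. f i t)"
  using assms
proof (induction I rule: infinite_finite_induct)
  case (insert i I)
  then show ?case using dominated_on_add[of S v "f i" "\<lambda>t. \<Sum>i\<in>I. f i t"] by simp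
qed (simp_all add: dominated_on_const)

lemma dominated_on_cong:
  "dominated_on S v f \<Longrightarrow> (\<And>t. t \<in> S \<Longrightarrow> g t = f t) \<Longrightarrow> dominated_on S v g"
  unfolding dominated_on_def by simp

lemma continuous_on_Icc_bounded:
  fixes f :: "real \<Rightarrow> real"
  assumes "continuous_on {a..b} f"
  shows "\<exists>B\<ge>0. \<forall>t\<in>{a..b}. \<bar>f t\<bar> \<le> B"
proof -
  have "bounded (f ` {a..b})"
    using compact_continuous_image[OF assms] compact_imp_bounded by blast
  then obtain B where "\<forall>t\<in>{a..b}. norm (f t) \<le> B" unfolding bounded_iff by blast
  then show ?thesis by (intro exI[of _ "max B 0"]) (auto simp: le_max_iff_disj)
qed

lemma dominated_on_self:
  assumes "continuous_on {a..b} v"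
  shows "dominated_on {a..b} v v"
proof -
  obtain B where "0 \<le> B" "\<And>t. t \<in> {a..b} \<Longrightarrow> \<bar>v t\<bar> \<le> B" using continuous_on_Icc_bounded[OF assms] by blast
  then show ?thesis unfolding dominated_on_def by (intro exI[of _ B] exI[of _ 1] conjI) auto
qed

lemma dominated_on_C1:
  assumes d: "\<And>t. t \<in> {a..b} \<Longrightarrow> (f has_real_derivative f' t) (at t within {a..b})"
    and c: "continuous_on {a..b} f'"
  shows "dominated_on {a..b} v f"
proof -
  have cf: "continuous_on {a..b} f"
    unfolding continuous_on_eq_continuous_within using d DERIV_continuous by blast
  obtain B where B: "0 \<le> B" "\<And>t. t \<in> {a..b} \<Longrightarrow> \<bar>f t\<bar> \<le> B" using continuous_on_Icc_bounded[OF cf] by blast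
  obtain L where L: "0 \<le> L" "\<And>t. t \<in> {a..b} \<Longrightarrow> \<bar>f' t\<bar> \<le> L" using continuous_on_Icc_bounded[OF c] by blast
  have "\<bar>f y - f x\<bar> \<le> L * (\<bar>y - x\<bar> + \<bar>v y - v x\<bar>)" if x: "x \<in> {a..b}" and y: "y \<in> {a..b}" for x y
  proof -
    have "norm (f y - f x) \<le> L * norm (y - x)"
      by (rule field_differentiable_bound[of "{a..b}" f f']) (use d L x y in auto)
    also have "\<dots> \<le> L * (\<bar>y - x\<bar> + \<bar>v y - v x\<bar>)" using L by (intro mult_left_mono) auto
    finally show ?thesis by simp
  qed
  with B L(1) show ?thesis unfolding dominated_on_def by blast
qed

text \<open>The energy of index k involves derivatives of \<gamma> of order at most k - 1, so its
  coefficients are C^1 in time; it is built from them, u and v by sums and products.\<close>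

lemma dominated_on_energy:
  assumes T: "0 < T" and \<gamma>: "Ck_on k {0..T} \<gamma>" "\<And>s. s \<in> {0..T} \<Longrightarrow> 0 < \<gamma> s" and "1 \<le> k"
    and u: "Ck_on 1 {0..T} u" and v: "v = nth_deriv_on {0..T} 1 u"
  shows "dominated_on {0..T} v (energy T \<gamma> lam u k)"
proof -
  note rules = dominated_on_add dominated_on_diff dominated_on_mult dominated_on_const
  have cv: "continuous_on {0..T} v" using continuous_on_jet[OF u, of 1] by (simp add: jet_def v)
  have dv: "dominated_on {0..T} v v" by (rule dominated_on_self[OF cv])
  have du: "dominated_on {0..T} v u"
  proof (rule dominated_on_C1[of _ _ _ v, OF _ cv])
    fix t assume "t \<in> {0..T}"
    then show "(u has_real_derivative v t) (at t within {0..T})"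
      using nth_deriv_on_has_derivative[OF u, of 0 t] by (simp add: jet_def v)
  qed
  have dg1: "(\<gamma> has_real_derivative jet {0..T} \<gamma> t 1) (at t within {0..T})" if "t \<in> {0..T}" for t
    using nth_deriv_on_has_derivative[OF \<gamma>(1), of 0 t] assms that by (simp add: jet_def)
  have cg: "continuous_on {0..T} (\<lambda>t. jet {0..T} \<gamma> t 1)" "continuous_on {0..T} \<gamma>"
    using continuous_on_jet[OF \<gamma>(1), of 1] continuous_on_jet[OF \<gamma>(1), of 0] assms by (auto simp: jet_def)
  have dg: "dominated_on {0..T} v \<gamma>" by (rule dominated_on_C1[OF dg1 cg(1)])
  have dgi: "dominated_on {0..T} v (\<lambda>t. 1 / (\<gamma> t)\<^sup>2)"
  proof (rule dominated_on_C1[of _ _ _ "\<lambda>t. - 2 * jet {0..T} \<gamma> t 1 / (\<gamma> t) ^ 3"])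
    fix t assume t: "t \<in> {0..T}"
    have nz: "\<gamma> t \<noteq> 0" using \<gamma>(2)[OF t] by simp
    show "((\<lambda>t. 1 / (\<gamma> t)\<^sup>2) has_real_derivative - 2 * jet {0..T} \<gamma> t 1 / (\<gamma> t) ^ 3) (at t within {0..T})"
      by (rule derivative_eq_intros dg1[OF t] refl | simp add: nz)+
        (simp add: nz field_simps power2_eq_square power3_eq_cube power4_eq_xxxx)
  next
    show "continuous_on {0..T} (\<lambda>t. - 2 * jet {0..T} \<gamma> t 1 / (\<gamma> t) ^ 3)"
      by (intro continuous_intros cg) (use \<gamma>(2) in force)
  qed
  have dQ: "dominated_on {0..T} v (\<lambda>t. (v t)\<^sup>2 + lam\<^sup>2 * (1 / (\<gamma> t)\<^sup>2) * (u t)\<^sup>2)"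
    unfolding power2_eq_square[of "v _"] power2_eq_square[of "u _"] by (intro rules dv du dgi)
  show ?thesis
  proof (cases "k = 1")
    case True
    have "dominated_on {0..T} v (\<lambda>t. \<gamma> t * ((v t)\<^sup>2 + lam\<^sup>2 * (1 / (\<gamma> t)\<^sup>2) * (u t)\<^sup>2))"
      by (intro rules dg dQ)
    then show ?thesis
      by (rule dominated_on_cong) (simp add: True coeff_of_def v)
  next
    case False
    then have k2: "2 \<le> k" using assms by simp
    have A: "dominated_on {0..T} v (\<lambda>t. coeff_jet i r (jet {0..T} \<gamma> t))"
      if "1 \<le> i" "2 * i - 2 + r < k" for i r
    proof (rule dominated_on_C1)
      fix t assume "t \<in> {0..T}"
      then show "((\<lambda>t. coeff_jet i r (jet {0..T} \<gamma> t)) has_real_derivative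
          coeff_jet i (Suc r) (jet {0..T} \<gamma> t)) (at t within {0..T})"
        using coeff_jet_has_derivative[OF that(1) \<gamma>(1) that(2)] by simp
    next
      show "continuous_on {0..T} (\<lambda>t. coeff_jet i (Suc r) (jet {0..T} \<gamma> t))"
        by (rule continuous_on_along_jet[OF diff_hom_coeff_jet[OF that(1)] \<gamma>(1)]) (use that in simp)
    qed
    have "dominated_on {0..T} v (\<lambda>t. \<Sum>i\<in>{1..<Suc (k div 2)}.
        energy_block T \<gamma> lam u i t + (if 2 * i < k then energy_corr T \<gamma> lam u i t else 0))"
    proof (intro dominated_on_sum dominated_on_add)
      fix i assume i: "i \<in> {1..<Suc (k div 2)}"
      then have i': "1 \<le> i" "2 * i \<le> k" by auto
      show "dominated_on {0..T} v (\<lambda>t. energy_block T \<gamma> lam u i t)"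
        unfolding energy_block_def v[symmetric]
        by (intro dQ rules A du dv) (use i' in auto)
      show "dominated_on {0..T} v (\<lambda>t. if 2 * i < k then energy_corr T \<gamma> lam u i t else 0)"
      proof (cases "2 * i < k")
        case True
        have "dominated_on {0..T} v (\<lambda>t. energy_corr T \<gamma> lam u i t)"
          unfolding energy_corr_def power2_eq_square[of "u _"]
          by (intro rules A du) (use i' True in auto)
        with True show ?thesis by simp
      qed (simp add: dominated_on_const)
    qed
    then show ?thesis by (rule dominated_on_cong) (rule energy_as_sum[OF \<gamma>(1) T _ k2])
  qed
qed

text \<open>The Lebesgue integral of a non-integrable function defaults to 0, in which case
  \<open>error_term\<close> would control nothing. Measurability and the two-sided bounds exclude
  this.\<close>

lemma speed_error_integrable:
  fixes T \<nu>1 \<nu>2 :: real and c \<gamma> :: "real \<Rightarrow> real"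
  assumes c: "c \<in> borel_measurable (lebesgue_on {0<..<T})"
    and ae: "AE t\<in>{0<..<T} in lebesgue. \<nu>1 \<le> c t \<and> c t \<le> \<nu>2" and "0 < \<nu>1"
    and \<gamma>: "continuous_on {0..T} \<gamma>" "\<forall>t\<in>{0..T}. 1 / \<nu>2 \<le> \<gamma> t \<and> \<gamma> t \<le> 1 / \<nu>1"
  shows "set_integrable lebesgue {0<..<T} (\<lambda>t. \<bar>\<gamma> t - 1 / c t\<bar>)"
proof -
  obtain G where G: "\<And>t. t \<in> {0..T} \<Longrightarrow> \<bar>\<gamma> t\<bar> \<le> G" using continuous_on_Icc_bounded[OF \<gamma>(1)] by blast
  have S: "{0<..<T} \<in> sets lebesgue" by simp
  have "continuous_on {0<..<T} \<gamma>" by (rule continuous_on_subset[OF \<gamma>(1)]) auto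
  then have m\<gamma>: "\<gamma> \<in> borel_measurable (lebesgue_on {0<..<T})"
    by (rule continuous_imp_measurable_on_sets_lebesgue[OF _ S])
  have m: "(\<lambda>t. \<bar>\<gamma> t - 1 / c t\<bar>) \<in> borel_measurable (lebesgue_on {0<..<T})"
    using m\<gamma> c by measurable
  have fin: "finite_measure (lebesgue_on {0<..<T})"
    by (intro finite_measure_lebesgue_on bounded_set_imp_lmeasurable) auto
  have "AE t in lebesgue_on {0<..<T}. norm \<bar>\<gamma> t - 1 / c t\<bar> \<le> G + 1 / \<nu>1"
  proof (subst AE_restrict_space_iff)
    show "{0<..<T} \<inter> space lebesgue \<in> sets lebesgue" by simp
    show "AE t in lebesgue. t \<in> {0<..<T} \<longrightarrow> norm \<bar>\<gamma> t - 1 / c t\<bar> \<le> G + 1 / \<nu>1"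
      using ae
    proof eventually_elim
      case (elim t)
      show ?case
      proof
        assume t: "t \<in> {0<..<T}"
        then have "\<nu>1 \<le> c t" using elim by blast
        then have "0 \<le> 1 / c t" "1 / c t \<le> 1 / \<nu>1" using \<open>0 < \<nu>1\<close> by (auto simp: frac_le)
        moreover have "\<bar>\<gamma> t\<bar> \<le> G" using G t by simp
        ultimately show "norm \<bar>\<gamma> t - 1 / c t\<bar> \<le> G + 1 / \<nu>1"
          unfolding real_norm_def by linarith
      qed
    qed
  qed
  then have "integrable (lebesgue_on {0<..<T}) (\<lambda>t. \<bar>\<gamma> t - 1 / c t\<bar>)"
    using finite_measure.integrable_const_bound[OF fin _ m] by blast
  then show ?thesis using integrable_restrict_space[of "{0<..<T}" lebesgue "\<lambda>t. \<bar>\<gamma> t - 1 / c t\<bar>"]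
    by (simp add: set_integrable_def)
qed

text \<open>Gronwall's lemma with rate (p |W| + q |\<gamma> - 1/c|) / A: the derivative is bounded
  in terms of \<open>energy0\<close>, and the lower comparison replaces \<open>energy0\<close> by e
  / A. W is left general so that k = 1 and k \<ge> 2 share this step.\<close>

lemma energy_growth_bound:
  assumes T: "0 < T" and "0 < A" "0 \<le> p" "0 \<le> q" "0 < \<nu>1"
    and c: "c \<in> borel_measurable (lebesgue_on {0<..<T})"
      "AE t\<in>{0<..<T} in lebesgue. \<nu>1 \<le> c t \<and> c t \<le> \<nu>2"
    and \<gamma>: "continuous_on {0..T} \<gamma>" "\<forall>t\<in>{0..T}. 1 / \<nu>2 \<le> \<gamma> t \<and> \<gamma> t \<le> 1 / \<nu>1"
    and W: "continuous_on {0..T} W"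
    and u: "is_solution T c lam u" and v: "v = nth_deriv_on {0..T} 1 u"
    and dom: "dominated_on {0..T} v e"
    and low: "\<And>t. t \<in> {0..T} \<Longrightarrow> A * energy0 T lam u t \<le> e t"
    and der: "\<And>t. t \<in> {0<..<T} \<Longrightarrow> \<nu>1 \<le> c t \<Longrightarrow> c t \<le> \<nu>2 \<Longrightarrow>
       (u has_real_derivative v t) (at t within {0..T}) \<Longrightarrow>
       (v has_real_derivative - (lam\<^sup>2 * (c t)\<^sup>2 * u t)) (at t within {0..T}) \<Longrightarrow>
       \<exists>D. (e has_real_derivative D) (at t within {0..T}) \<and>
         \<bar>D\<bar> \<le> (p * \<bar>W t\<bar> + q * \<bar>\<gamma> t - 1 / c t\<bar>) * energy0 T lam u t"
    and t: "t \<in> {0..T}"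
  defines "J \<equiv> (p * integral {0..T} (\<lambda>t. \<bar>W t\<bar>) + q * (LINT t:{0<..<T}|lebesgue. \<bar>\<gamma> t - 1 / c t\<bar>)) / A"
  shows "e 0 * exp (- J) \<le> e t" "e t \<le> e 0 * exp J"
proof -
  \<comment> \<open>c is controlled only inside the open interval; extension by 0 gives a rate on
    all of {0..T}.\<close>
  define \<delta> where "\<delta> t = (if t \<in> {0<..<T} then \<bar>\<gamma> t - 1 / c t\<bar> else 0)" for t
  define \<phi> where "\<phi> t = (p * \<bar>W t\<bar> + q * \<delta> t) / A" for t
  have si: "set_integrable lebesgue {0<..<T} (\<lambda>t. \<bar>\<gamma> t - 1 / c t\<bar>)"
    by (rule speed_error_integrable[OF c \<open>0 < \<nu>1\<close> \<gamma>])
  have "((\<lambda>t. \<bar>\<gamma> t - 1 / c t\<bar>) has_integral (LINT t:{0<..<T}|lebesgue. \<bar>\<gamma> t - 1 / c t\<bar>)) {0<..<T}"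
    using set_lebesgue_integral_eq_integral[OF si] by (simp add: has_integral_integrable_integral)
  then have \<delta>: "(\<delta> has_integral (LINT t:{0<..<T}|lebesgue. \<bar>\<gamma> t - 1 / c t\<bar>)) {0..T}"
    unfolding \<delta>_def by (subst has_integral_restrict) auto
  have hW: "((\<lambda>t. \<bar>W t\<bar>) has_integral integral {0..T} (\<lambda>t. \<bar>W t\<bar>)) {0..T}"
    by (intro integrable_integral integrable_continuous_real continuous_intros W)
  have "(\<phi> has_integral J) {0..T}"
    unfolding \<phi>_def J_def
    by (intro has_integral_divide has_integral_add has_integral_mult_right hW \<delta>)
  then have \<phi>: "\<phi> integrable_on {0..T}" and J: "integral {0..T} \<phi> = J"
    by (auto simp: integrable_on_def integral_unique)
  have \<phi>0: "0 \<le> \<phi> t" for t using assms(2-4) by (simp add: \<phi>_def \<delta>_def)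
  have "AE t in lebesgue. t \<in> {0<..<T} \<longrightarrow> (\<nu>1 \<le> c t \<and> c t \<le> \<nu>2) \<and>
        (\<exists>w. (v has_real_derivative w) (at t) \<and> w + lam\<^sup>2 * (c t)\<^sup>2 * u t = 0)"
    using c(2) u[unfolded is_solution_def v[symmetric], THEN conjunct2, THEN conjunct2]
    by eventually_elim blast
  then obtain N where N: "N \<in> null_sets lebesgue" "\<And>t. t \<notin> N \<Longrightarrow> t \<in> {0<..<T} \<Longrightarrow> (\<nu>1 \<le> c t \<and> c t \<le> \<nu>2) \<and>
        (\<exists>w. (v has_real_derivative w) (at t) \<and> w + lam\<^sup>2 * (c t)\<^sup>2 * u t = 0)"
    by (elim AE_E3) auto
  \<comment> \<open>The endpoints join the null set, as the equation concerns interior times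
    only.\<close>
  have neg: "negligible (N \<union> {0, T})"
    using N(1) by (simp add: negligible_iff_null_sets[symmetric])
  have ac: "abs_cont_on {0..T} v" using u by (simp add: is_solution_def v)
  obtain L where L: "0 \<le> L" "\<And>a b. a \<in> {0..T} \<Longrightarrow> b \<in> {0..T} \<Longrightarrow> \<bar>e b - e a\<bar> \<le> L * (\<bar>b - a\<bar> + \<bar>v b - v a\<bar>)"
    using dom unfolding dominated_on_def by blast
  have e0: "0 \<le> e t" if "t \<in> {0..T}" for t
    using low[OF that] \<open>0 < A\<close> by (auto simp: energy0_def intro: order_trans[rotated])
  have d: "\<exists>D. (e has_real_derivative D) (at t within {0..T}) \<and> \<bar>D\<bar> \<le> \<phi> t * e t"
    if t: "t \<in> {0..T} - (N \<union> {0, T})" for t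
  proof -
    have t': "t \<in> {0<..<T}" "t \<notin> N" using t by auto
    have du: "(u has_real_derivative v t) (at t within {0..T})"
      using nth_deriv_on_has_derivative[of 1 "{0..T}" u 0 t] u t by (simp add: is_solution_def jet_def v)
    obtain w where w: "(v has_real_derivative w) (at t)" "w + lam\<^sup>2 * (c t)\<^sup>2 * u t = 0"
      and ct: "\<nu>1 \<le> c t" "c t \<le> \<nu>2" using N(2)[OF t'(2,1)] by blast
    have "w = - (lam\<^sup>2 * (c t)\<^sup>2 * u t)" using w(2) by simp
    then have dv: "(v has_real_derivative - (lam\<^sup>2 * (c t)\<^sup>2 * u t)) (at t within {0..T})"
      using has_field_derivative_at_within[OF w(1)] by simp
    obtain D where D: "(e has_real_derivative D) (at t within {0..T})"
        "\<bar>D\<bar> \<le> (p * \<bar>W t\<bar> + q * \<bar>\<gamma> t - 1 / c t\<bar>) * energy0 T lam u t"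
      using der[OF t'(1) ct du dv] by blast
    have "energy0 T lam u t \<le> e t / A" using low[of t] t \<open>0 < A\<close> by (simp add: pos_le_divide_eq mult.commute)
    then have "(p * \<bar>W t\<bar> + q * \<bar>\<gamma> t - 1 / c t\<bar>) * energy0 T lam u t \<le> (p * \<bar>W t\<bar> + q * \<bar>\<gamma> t - 1 / c t\<bar>) * (e t / A)"
      using assms(3,4) by (intro mult_left_mono) auto
    also have "\<dots> = \<phi> t * e t" using t'(1) by (simp add: \<phi>_def \<delta>_def)
    finally show ?thesis using D by (intro exI[of _ D]) auto
  qed
  from gronwall_abs_cont[OF ac L neg d \<phi> \<phi>0 e0 t]
  show "e 0 * exp (- J) \<le> e t" "e t \<le> e 0 * exp J" by (simp_all add: J)
qed

text \<open>Index 1 lacks the term - a_1' u u', so \<gamma>' multiplies u'^2 - \<lambda>^2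
  \<gamma>^(-2) u^2 without cancellation. Its weight is 1 = k, hence it already has the form of the
  surviving term for larger k.\<close>

lemma energy_one_derivative_bound:
  assumes T: "0 < T" "t \<in> {0..T}" and lam: "0 < lam" and \<nu>: "0 < \<nu>1" "0 < \<nu>2"
    and \<gamma>: "Ck_on 1 {0..T} \<gamma>" "\<And>s. s \<in> {0..T} \<Longrightarrow> 0 < \<gamma> s" "1 / \<nu>2 \<le> \<gamma> t" "\<gamma> t \<le> 1 / \<nu>1"
    and v: "v = nth_deriv_on {0..T} 1 u"
    and c: "0 < c t" "c t \<le> \<nu>2"
    and du: "(u has_real_derivative v t) (at t within {0..T})"
    and dv: "(v has_real_derivative - (lam\<^sup>2 * (c t)\<^sup>2 * u t)) (at t within {0..T})"
  shows "\<exists>D. (energy T \<gamma> lam u 1 has_real_derivative D) (at t within {0..T}) \<and>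
     \<bar>D\<bar> \<le> ((1 + \<nu>2\<^sup>2) * \<bar>jet {0..T} \<gamma> t 1\<bar> + (4 * \<nu>2 ^ 3 / \<nu>1 * lam) * \<bar>\<gamma> t - 1 / c t\<bar>) * energy0 T lam u t"
proof -
  define g g1 E where "g = \<gamma> t" "g1 = jet {0..T} \<gamma> t 1" "E = energy0 T lam u t"
  note defs = this
  have dg: "(\<gamma> has_real_derivative g1) (at t within {0..T})"
    using nth_deriv_on_has_derivative[OF \<gamma>(1), of 0 t] T by (simp add: jet_def defs)
  have g: "0 < g" using \<gamma>(2)[OF T(2)] by (simp add: defs)
  have E: "lam\<^sup>2 * (u t)\<^sup>2 \<le> E" "lam * \<bar>u t * v t\<bar> \<le> E" "0 \<le> E" "(v t)\<^sup>2 + lam\<^sup>2 * (u t)\<^sup>2 = E"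
    using lam_abs_mult_le[OF lam, of "u t" "v t"] by (auto simp: energy0_def v defs)
  have e: "energy T \<gamma> lam u 1 = (\<lambda>s. \<gamma> s * ((v s)\<^sup>2 + lam\<^sup>2 * (1 / (\<gamma> s)\<^sup>2) * (u s)\<^sup>2))"
    by (simp add: coeff_of_def v)
  let ?\<delta> = "(c t)\<^sup>2 - 1 / g\<^sup>2"
  define D1 D2 where "D1 = g1 * ((v t)\<^sup>2 - 1 / g\<^sup>2 * (lam\<^sup>2 * (u t)\<^sup>2))"
    and "D2 = - (2 * lam * g * (lam * (u t * v t))) * ?\<delta>"
  have "(energy T \<gamma> lam u 1 has_real_derivative
      g * (2 * lam\<^sup>2 * u t * v t * (1 / g\<^sup>2 - (c t)\<^sup>2) - 2 * lam\<^sup>2 * g1 / g ^ 3 * (u t)\<^sup>2)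
      + g1 * ((v t)\<^sup>2 + lam\<^sup>2 * (1 / g\<^sup>2) * (u t)\<^sup>2)) (at t within {0..T})"
    unfolding e using DERIV_mult'[OF dg Q_has_derivative[where c = c, OF T lam \<gamma>(1,2) v du dv order.refl]] by (simp add: defs)
  moreover have "g * (2 * lam\<^sup>2 * u t * v t * (1 / g\<^sup>2 - (c t)\<^sup>2) - 2 * lam\<^sup>2 * g1 / g ^ 3 * (u t)\<^sup>2)
      + g1 * ((v t)\<^sup>2 + lam\<^sup>2 * (1 / g\<^sup>2) * (u t)\<^sup>2) = D1 + D2"
  proof -
    have "g * (2 * lam\<^sup>2 * g1 / g ^ 3 * (u t)\<^sup>2) = 2 * g1 * (1 / g\<^sup>2 * (lam\<^sup>2 * (u t)\<^sup>2))"
      using g by (simp add: power2_eq_square power3_eq_cube)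
    moreover have "g * (2 * lam\<^sup>2 * x * y * (h - d)) - 2 * g1 * (h * (lam\<^sup>2 * U)) + g1 * (V + lam\<^sup>2 * h * U)
        = g1 * (V - h * (lam\<^sup>2 * U)) + - (2 * lam * g * (lam * (x * y))) * (d - h)" for h d x y U V :: real
      by (simp add: algebra_simps power2_eq_square)
    ultimately show ?thesis unfolding right_diff_distrib[of g] D1_def D2_def by (simp only:)
  qed
  ultimately have D: "(energy T \<gamma> lam u 1 has_real_derivative D1 + D2) (at t within {0..T})" by simp
  have ig: "1 / g\<^sup>2 \<le> \<nu>2\<^sup>2" using wave_form_bounds(4)[OF \<nu> \<gamma>(3,4)] by (simp add: defs)
  have "\<bar>(v t)\<^sup>2 - 1 / g\<^sup>2 * (lam\<^sup>2 * (u t)\<^sup>2)\<bar> \<le> (1 + \<nu>2\<^sup>2) * E"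
  proof -
    have "1 / g\<^sup>2 * (lam\<^sup>2 * (u t)\<^sup>2) \<le> \<nu>2\<^sup>2 * E" using ig E by (intro mult_mono) auto
    moreover have "0 \<le> 1 / g\<^sup>2 * (lam\<^sup>2 * (u t)\<^sup>2)" "0 \<le> (v t)\<^sup>2" "0 \<le> lam\<^sup>2 * (u t)\<^sup>2" by auto
    ultimately show ?thesis unfolding distrib_right using E(4) by linarith
  qed
  then have "\<bar>g1\<bar> * \<bar>(v t)\<^sup>2 - 1 / g\<^sup>2 * (lam\<^sup>2 * (u t)\<^sup>2)\<bar> \<le> \<bar>g1\<bar> * ((1 + \<nu>2\<^sup>2) * E)"
    by (rule mult_left_mono) simp
  then have D1: "\<bar>D1\<bar> \<le> (1 + \<nu>2\<^sup>2) * \<bar>g1\<bar> * E"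
    by (simp add: D1_def abs_mult mult_ac)
  have "\<bar>D2\<bar> = (2 * lam * g * (lam * \<bar>u t * v t\<bar>)) * \<bar>?\<delta>\<bar>"
    using lam g by (simp add: D2_def abs_mult)
  also have "\<dots> \<le> (2 * lam * (1 / \<nu>1) * E) * (2 * \<nu>2 ^ 3 * \<bar>g - 1 / c t\<bar>)"
    using lam g E \<gamma>(3,4) \<nu> by (intro mult_mono square_difference_bound c) (auto simp: defs)
  finally have D2: "\<bar>D2\<bar> \<le> (4 * \<nu>2 ^ 3 / \<nu>1 * lam) * \<bar>g - 1 / c t\<bar> * E" by (simp add: mult_ac)
  have "\<bar>D1 + D2\<bar> \<le> ((1 + \<nu>2\<^sup>2) * \<bar>g1\<bar> + (4 * \<nu>2 ^ 3 / \<nu>1 * lam) * \<bar>g - 1 / c t\<bar>) * E"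
    unfolding distrib_right[of _ _ E] by (rule order_trans[OF abs_triangle_ineq add_mono[OF D1 D2]])
  with D show ?thesis unfolding defs by blast
qed

lemma error_term_eq:
  assumes "Ck_on k {0..T} \<gamma>"
  shows "error_term T k lam \<gamma> c = 1 / lam ^ (k - 1) * integral {0..T} (\<lambda>t. \<bar>nth_deriv_on {0..T} k \<gamma> t\<bar>)
     + lam * (LINT t:{0<..<T}|lebesgue. \<bar>\<gamma> t - 1 / c t\<bar>)"
proof -
  have "continuous_on {0..T} (\<lambda>t. \<bar>nth_deriv_on {0..T} k \<gamma> t\<bar>)"
    using assms by (intro continuous_intros) (simp add: Ck_on_def)
  then have "set_integrable lebesgue {0..T} (\<lambda>t. \<bar>nth_deriv_on {0..T} k \<gamma> t\<bar>)"
    by (rule absolutely_integrable_continuous_real)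
  from set_lebesgue_integral_eq_integral(2)[OF this] show ?thesis unfolding error_term_def by simp
qed

lemma exp_growth_weaken:
  assumes "e0 * exp (- J) \<le> (e :: real)" "e \<le> e0 * exp J" "0 \<le> e0" "J \<le> X"
  shows "e0 * exp (- X) \<le> e \<and> e \<le> e0 * exp X"
proof
  have "e0 * exp (- X) \<le> e0 * exp (- J)" using assms by (intro mult_left_mono) auto
  then show "e0 * exp (- X) \<le> e" using assms by linarith
  have "e0 * exp J \<le> e0 * exp X" using assms by (intro mult_left_mono) auto
  then show "e \<le> e0 * exp X" using assms by linarith
qed

theorem theorem4p1:
  fixes k :: nat and T \<nu>1 \<nu>2 :: real
  assumes "1 \<le> k" and "0 < T" and "0 < \<nu>1" and "0 < \<nu>2" and "\<nu>1 \<le> \<nu>2"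
  shows "\<exists>A B C \<epsilon> :: real. 0 < A \<and> 0 < B \<and> 0 < C \<and> 0 < \<epsilon> \<and>
    (\<forall>c \<gamma> :: real \<Rightarrow> real.
       c \<in> borel_measurable (lebesgue_on {0<..<T}) \<longrightarrow>
       (AE t\<in>{0<..<T} in lebesgue. \<nu>1 \<le> c t \<and> c t \<le> \<nu>2) \<longrightarrow>
       Ck_on k {0..T} \<gamma> \<longrightarrow>
       (\<forall>t\<in>{0..T}. 1 / \<nu>2 \<le> \<gamma> t \<and> \<gamma> t \<le> 1 / \<nu>1) \<longrightarrow>
       (\<forall>lam>0.
          (\<forall>t\<in>{0..T}. \<forall>j\<in>{1..k-1}. \<bar>nth_deriv_on {0..T} j \<gamma> t\<bar> \<le> \<epsilon> * lam ^ j) \<longrightarrow>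
          (\<forall>u. is_solution T c lam u \<longrightarrow>
             (\<forall>t\<in>{0..T}.
                A * energy0 T lam u t \<le> energy T \<gamma> lam u k t \<and>
                energy T \<gamma> lam u k t \<le> B * energy0 T lam u t) \<and>
             (\<forall>t\<in>{0..T}.
                energy T \<gamma> lam u k 0 * exp (- C * (1 / lam ^ (k - 1) + error_term T k lam \<gamma> c))
                  \<le> energy T \<gamma> lam u k t \<and>
                energy T \<gamma> lam u k t
                  \<le> energy T \<gamma> lam u k 0 * exp (C * (1 / lam ^ (k - 1) + error_term T k lam \<gamma> c))))))"
proof -
  define m where "m = k div 2"
  define A0 B0 where "A0 = min (1 / \<nu>2) \<nu>1" and "B0 = max (1 / \<nu>1) \<nu>2"
  have A0: "0 < A0" and B0: "0 < B0" using assms by (auto simp: A0_def B0_def less_max_iff_disj)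
  have M0: "0 \<le> 1 / \<nu>1" using assms by simp
  obtain K where K: "0 \<le> K" and KB: "\<And>i r x lam \<epsilon>. 1 \<le> i \<Longrightarrow> i \<le> m \<Longrightarrow> r \<le> 2 \<Longrightarrow> 0 < 2 * i - 2 + r \<Longrightarrow> 0 < lam \<Longrightarrow> 0 \<le> \<epsilon> \<Longrightarrow> \<epsilon> \<le> 1 \<Longrightarrow>
      \<bar>x 0\<bar> \<le> 1 / \<nu>1 \<Longrightarrow> (\<forall>j\<in>{1..2 * i - 2 + r}. \<bar>x j\<bar> \<le> \<epsilon> * lam ^ j) \<Longrightarrow>
      \<bar>coeff_jet i r x\<bar> \<le> K * \<epsilon> * lam ^ (2 * i - 2 + r)"
    using coeff_jet_bounds[OF M0, of m] by metis
  define R where "R = real m * (K * (3 + \<nu>2\<^sup>2))"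
  have R: "0 \<le> R" using K by (simp add: R_def)
  \<comment> \<open>R \<epsilon> is the relative deviation from the leading term; held below A0 / 2
    it leaves half of the lower constant. R may be 0, as for k = 1, hence R + 1. The cap 1 is what
    the coefficient bounds ask of \<epsilon>.\<close>
  define \<epsilon> where "\<epsilon> = min 1 (A0 / (2 * (R + 1)))"
  have \<epsilon>: "0 < \<epsilon>" "\<epsilon> \<le> 1" using A0 R by (auto simp: \<epsilon>_def)
  have R\<epsilon>: "R * \<epsilon> \<le> A0 / 2"
  proof -
    have "R * \<epsilon> \<le> (R + 1) * (A0 / (2 * (R + 1)))"
      using R A0 by (intro mult_mono) (auto simp: \<epsilon>_def)
    moreover have "x * (A0 / (2 * x)) = A0 / 2" if "x \<noteq> 0" for x :: real using that by simp
    ultimately show ?thesis using R by (metis add_nonneg_eq_0_iff zero_le_one zero_neq_one)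
  qed
  define A B where "A = A0 / 2" and "B = B0 + A0 / 2"
  have AB: "0 < A" "0 < B" using A0 B0 by (auto simp: A_def B_def)
  have close: "A * energy0 T lam u t \<le> energy T \<gamma> lam u k t \<and> energy T \<gamma> lam u k t \<le> B * energy0 T lam u t"
    if \<gamma>: "Ck_on k {0..T} \<gamma>" "\<forall>t\<in>{0..T}. 1 / \<nu>2 \<le> \<gamma> t \<and> \<gamma> t \<le> 1 / \<nu>1" and lam: "0 < lam"
      and small: "\<forall>t\<in>{0..T}. \<forall>j\<in>{1..k-1}. \<bar>nth_deriv_on {0..T} j \<gamma> t\<bar> \<le> \<epsilon> * lam ^ j" and t: "t \<in> {0..T}"
    for \<gamma> lam u t
  proof -
    define v where "v = nth_deriv_on {0..T} 1 u"
    define Q E where "Q = \<gamma> t * ((v t)\<^sup>2 + lam\<^sup>2 * (1 / (\<gamma> t)\<^sup>2) * (u t)\<^sup>2)" and "E = energy0 T lam u t"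
    have gt: "1 / \<nu>2 \<le> \<gamma> t" "\<gamma> t \<le> 1 / \<nu>1" using \<gamma>(2) t by auto
    have E0: "0 \<le> E" by (simp add: E_def energy0_def)
    have Q: "A0 * E \<le> Q" "Q \<le> B0 * E"
      using wave_form_bounds(1,2)[OF assms(3,4) gt, of "v t" lam "u t"]
      by (simp_all add: A0_def B0_def Q_def E_def energy0_def v_def)
    have "\<bar>energy T \<gamma> lam u k t - Q\<bar> \<le> A0 / 2 * E"
    proof (cases "k = 1")
      case True
      then have "energy T \<gamma> lam u k t = Q" by (simp add: coeff_of_def Q_def v_def)
      then show ?thesis using A0 E0 by simp
    next
      case False
      then have "2 \<le> k" using assms(1) by simp
      have "\<bar>energy T \<gamma> lam u k t - Q\<bar> \<le> real (k div 2) * (K * \<epsilon> * (3 + \<nu>2\<^sup>2)) * energy0 T lam u t"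
        unfolding Q_def using \<epsilon>
        by (intro energy_close[OF assms(2) t lam assms(3,4) K _ _ \<gamma>(1) gt v_def bspec[OF small t] KB[unfolded m_def] \<open>2 \<le> k\<close>]) auto
      also have "\<dots> = (R * \<epsilon>) * E" by (simp add: R_def E_def m_def mult_ac)
      also have "\<dots> \<le> A0 / 2 * E" by (rule mult_right_mono[OF R\<epsilon> E0])
      finally show ?thesis .
    qed
    moreover have "A0 / 2 * E = A0 * E / 2" by simp
    ultimately show ?thesis using Q unfolding E_def[symmetric] A_def B_def distrib_right
      by (intro conjI) linarith+
  qed
  have "\<exists>C>0. \<forall>(c :: real \<Rightarrow> real) \<gamma> lam u. c \<in> borel_measurable (lebesgue_on {0<..<T}) \<longrightarrow>
       (AE t\<in>{0<..<T} in lebesgue. \<nu>1 \<le> c t \<and> c t \<le> \<nu>2) \<longrightarrow>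
       Ck_on k {0..T} \<gamma> \<longrightarrow>
       (\<forall>t\<in>{0..T}. 1 / \<nu>2 \<le> \<gamma> t \<and> \<gamma> t \<le> 1 / \<nu>1) \<longrightarrow> 0 < lam \<longrightarrow>
       (\<forall>t\<in>{0..T}. \<forall>j\<in>{1..k-1}. \<bar>nth_deriv_on {0..T} j \<gamma> t\<bar> \<le> \<epsilon> * lam ^ j) \<longrightarrow>
       is_solution T c lam u \<longrightarrow>
       (\<forall>t\<in>{0..T}.
          energy T \<gamma> lam u k 0 * exp (- (C * (1 / lam ^ (k - 1) + error_term T k lam \<gamma> c)))
                  \<le> energy T \<gamma> lam u k t \<and>
                energy T \<gamma> lam u k t
                  \<le> energy T \<gamma> lam u k 0 * exp (C * (1 / lam ^ (k - 1) + error_term T k lam \<gamma> c)))"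
  proof -
    \<comment> \<open>The surviving polynomial of weight k; for k = 1 it is \<gamma>'.
      \<open>p0\<close> and \<open>q0\<close> are the constants of the two derivative bounds,
      stripped of powers of \<open>lam\<close>.\<close>
    define W where "W = (if k = 1 then (\<lambda>x. x 1) else coeff_jet m (2 + k mod 2))"
    define p0 q0 where "p0 = (if k = 1 then 1 + \<nu>2\<^sup>2 else 1)"
      and "q0 = (if k = 1 then 4 * \<nu>2 ^ 3 / \<nu>1 else real m * (2 * \<nu>2 ^ 3 * (3 * K + 2 / \<nu>1)))"
    have pq: "0 < p0" "0 \<le> q0" using assms K by (auto simp: p0_def q0_def add_pos_nonneg)
    have Wk: "diff_hom k W"
    proof (cases "k = 1")
      case True
      then show ?thesis using diff_hom.coord[of 1] by (simp add: W_def)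
    next
      case False
      then have "1 \<le> m" "2 * m - 2 + (2 + k mod 2) = k" using assms(1) unfolding m_def by presburger+
      with False diff_hom_coeff_jet[of m "2 + k mod 2"] show ?thesis by (simp add: W_def)
    qed
    have "\<exists>Cw>0. \<forall>\<gamma>. Ck_on k {0..T} \<gamma> \<longrightarrow> (\<forall>t\<in>{0..T}. \<bar>\<gamma> t\<bar> \<le> 1 / \<nu>1) \<longrightarrow>
      integral {0..T} (\<lambda>t. \<bar>W (jet {0..T} \<gamma> t)\<bar>)
      \<le> Cw * (1 + integral {0..T} (\<lambda>t. \<bar>nth_deriv_on {0..T} k \<gamma> t\<bar>))"
    proof (cases "k = 1")
      case True
      then show ?thesis by (intro exI[of _ 1]) (simp add: W_def jet_def)
    next
      case False
      then show ?thesis using integral_along_jet_bound[OF Wk _ assms(2) M0] assms(1) by simp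
    qed
    then obtain Cw where "0 < Cw" and Cw: "\<And>\<gamma>. Ck_on k {0..T} \<gamma> \<Longrightarrow> (\<forall>t\<in>{0..T}. \<bar>\<gamma> t\<bar> \<le> 1 / \<nu>1) \<Longrightarrow>
      integral {0..T} (\<lambda>t. \<bar>W (jet {0..T} \<gamma> t)\<bar>)
      \<le> Cw * (1 + integral {0..T} (\<lambda>t. \<bar>nth_deriv_on {0..T} k \<gamma> t\<bar>))" by blast
    \<comment> \<open>The sum dominates both the coefficient \<open>p0 * Cw\<close> of the
      derivative part and the coefficient \<open>q0\<close> of |\<gamma> - 1/c|; A comes from
      trading \<open>energy0\<close> for the energy.\<close>
    define C where "C = (p0 * Cw + q0) / A"
    have "0 < C" using pq \<open>0 < Cw\<close> AB by (simp add: C_def add_pos_nonneg)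
    show ?thesis
    proof (rule exI[of _ C], rule conjI[OF \<open>0 < C\<close>], intro allI impI ballI, goal_cases)
      case (1 c \<gamma> lam u t)
      note c = 1(1,2) and \<gamma> = 1(3,4) and lam = 1(5) and small = 1(6) and u = 1(7) and t = 1(8)
      define v where "v = nth_deriv_on {0..T} 1 u"
      have pos: "0 < \<gamma> s" if "s \<in> {0..T}" for s
        using \<gamma>(2) that assms(4) less_le_trans[of 0 "1 / \<nu>2" "\<gamma> s"] by simp
      have c\<gamma>: "continuous_on {0..T} \<gamma>" using continuous_on_jet[OF \<gamma>(1), of 0] by (simp add: jet_def)
      have cW: "continuous_on {0..T} (\<lambda>t. W (jet {0..T} \<gamma> t))"
        by (rule continuous_on_along_jet[OF Wk \<gamma>(1)]) simp
      have dom: "dominated_on {0..T} v (energy T \<gamma> lam u k)"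
        by (rule dominated_on_energy[OF assms(2) \<gamma>(1) pos assms(1) _ v_def])
          (use u in \<open>simp_all add: is_solution_def\<close>)
      note low = close[OF \<gamma> lam small, THEN conjunct1]
      define p q where "p = p0 / lam ^ (k - 1)" and "q = q0 * lam"
      have pq': "0 \<le> p" "0 \<le> q" using pq lam by (auto simp: p_def q_def)
      have der: "\<exists>D. (energy T \<gamma> lam u k has_real_derivative D) (at s within {0..T}) \<and>
         \<bar>D\<bar> \<le> (p * \<bar>W (jet {0..T} \<gamma> s)\<bar> + q * \<bar>\<gamma> s - 1 / c s\<bar>) * energy0 T lam u s"
        if s: "s \<in> {0<..<T}" "\<nu>1 \<le> c s" "c s \<le> \<nu>2"
          "(u has_real_derivative v s) (at s within {0..T})"
          "(v has_real_derivative - (lam\<^sup>2 * (c s)\<^sup>2 * u s)) (at s within {0..T})" for s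
      proof -
        have s': "s \<in> {0..T}" "0 < c s" using s assms(3) by auto
        have gs: "1 / \<nu>2 \<le> \<gamma> s" "\<gamma> s \<le> 1 / \<nu>1" using \<gamma>(2) s' by auto
        show ?thesis
        proof (cases "k = 1")
          case True
          have eqs: "W = (\<lambda>x. x 1)" "p = 1 + \<nu>2\<^sup>2" "q = 4 * \<nu>2 ^ 3 / \<nu>1 * lam"
            using True by (simp_all add: W_def p_def q_def p0_def q0_def)
          have "Ck_on 1 {0..T} \<gamma>" using \<gamma>(1) True by simp
          then show ?thesis unfolding eqs True
            by (rule energy_one_derivative_bound[where c = c and u = u and v = v and \<gamma> = \<gamma> and t = s, OF assms(2) s'(1) lam assms(3,4) _ pos gs v_def s'(2) s(3-5)])
        next
          case False
          then have k2: "2 \<le> k" using assms(1) by simp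
          have eqs: "W = coeff_jet (k div 2) (2 + k mod 2)" "p = 1 / lam ^ (k - 1)"
            "q = real (k div 2) * (2 * \<nu>2 ^ 3 * (3 * K + 2 / \<nu>1)) * lam"
            using False by (simp_all only: W_def p_def q_def p0_def q0_def m_def if_False)
          show ?thesis unfolding eqs
            by (rule energy_derivative_bound[where c = c and \<epsilon> = \<epsilon> and K = K and u = u and v = v and \<gamma> = \<gamma> and t = s and k = k, OF assms(2) s'(1) lam assms(3,4) K
                  less_imp_le[OF \<epsilon>(1)] \<epsilon>(2) \<gamma>(1) gs v_def bspec[OF small s'(1)] _ k2 s'(2) s(3) pos s(4,5)])
              (rule KB[unfolded m_def])
        qed
      qed
      define I X where "I = integral {0..T} (\<lambda>t. \<bar>nth_deriv_on {0..T} k \<gamma> t\<bar>)"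
        and "X = (LINT t:{0<..<T}|lebesgue. \<bar>\<gamma> t - 1 / c t\<bar>)"
      have IX: "0 \<le> I" "0 \<le> X"
        unfolding I_def X_def
        by (rule integral_nonneg) (use continuous_on_jet[OF \<gamma>(1), of k] in
            \<open>auto simp: jet_def set_lebesgue_integral_def intro!: integrable_continuous_real continuous_intros integral_nonneg_AE\<close>)
      have "(p * integral {0..T} (\<lambda>t. \<bar>W (jet {0..T} \<gamma> t)\<bar>) + q * X) / A
          \<le> C * (1 / lam ^ (k - 1) + error_term T k lam \<gamma> c)"
      proof -
        have "\<forall>t\<in>{0..T}. \<bar>\<gamma> t\<bar> \<le> 1 / \<nu>1"
        proof
          fix s assume "s \<in> {0..T}"
          then show "\<bar>\<gamma> s\<bar> \<le> 1 / \<nu>1" using \<gamma>(2) pos[of s] by simp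
        qed
        \<comment> \<open>The additive 1 in \<open>Cw * (1 + I)\<close> is the origin of the term
          \<open>1 / lam ^ (k - 1)\<close> in the exponent.\<close>
        then have "p * integral {0..T} (\<lambda>t. \<bar>W (jet {0..T} \<gamma> t)\<bar>) \<le> p * (Cw * (1 + I))"
          unfolding I_def by (intro mult_left_mono Cw \<gamma>(1) pq')
        then have "p * integral {0..T} (\<lambda>t. \<bar>W (jet {0..T} \<gamma> t)\<bar>) + q * X \<le> (p0 * Cw) * ((1 + I) / lam ^ (k - 1)) + q0 * (lam * X)"
          by (simp add: p_def q_def mult_ac)
        also have "\<dots> \<le> (p0 * Cw + q0) * ((1 + I) / lam ^ (k - 1)) + (p0 * Cw + q0) * (lam * X)"
          using pq \<open>0 < Cw\<close> IX lam by (intro add_mono mult_right_mono) auto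
        also have "\<dots> = (p0 * Cw + q0) * (1 / lam ^ (k - 1) + error_term T k lam \<gamma> c)"
          unfolding error_term_eq[OF \<gamma>(1)] I_def[symmetric] X_def[symmetric]
          by (simp add: distrib_left add_divide_distrib)
        finally show ?thesis using AB(1) by (simp add: C_def divide_right_mono)
      qed
      note J = this
      note growth = energy_growth_bound[where c = c and u = u and v = v and \<gamma> = \<gamma> and W = "\<lambda>t. W (jet {0..T} \<gamma> t)" and e = "energy T \<gamma> lam u k", OF assms(2) AB(1) pq' assms(3) c c\<gamma> \<gamma>(2) cW u v_def dom low der t]
      have "0 \<le> energy T \<gamma> lam u k 0"
      proof -
        have "0 \<le> A * energy0 T lam u 0" using AB(1) by (simp add: energy0_def)
        also have "\<dots> \<le> energy T \<gamma> lam u k 0" by (rule low) (use assms(2) in simp)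
        finally show ?thesis .
      qed
      from exp_growth_weaken[OF growth this J[unfolded X_def]] show ?case .
    qed
  qed
  then obtain C where "0 < C" and C: "\<And>(c :: real \<Rightarrow> real) \<gamma> lam u t. c \<in> borel_measurable (lebesgue_on {0<..<T}) \<Longrightarrow>
       (AE t\<in>{0<..<T} in lebesgue. \<nu>1 \<le> c t \<and> c t \<le> \<nu>2) \<Longrightarrow>
       Ck_on k {0..T} \<gamma> \<Longrightarrow>
       (\<forall>t\<in>{0..T}. 1 / \<nu>2 \<le> \<gamma> t \<and> \<gamma> t \<le> 1 / \<nu>1) \<Longrightarrow> 0 < lam \<Longrightarrow>
       (\<forall>t\<in>{0..T}. \<forall>j\<in>{1..k-1}. \<bar>nth_deriv_on {0..T} j \<gamma> t\<bar> \<le> \<epsilon> * lam ^ j) \<Longrightarrow>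
       is_solution T c lam u \<Longrightarrow> t \<in> {0..T} \<Longrightarrow>
          energy T \<gamma> lam u k 0 * exp (- (C * (1 / lam ^ (k - 1) + error_term T k lam \<gamma> c)))
                  \<le> energy T \<gamma> lam u k t \<and>
                energy T \<gamma> lam u k t
                  \<le> energy T \<gamma> lam u k 0 * exp (C * (1 / lam ^ (k - 1) + error_term T k lam \<gamma> c))"
    by blast
  show ?thesis
  proof (rule exI[of _ A], rule exI[of _ B], rule exI[of _ C], rule exI[of _ \<epsilon>],
      intro conjI[OF AB(1)] conjI[OF AB(2)] conjI[OF \<open>0 < C\<close>] conjI[OF \<epsilon>(1)] allI impI, goal_cases)
    case (1 c \<gamma> lam u)
    show ?case
      unfolding mult_minus_left using close[OF 1(3-6)] C[OF 1] by blast
  qed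
qed

end
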